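(* Let $X=X(\mathbb R)$ be a Banach lattice on $\mathbb R$ satisfying Assumption A, and let $r,s\in\mathbb N$. Let $\mathcal K_{\sigma,r}$ be the Kantorovich-type operators described in the context, and suppose that there exist constants $C_1,C_2>0$ such that $$\|\mathcal K_{\sigma,r}f\|_X\le C_1\|f\|_X\quad\text{for all } f\in X,\ \sigma\ge1,$$ $$\|g-\mathcal K_{\sigma,r}g\|_X\le C_2\,\sigma^{-s}\|g^{(s)}\|_X\quad\text{for all } g\in\mathcal B_X^\sigma,\ \sigma\ge1.$$ Then there is a constant $C>0$, independent of $f$ and $\sigma$, such that for all $f\in X$ and all $\sigma\ge1$ $$\|f-\mathcal K_{\sigma,r}f\|_X\le C\,\|(I-\dot A_{\gamma/\sigma})^s f\|_X .$$
   Context: **Banach lattice.** $\mu$ is Lebesgue measure on $\mathbb R$. A Banach lattice $X$ on $\mathbb R$ is a Banach space of measurable functions on $\mathbb R$ with norm $\|\cdot\|_X$ such that: (1) if $f$ is measurable, $g\in X$ and $|f|\le|g|$, then $f\in X$ and $\|f\|_X\le\|g\|_X$; (2) if $f_n\in X$, $\sup_n\|f_n\|_X<\infty$ and $0\le f_n\uparrow f$, then $f\in X$ and $\|f_n\|_X\to\|f\|_X$; (3) if $E\subset\mathbb R$ is measurable with $\mu(E)<\infty$, then $\chi_E\in X$ and there is $c_E>0$ with $\int_E|f|\,d\mu\le c_E\|f\|_X$ for all $f\in X$. **Steklov averages.** For locally integrable $f$ and $h>0$: $A_hf(x)=\frac1h\int_{x-h/2}^{x+h/2}f(t)\,dt$,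 $\dot A_hf(x)=A_hf(x+h/2)=\frac1h\int_x^{x+h}f(t)\,dt$, and $A_{h,r}f=\sum_{k=1}^r(-1)^{k+1}\binom rk A_h^kf=f-(I-A_h)^rf$. **Assumption A.** For all $f\in X$ and $h>0$, $A_hf\in X$, and $\sup_{h>0}\sup_{\|f\|_X\le1}\|A_hf\|_X<\infty$. **Spaces.** $\mathcal B_X^\sigma=\{\varphi\in X\cap\mathcal S'(\mathbb R):\operatorname{supp}\widehat\varphi\subset[-\sigma,\sigma]\}$, with $\widehat\varphi$ the distributional Fourier transform. $(\Phi_\sigma)_{\sigma}$ is a nested family of linear subspaces of $X$ ($\Phi_{\sigma'}\subset\Phi_\sigma$ for $\sigma'\le\sigma$, $\Phi_0=\{0\}$) satisfying the Bernstein inequality: there is $B>0$ depending only on $X$ with $\|\varphi^{(k)}\|_X\le(B\sigma)^k\|\varphi\|_X$ for all $k\in\mathbb N$, $\varphi\in\Phi_\sigma$ (in particular the derivatives exist and lie in $X$). **Operators.** $\varphi_{k,\sigma}\in\Phi_\sigma$, $k\in\mathbb Z$, and $(x_{k,\sigma})_{k\in\mathbb Z}\subset\mathbb R$ are distinct points for which there are positive constants $\gamma,\gamma'$ (independent of $\sigma,k$) with $\frac\gamma\sigma\le x_{k+1,\sigma}-x_{k,\sigma}\le\frac{\gamma'}\sigma$, $k\in\mathbb Z$. Then $$\mathcal K_{\sigma,r}f(x)=\sum_{k\in\mathbb Z}A_{\gamma/\sigma,r}f(x_{k,\sigma})\,\varphi_{k,\sigma}(x).$$ **Standing assumptions.**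 The series defining $\mathcal K_{\sigma,r}f$ converges in the norm of $X$ for every $f\in X$. To guarantee this when the kernels $\varphi_{k,\sigma}$ are not compactly supported, it is additionally required that $X$ has order continuous norm ($f_n\downarrow0$ a.e. implies $\|f_n\|_X\to0$) and contains the Schwartz space $\mathcal S$ as a dense subspace. *)

theory Defs
  imports "HOL-Analysis.Analysis"
begin

text \<open>
  Functions are Lebesgue measurable and complex valued. Elements of \<open>X\<close> are functions rather than
  classes, so all (in)equalities between them are meant almost everywhere; \<open>solid\<close> makes
  membership in \<open>X\<close> and the value of the norm independent of the representative. The value of
  \<open>nrm\<close> matters only on \<open>X\<close>.
\<close>

locale banach_lattice =
  fixes X :: "(real \<Rightarrow> complex) set" and nrm :: "(real \<Rightarrow> complex) \<Rightarrow> real"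
  assumes meas: "f \<in> X \<Longrightarrow> f \<in> borel_measurable lebesgue"
    and zero_mem: "(\<lambda>x. 0) \<in> X"
    and add_mem: "f \<in> X \<Longrightarrow> g \<in> X \<Longrightarrow> (\<lambda>x. f x + g x) \<in> X"
    and scale_mem: "f \<in> X \<Longrightarrow> (\<lambda>x. c * f x) \<in> X"
    and nrm_nonneg: "f \<in> X \<Longrightarrow> 0 \<le> nrm f"
    and nrm_eq_0_iff: "f \<in> X \<Longrightarrow> nrm f = 0 \<longleftrightarrow> (AE x in lebesgue. f x = 0)"
    and nrm_triangle: "f \<in> X \<Longrightarrow> g \<in> X \<Longrightarrow> nrm (\<lambda>x. f x + g x) \<le> nrm f + nrm g"
    and nrm_scale: "f \<in> X \<Longrightarrow> nrm (\<lambda>x. c * f x) = cmod c * nrm f"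
    and complete:
      "(\<And>n. u n \<in> X) \<Longrightarrow>
       (\<And>e. e > 0 \<Longrightarrow> \<exists>N. \<forall>m\<ge>N. \<forall>n\<ge>N. nrm (\<lambda>x. u m x - u n x) < e) \<Longrightarrow>
       \<exists>f\<in>X. (\<lambda>n. nrm (\<lambda>x. u n x - f x)) \<longlonglongrightarrow> 0"
    and solid:
      "f \<in> borel_measurable lebesgue \<Longrightarrow> g \<in> X \<Longrightarrow>
       (AE x in lebesgue. cmod (f x) \<le> cmod (g x)) \<Longrightarrow> f \<in> X \<and> nrm f \<le> nrm g"
    and fatou:
      "(\<And>n. (\<lambda>x. complex_of_real (w n x)) \<in> X) \<Longrightarrow>
       bdd_above (range (\<lambda>n. nrm (\<lambda>x. complex_of_real (w n x)))) \<Longrightarrow>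
       v \<in> borel_measurable lebesgue \<Longrightarrow>
       (AE x in lebesgue. (\<forall>n. 0 \<le> w n x) \<and> incseq (\<lambda>n. w n x) \<and> (\<lambda>n. w n x) \<longlonglongrightarrow> v x) \<Longrightarrow>
       (\<lambda>x. complex_of_real (v x)) \<in> X \<and>
       (\<lambda>n. nrm (\<lambda>x. complex_of_real (w n x))) \<longlonglongrightarrow> nrm (\<lambda>x. complex_of_real (v x))"
    and indicator_mem:
      "E \<in> sets lebesgue \<Longrightarrow> emeasure lebesgue E < \<infinity> \<Longrightarrow> (indicator E :: real \<Rightarrow> complex) \<in> X"
    and local_L1:
      "E \<in> sets lebesgue \<Longrightarrow> emeasure lebesgue E < \<infinity> \<Longrightarrow>
       \<exists>c>0. \<forall>f\<in>X. (\<integral>\<^sup>+x\<in>E. ennreal (cmod (f x)) \<partial>lebesgue) \<le> ennreal (c * nrm f)"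

subsection \<open>Steklov averages\<close>

text \<open>The integrals are over \<open>lebesgue\<close>, not \<open>lborel\<close>: elements of \<open>X\<close> need not be Borel.\<close>

definition steklov :: "real \<Rightarrow> (real \<Rightarrow> complex) \<Rightarrow> real \<Rightarrow> complex" where
  "steklov h f x = (1 / h) *\<^sub>R (LINT t:{x - h/2..x + h/2}|lebesgue. f t)"

definition steklov_fwd :: "real \<Rightarrow> (real \<Rightarrow> complex) \<Rightarrow> real \<Rightarrow> complex" where
  "steklov_fwd h f x = steklov h f (x + h/2)"

definition steklov_comb :: "real \<Rightarrow> nat \<Rightarrow> (real \<Rightarrow> complex) \<Rightarrow> real \<Rightarrow> complex" where
  "steklov_comb h r f x =
     (\<Sum>k=1..r. (-1) ^ (k + 1) * of_nat (r choose k) * (steklov h ^^ k) f x)"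

definition I_minus_steklov_fwd :: "real \<Rightarrow> (real \<Rightarrow> complex) \<Rightarrow> real \<Rightarrow> complex" where
  "I_minus_steklov_fwd h f x = f x - steklov_fwd h f x"

definition assumption_A ::
  "(real \<Rightarrow> complex) set \<Rightarrow> ((real \<Rightarrow> complex) \<Rightarrow> real) \<Rightarrow> bool" where
  "assumption_A X nrm \<longleftrightarrow>
     (\<forall>f\<in>X. \<forall>h>0. steklov h f \<in> X) \<and>
     (\<exists>M. \<forall>h>0. \<forall>f\<in>X. nrm f \<le> 1 \<longrightarrow> nrm (steklov h f) \<le> M)"

subsection \<open>Derivatives, Schwartz functions, tempered distributions\<close>

definition nth_deriv :: "nat \<Rightarrow> (real \<Rightarrow> complex) \<Rightarrow> real \<Rightarrow> complex" where
  "nth_deriv n f = ((\<lambda>g x. vector_derivative g (at x)) ^^ n) f"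

definition smooth :: "(real \<Rightarrow> complex) \<Rightarrow> bool" where
  "smooth f \<longleftrightarrow> (\<forall>n x. nth_deriv n f differentiable (at x))"

definition schwartz :: "(real \<Rightarrow> complex) set" where
  "schwartz = {\<psi>. smooth \<psi> \<and> (\<forall>m n. bounded (range (\<lambda>x. \<bar>x\<bar> ^ m *\<^sub>R nth_deriv n \<psi> x)))}"

definition schwartz_seminorm :: "nat \<Rightarrow> nat \<Rightarrow> (real \<Rightarrow> complex) \<Rightarrow> real" where
  "schwartz_seminorm m n \<psi> = (SUP x. \<bar>x\<bar> ^ m * cmod (nth_deriv n \<psi> x))"

definition test_functions :: "real set \<Rightarrow> (real \<Rightarrow> complex) set" where
  "test_functions V =
     {\<psi>. smooth \<psi> \<and> compact (closure {x. \<psi> x \<noteq> 0}) \<and> closure {x. \<psi> x \<noteq> 0} \<subseteq> V}"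

definition tempered_distribution :: "((real \<Rightarrow> complex) \<Rightarrow> complex) \<Rightarrow> bool" where
  "tempered_distribution T \<longleftrightarrow>
     (\<forall>\<psi>\<in>schwartz. \<forall>\<eta>\<in>schwartz. T (\<lambda>x. \<psi> x + \<eta> x) = T \<psi> + T \<eta>) \<and>
     (\<forall>\<psi>\<in>schwartz. \<forall>c. T (\<lambda>x. c * \<psi> x) = c * T \<psi>) \<and>
     (\<exists>C N. \<forall>\<psi>\<in>schwartz. cmod (T \<psi>) \<le> C * (\<Sum>m\<le>N. \<Sum>n\<le>N. schwartz_seminorm m n \<psi>))"

definition fourier :: "(real \<Rightarrow> complex) \<Rightarrow> real \<Rightarrow> complex" where
  "fourier \<psi> \<xi> = (LINT x|lebesgue. \<psi> x * exp (- (\<i> * complex_of_real (\<xi> * x))))"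

definition dist_fourier ::
  "((real \<Rightarrow> complex) \<Rightarrow> complex) \<Rightarrow> (real \<Rightarrow> complex) \<Rightarrow> complex" where
  "dist_fourier T \<psi> = T (fourier \<psi>)"

definition dist_support :: "((real \<Rightarrow> complex) \<Rightarrow> complex) \<Rightarrow> real set" where
  "dist_support U = {\<xi>. \<forall>V. open V \<and> \<xi> \<in> V \<longrightarrow> (\<exists>\<psi>\<in>test_functions V. U \<psi> \<noteq> 0)}"

text \<open>\<open>T\<close> is the (unique) tempered distribution given by the locally integrable function \<open>f\<close>.\<close>

definition represents ::
  "((real \<Rightarrow> complex) \<Rightarrow> complex) \<Rightarrow> (real \<Rightarrow> complex) \<Rightarrow> bool" where
  "represents T f \<longleftrightarrow> tempered_distribution T \<and>
     (\<forall>\<psi>\<in>test_functions UNIV. T \<psi> = (LINT x|lebesgue. f x * \<psi> x))"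

subsection \<open>The spaces\<close>

text \<open>
  By Paley--Wiener--Schwartz every band-limited tempered function agrees almost everywhere with a
  (unique) smooth function. The classes in the space are listed by these representatives, so that
  \<open>nth_deriv\<close> is the derivative of the class.
\<close>

definition band_limited :: "(real \<Rightarrow> complex) set \<Rightarrow> real \<Rightarrow> (real \<Rightarrow> complex) set" where
  "band_limited X \<sigma> =
     {\<phi>\<in>X. smooth \<phi> \<and> (\<exists>T. represents T \<phi> \<and> dist_support (dist_fourier T) \<subseteq> {-\<sigma>..\<sigma>})}"

definition bernstein_family ::
  "(real \<Rightarrow> complex) set \<Rightarrow> ((real \<Rightarrow> complex) \<Rightarrow> real) \<Rightarrow>
   (real \<Rightarrow> (real \<Rightarrow> complex) set) \<Rightarrow> bool" where
  "bernstein_family X nrm \<Phi> \<longleftrightarrow>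
     (\<forall>\<sigma>\<ge>0. \<Phi> \<sigma> \<subseteq> X \<and> (\<lambda>x. 0) \<in> \<Phi> \<sigma> \<and>
        (\<forall>f\<in>\<Phi> \<sigma>. \<forall>g\<in>\<Phi> \<sigma>. (\<lambda>x. f x + g x) \<in> \<Phi> \<sigma>) \<and>
        (\<forall>f\<in>\<Phi> \<sigma>. \<forall>c. (\<lambda>x. c * f x) \<in> \<Phi> \<sigma>)) \<and>
     (\<forall>\<sigma>' \<sigma>. 0 \<le> \<sigma>' \<and> \<sigma>' \<le> \<sigma> \<longrightarrow> \<Phi> \<sigma>' \<subseteq> \<Phi> \<sigma>) \<and>
     \<Phi> 0 = {\<lambda>x. 0} \<and>
     (\<exists>B>0. \<forall>\<sigma>\<ge>0. \<forall>\<phi>\<in>\<Phi> \<sigma>. smooth \<phi> \<and>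
        (\<forall>k. nth_deriv k \<phi> \<in> X \<and> nrm (nth_deriv k \<phi>) \<le> (B * \<sigma>) ^ k * nrm \<phi>))"

definition order_continuous_norm ::
  "(real \<Rightarrow> complex) set \<Rightarrow> ((real \<Rightarrow> complex) \<Rightarrow> real) \<Rightarrow> bool" where
  "order_continuous_norm X nrm \<longleftrightarrow>
     (\<forall>w :: nat \<Rightarrow> real \<Rightarrow> real. (\<forall>n. (\<lambda>x. complex_of_real (w n x)) \<in> X) \<and>
        (AE x in lebesgue. decseq (\<lambda>n. w n x) \<and> (\<lambda>n. w n x) \<longlonglongrightarrow> 0) \<longrightarrow>
        (\<lambda>n. nrm (\<lambda>x. complex_of_real (w n x))) \<longlonglongrightarrow> 0)"

definition schwartz_dense ::
  "(real \<Rightarrow> complex) set \<Rightarrow> ((real \<Rightarrow> complex) \<Rightarrow> real) \<Rightarrow> bool" where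
  "schwartz_dense X nrm \<longleftrightarrow>
     schwartz \<subseteq> X \<and> (\<forall>f\<in>X. \<forall>e>0. \<exists>\<psi>\<in>schwartz. nrm (\<lambda>x. f x - \<psi> x) < e)"

subsection \<open>Kantorovich-type operators\<close>

text \<open>
  The series over the integers is summed by symmetric partial sums, the weakest of the usual
  notions of convergence; its sum is determined up to almost everywhere equality.
\<close>

definition kantorovich_sum ::
  "(real \<Rightarrow> complex) set \<Rightarrow> ((real \<Rightarrow> complex) \<Rightarrow> real) \<Rightarrow> real \<Rightarrow> nat \<Rightarrow>
   (int \<Rightarrow> real) \<Rightarrow> (int \<Rightarrow> real \<Rightarrow> complex) \<Rightarrow>
   (real \<Rightarrow> complex) \<Rightarrow> (real \<Rightarrow> complex) \<Rightarrow> bool" where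
  "kantorovich_sum X nrm h r x \<phi> f F \<longleftrightarrow> F \<in> X \<and>
     (\<lambda>n::nat. nrm (\<lambda>t. F t - (\<Sum>k=-int n..int n. steklov_comb h r f (x k) * \<phi> k t)))
       \<longlonglongrightarrow> 0"

definition kantorovich ::
  "(real \<Rightarrow> complex) set \<Rightarrow> ((real \<Rightarrow> complex) \<Rightarrow> real) \<Rightarrow> real \<Rightarrow> nat \<Rightarrow>
   (int \<Rightarrow> real) \<Rightarrow> (int \<Rightarrow> real \<Rightarrow> complex) \<Rightarrow> (real \<Rightarrow> complex) \<Rightarrow> real \<Rightarrow> complex" where
  "kantorovich X nrm h r x \<phi> f = (SOME F. kantorovich_sum X nrm h r x \<phi> f F)"

end

theory Submission
  imports Defs "HOL-Probability.Sinc_Integral" "HOL-Complex_Analysis.Complex_Analysis" "HOL-Real_Asymp.Real_Asymp"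
begin

text \<open>
  Put \<open>h = \<gamma> / \<sigma>\<close>, let \<open>A\<close> be the forward average of step \<open>h\<close> and \<open>\<Delta> = I - A\<close>. The theorem rests on an
  approximation result about \<open>X\<close> alone (\<open>band_limited_approximation\<close>): every \<open>f\<close> in \<open>X\<close> has a \<open>g\<close> with
  spectrum in \<open>{- \<sigma>..\<sigma>}\<close> such that the norms of \<open>f - g\<close> and of \<open>\<sigma> ^ (- s)\<close> times the \<open>s\<close>-th derivative
  of \<open>g\<close> are at most a constant times the norm of \<open>\<Delta> ^ s f\<close>. Given this, the two hypotheses on the
  operator \<open>K\<close> bound the terms of \<open>f - K f = (f - g) + (g - K g) + K (g - f)\<close>.

  The function \<open>g\<close> comes from a mollifier \<open>V\<close> of Jackson type, a dilate of \<open>(sin x / x) ^ 4\<close>. With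
  \<open>E = I - V\<close> let \<open>q\<close> be the sum of \<open>E ^ j f\<close> over \<open>j < s\<close> and \<open>g = V q\<close>. Then \<open>f - g = E ^ s f\<close>, and the
  derivatives of \<open>g\<close> fall on \<open>V\<close>. Everything in sight is a convolution, hence commutes, and it remains
  to divide every factor \<open>E\<close> once, and the \<open>s\<close>-th derivative of \<open>V\<close> altogether \<open>s\<close> times, by \<open>\<Delta>\<close>, with
  bounded quotients.

  On the Fourier side \<open>\<Delta>\<close> has the symbol \<open>1 - (exp (i t) - 1) / (i t)\<close>, with a simple zero at \<open>0\<close> and no other
  real zero. The division is nevertheless done without Fourier analysis (\<open>box_quotient_eq\<close>). At unit
  step the kernel of \<open>A\<close> is the indicator of \<open>{-1..0}\<close>, the sum of an increasing ramp \<open>U\<close> and a decreasing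
  ramp \<open>D\<close>. Partial integration gives \<open>U P' = A P - P\<close>, and \<open>I - D\<close> is inverted by an absolutely
  convergent Neumann series because \<open>D\<close> has mass \<open>1 / 2\<close>. Together, \<open>P'\<close> is the product of \<open>\<Delta>\<close> with the inverse of
  \<open>I - D\<close> applied to \<open>P' - P\<close>. This applies to the derivatives of \<open>V\<close>, and also to \<open>A - V\<close>: both
  kernels have integral one, so their difference has a decaying primitive (\<open>ex_primitive_box_minus\<close>).

  The space \<open>X\<close> need not be translation invariant; all that is known is that averages are bounded on it. But a
  kernel of size \<open>O(1 / (1 + x^2))\<close> is dominated by a convergent sum of dyadic averaging kernels, so that
  convolution with any of its dilates is bounded uniformly (\<open>conv_dil_bounded\<close>). Hence the class of
  kernels with quadratic decay, which is closed under convolution, is the natural setting.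
\<close>

section \<open>Convolution with quadratically decaying kernels\<close>

text \<open>The integral is taken over \<open>lebesgue\<close> because elements of \<open>X\<close> need
  not be Borel functions.\<close>

definition conv :: "(real \<Rightarrow> complex) \<Rightarrow> (real \<Rightarrow> complex) \<Rightarrow> real \<Rightarrow> complex" where
  "conv K f x = (LINT y|lebesgue. K (x - y) * f y)"

definition decaying :: "(real \<Rightarrow> complex) \<Rightarrow> bool" where
  "decaying K \<longleftrightarrow> K \<in> borel_measurable borel \<and> (\<exists>C. \<forall>x. cmod (K x) \<le> C / (1 + x^2))"

text \<open>The growth condition under which the convolution with a decaying kernel converges at every
  point.\<close>

definition moderate :: "(real \<Rightarrow> complex) \<Rightarrow> bool" where
  "moderate f \<longleftrightarrow> f \<in> borel_measurable lebesgue \<and> integrable lebesgue (\<lambda>x. cmod (f x) / (1 + x^2))"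

lemmas integrable_le = Bochner_Integration.integrable_bound

lemma one_plus_square_pos: "0 < 1 + (x::real)^2"
  by (simp add: add_pos_nonneg)

lemma decayingI:
  assumes "K \<in> borel_measurable borel" "\<And>x. cmod (K x) \<le> C / (1 + x^2)"
  shows "decaying K"
  using assms unfolding decaying_def by blast

lemma decayingE:
  assumes "decaying K"
  obtains C where "C > 0" "\<And>x. cmod (K x) \<le> C / (1 + x^2)" "K \<in> borel_measurable borel"
proof -
  obtain C where C: "\<And>x. cmod (K x) \<le> C / (1 + x^2)" and m: "K \<in> borel_measurable borel"
    using assms unfolding decaying_def by blast
  have "cmod (K x) \<le> (\<bar>C\<bar> + 1) / (1 + x^2)" for x
    using C[of x] by (rule order_trans) (intro divide_right_mono, auto)
  with m show thesis by (intro that[of "\<bar>C\<bar> + 1"]) auto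
qed

lemma decaying_measurable [measurable_dest]: "decaying K \<Longrightarrow> K \<in> borel_measurable borel"
  by (simp add: decaying_def)

lemma decaying_add:
  assumes "decaying K" "decaying J" shows "decaying (\<lambda>x. K x + J x)"
proof -
  obtain C where C: "\<And>x. cmod (K x) \<le> C / (1 + x^2)" using decayingE[OF assms(1)] by metis
  obtain D where D: "\<And>x. cmod (J x) \<le> D / (1 + x^2)" using decayingE[OF assms(2)] by metis
  show ?thesis
  proof (rule decayingI[of _ "C + D"])
    show "(\<lambda>x. K x + J x) \<in> borel_measurable borel"
      using assms by measurable
    show "cmod (K x + J x) \<le> (C + D) / (1 + x^2)" for x
      using norm_triangle_ineq[of "K x" "J x"] C[of x] D[of x] by (simp add: add_divide_distrib)
  qed
qed

lemma decaying_cmult: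
  assumes "decaying K" shows "decaying (\<lambda>x. c * K x)"
proof -
  obtain C where C: "\<And>x. cmod (K x) \<le> C / (1 + x^2)" using decayingE[OF assms(1)] by metis
  show ?thesis
  proof (rule decayingI[of _ "cmod c * C"])
    show "(\<lambda>x. c * K x) \<in> borel_measurable borel"
      using assms by measurable
    show "cmod (c * K x) \<le> (cmod c * C) / (1 + x^2)" for x
      using mult_left_mono[OF C[of x], of "cmod c"] by (simp add: norm_mult)
  qed
qed

lemma decaying_diff:
  assumes "decaying K" "decaying J" shows "decaying (\<lambda>x. K x - J x)"
  using decaying_add[OF assms(1) decaying_cmult[OF assms(2), of "-1"]] by simp

lemma integrable_cauchy: "integrable lborel (\<lambda>x::real. 1 / (1 + x^2))"
  using integrable_inverse_1_plus_square
  by (simp add: set_integrable_def einterval_def divide_inverse)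

text \<open>Translations change the Cauchy kernel only by a bounded factor, so decaying kernels may be
  translated under the integral sign.\<close>

lemma cauchy_shift_le:
  fixes x y :: real
  shows "1 / (1 + (x - y)^2) \<le> 2 * (1 + x^2) / (1 + y^2)"
proof -
  have "1 + y^2 \<le> 2 * (1 + x^2) * (1 + (x - y)^2)"
  proof -
    have "y^2 \<le> 2 * x^2 + 2 * (x - y)^2"
      using zero_le_power2[of "2 * x - y"] by (simp add: power2_eq_square algebra_simps)
    moreover have "0 \<le> x^2 * (x - y)^2" by simp
    moreover have "2 * (1 + x^2) * (1 + (x - y)^2) = 2 + 2 * x^2 + 2 * (x - y)^2 + 2 * (x^2 * (x - y)^2)"
      by (simp add: distrib_left distrib_right)
    ultimately show ?thesis by linarith
  qed
  thus ?thesis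
    by (simp add: divide_simps one_plus_square_pos add_pos_nonneg)
qed

lemma moderate_decaying:
  assumes "decaying K" shows "moderate K"
proof -
  obtain C where C: "\<And>x. cmod (K x) \<le> C / (1 + x^2)" "C > 0" using decayingE[OF assms(1)] by metis
  have m [measurable]: "K \<in> borel_measurable borel" using assms by (rule decaying_measurable)
  have bd: "cmod (K x) / (1 + x^2) \<le> C * (1 / (1 + x^2))" for x
  proof -
    have "cmod (K x) / (1 + x^2) \<le> cmod (K x) / 1"
      by (intro divide_left_mono) (auto simp: one_plus_square_pos)
    with C(1)[of x] show ?thesis by simp
  qed
  have "integrable lborel (\<lambda>x. cmod (K x) / (1 + x^2))"
    by (rule integrable_le[OF integrable_mult_right[OF integrable_cauchy, of C]])
      (use bd C in \<open>auto simp: abs_mult\<close>)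
  thus ?thesis
    unfolding moderate_def by (auto simp: integrable_completion intro: measurable_completion)
qed

lemma conv_integrable:
  assumes K: "decaying K" and f: "moderate f"
  shows "integrable lebesgue (\<lambda>y. K (x - y) * f y)"
proof -
  obtain C where C: "\<And>x. cmod (K x) \<le> C / (1 + x^2)" "C > 0" using decayingE[OF assms(1)] by metis
  have [measurable]: "K \<in> borel_measurable borel" "f \<in> borel_measurable lebesgue"
    using assms by (auto simp: decaying_def moderate_def)
  have bd: "cmod (K (x - y) * f y) \<le> (C * (2 * (1 + x^2))) * (cmod (f y) / (1 + y^2))" for y
  proof -
    have "cmod (K (x - y)) \<le> C * (1 / (1 + (x - y)^2))" using C(1)[of "x - y"] by simp
    also have "\<dots> \<le> C * (2 * (1 + x^2) / (1 + y^2))"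
      using C(2) by (intro mult_left_mono cauchy_shift_le) auto
    finally have "cmod (K (x - y)) * cmod (f y) \<le> C * (2 * (1 + x^2) / (1 + y^2)) * cmod (f y)"
      by (rule mult_right_mono) simp
    thus ?thesis by (simp add: norm_mult)
  qed
  have [measurable]: "(\<lambda>y. K (x - y)) \<in> borel_measurable lebesgue"
    by (rule measurable_completion) measurable
  have "integrable lebesgue (\<lambda>y. (C * (2 * (1 + x^2))) * (cmod (f y) / (1 + y^2)))"
    using f by (intro integrable_mult_right) (simp add: moderate_def)
  thus ?thesis
    by (rule integrable_le) (use bd C in \<open>auto simp: abs_mult\<close>)
qed

lemma conv_add_right:
  assumes "decaying K" "moderate f" "moderate g"
  shows "conv K (\<lambda>x. f x + g x) = (\<lambda>x. conv K f x + conv K g x)"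
  unfolding conv_def using conv_integrable[OF assms(1)] assms(2,3)
  by (auto simp: distrib_left)

lemma conv_diff_right:
  assumes "decaying K" "moderate f" "moderate g"
  shows "conv K (\<lambda>x. f x - g x) = (\<lambda>x. conv K f x - conv K g x)"
  unfolding conv_def using conv_integrable[OF assms(1)] assms(2,3)
  by (auto simp: right_diff_distrib)

lemma conv_add_left:
  assumes "decaying K" "decaying J" "moderate f"
  shows "conv (\<lambda>x. K x + J x) f = (\<lambda>x. conv K f x + conv J f x)"
  unfolding conv_def using conv_integrable[OF assms(1,3)] conv_integrable[OF assms(2,3)]
  by (auto simp: distrib_right)

lemma conv_diff_left:
  assumes "decaying K" "decaying J" "moderate f"
  shows "conv (\<lambda>x. K x - J x) f = (\<lambda>x. conv K f x - conv J f x)"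
  unfolding conv_def using conv_integrable[OF assms(1,3)] conv_integrable[OF assms(2,3)]
  by (auto simp: left_diff_distrib)

lemma conv_cmult_left: "conv (\<lambda>x. c * K x) f = (\<lambda>x. c * conv K f x)"
  unfolding conv_def by (auto simp: mult.assoc)

lemma borel_representative:
  fixes f :: "real \<Rightarrow> complex"
  assumes "f \<in> borel_measurable lebesgue"
  shows "\<exists>g\<in>borel_measurable borel. AE x in lebesgue. f x = g x"
proof -
  have "(\<lambda>x. Re (f x)) \<in> borel_measurable lebesgue" "(\<lambda>x. Im (f x)) \<in> borel_measurable lebesgue"
    using assms by measurable
  from this[THEN completion_ex_borel_measurable_real]
  obtain u v where uv: "u \<in> borel_measurable lborel" "AE x in lborel. Re (f x) = u x"
      "v \<in> borel_measurable lborel" "AE x in lborel. Im (f x) = v x"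
    by (elim bexE) (rule that)
  have "AE x in lborel. f x = Complex (u x) (v x)"
    using uv(2,4) by eventually_elim (simp add: complex_eq_iff)
  moreover have "(\<lambda>x. Complex (u x) (v x)) = (\<lambda>x. of_real (u x) + \<i> * of_real (v x))"
    by (simp add: complex_eq_iff fun_eq_iff)
  moreover have [measurable]: "u \<in> borel_measurable borel" "v \<in> borel_measurable borel"
    using uv(1,3) by simp_all
  have "(\<lambda>x. complex_of_real (u x) + \<i> * of_real (v x)) \<in> borel_measurable borel"
    by measurable
  ultimately show ?thesis
    by (intro bexI[of _ "\<lambda>x. Complex (u x) (v x)"]) (simp_all add: AE_completion)
qed

text \<open>Fubini's theorem needs joint measurability, which is only at hand for Borel functions.
  Convolutions do not see null sets, so a Borel representative may always be used.\<close>

lemma moderate_representative: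
  assumes "moderate f"
  obtains g where "moderate g" "g \<in> borel_measurable borel" "AE x in lebesgue. f x = g x"
    "\<And>K. decaying K \<Longrightarrow> conv K f = conv K g" "integrable lborel (\<lambda>x. cmod (g x) / (1 + x^2))"
proof -
  have f [measurable]: "f \<in> borel_measurable lebesgue" using assms by (simp add: moderate_def)
  obtain g where g: "g\<in>borel_measurable borel" "AE x in lebesgue. f x = g x"
    using borel_representative[OF f] by blast
  have g' [measurable]: "g \<in> borel_measurable lebesgue" using g(1) by (simp add: measurable_completion)
  have [measurable]: "(\<lambda>x::real. 1 + x^2) \<in> borel_measurable lebesgue"
    by (rule measurable_completion) measurable
  have "integrable lebesgue (\<lambda>x. cmod (f x) / (1 + x^2)) \<longleftrightarrow> integrable lebesgue (\<lambda>x. cmod (g x) / (1 + x^2))"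
    by (rule integrable_cong_AE) (use g(2) in auto)
  with assms have i: "integrable lebesgue (\<lambda>x. cmod (g x) / (1 + x^2))" by (simp add: moderate_def)
  have "conv K f = conv K g" if "decaying K" for K
  proof
    fix x
    have [measurable]: "K \<in> borel_measurable borel" using that by (rule decaying_measurable)
    have [measurable]: "(\<lambda>y. K (x - y)) \<in> borel_measurable lebesgue"
      by (intro measurable_completion) measurable
    show "conv K f x = conv K g x"
      unfolding conv_def by (rule integral_cong_AE) (use g(2) in auto)
  qed
  moreover have "moderate g" using i g' by (simp add: moderate_def)
  moreover have "integrable lborel (\<lambda>x. cmod (g x) / (1 + x^2))"
    using i g(1) by (subst (asm) integrable_completion) auto
  ultimately show thesis using that g by blast
qed

lemma conv_borel:
  assumes "K \<in> borel_measurable borel" "f \<in> borel_measurable borel"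
  shows "conv K f x = (LINT y|lborel. K (x - y) * f y)"
  unfolding conv_def using assms by (intro integral_completion) auto

lemma conv_measurable:
  assumes "decaying K" "moderate f" shows "conv K f \<in> borel_measurable borel"
proof -
  obtain g where g: "g \<in> borel_measurable borel" "conv K f = conv K g"
    using moderate_representative[OF assms(2)] assms(1) by metis
  have [measurable]: "K \<in> borel_measurable borel" "g \<in> borel_measurable borel"
    using assms(1) g(1) by (auto simp: decaying_def)
  have eq: "conv K g = (\<lambda>x. LINT y|lborel. K (x - y) * g y)"
    using conv_borel[of K g] by auto
  have "(\<lambda>(x, y). K (x - y) * g y) \<in> borel_measurable (borel \<Otimes>\<^sub>M lborel)" by measurable
  hence "(\<lambda>x. LINT y|lborel. K (x - y) * g y) \<in> borel_measurable borel"
    using lborel.borel_measurable_lebesgue_integral[of "\<lambda>x y. K (x - y) * g y" borel] by simp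
  thus ?thesis using g(2) eq by simp
qed

lemma decaying_integrable: "decaying K \<Longrightarrow> integrable lborel K"
proof -
  assume K: "decaying K"
  obtain C where C: "\<And>x. cmod (K x) \<le> C / (1 + x^2)" "C > 0" using decayingE[OF K] by metis
  show ?thesis
    by (rule integrable_le[OF integrable_mult_right[OF integrable_cauchy, of C]])
      (use decaying_measurable[OF K] C in \<open>auto simp: abs_mult\<close>)
qed

text \<open>Since \<open>x^2 \<le> 2 (x - y)^2 + 2 y^2\<close>, a partial fraction decomposition bounds a
  product of two Cauchy kernels by their sum; integrated over \<open>y\<close>, this shows that decaying
  kernels are closed under convolution.\<close>

lemma cauchy_product_le:
  fixes x y :: real
  shows "1 / (1 + (x - y)^2) * (1 / (1 + y^2)) \<le> 2 / (1 + x^2) * (1 / (1 + y^2) + 1 / (1 + (x - y)^2))"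
proof -
  define A B C where "A = 1 + (x - y)^2" and "B = 1 + y^2" and "C = 1 + x^2"
  have pos: "A > 0" "B > 0" "C > 0" unfolding A_def B_def C_def by (auto simp: one_plus_square_pos)
  have "C \<le> 2 * (A + B)"
    unfolding A_def B_def C_def using zero_le_power2[of "x - 2 * y"]
    by (simp add: power2_eq_square algebra_simps)
  hence "1 / A * (1 / B) \<le> 2 / C * (1 / B + 1 / A)"
    using pos by (simp add: divide_simps algebra_simps)
  thus ?thesis unfolding A_def B_def C_def .
qed

lemma decaying_product_le:
  assumes "decaying K" "decaying J"
  shows "\<exists>C>0. \<forall>x. integrable lborel (\<lambda>y. cmod (K (x - y)) * cmod (J y)) \<and>
    (LINT y|lborel. cmod (K (x - y)) * cmod (J y)) \<le> C / (1 + x^2)"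
proof -
  obtain C where C: "\<And>x. cmod (K x) \<le> C / (1 + x^2)" "C > 0" using decayingE[OF assms(1)] by metis
  obtain D where D: "\<And>x. cmod (J x) \<le> D / (1 + x^2)" "D > 0" using decayingE[OF assms(2)] by metis
  have [measurable]: "K \<in> borel_measurable borel" "J \<in> borel_measurable borel"
    using assms by (auto simp: decaying_def)
  define p where "p = (LINT y::real|lborel. 1 / (1 + y^2))"
  have p: "0 \<le> p" unfolding p_def by (rule integral_nonneg_AE) auto
  have i2: "integrable lborel (\<lambda>y. 1 / (1 + (x - y)^2))" for x :: real
    using lborel_integrable_real_affine[OF integrable_cauchy, of "-1" x] by simp
  have p2: "(LINT y|lborel. 1 / (1 + (x - y)^2)) = p" for x :: real
    unfolding p_def using lborel_integral_real_affine[of "-1" "\<lambda>y. 1 / (1 + y^2)" x] by simp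
  have bd: "cmod (K (x - y)) * cmod (J y) \<le> C * D * (2 / (1 + x^2)) * (1 / (1 + y^2) + 1 / (1 + (x - y)^2))" for x y
  proof -
    have "cmod (K (x - y)) * cmod (J y) \<le> (C / (1 + (x - y)^2)) * (D / (1 + y^2))"
      by (intro mult_mono C D) (use C(2) in \<open>auto simp: one_plus_square_pos\<close>)
    also have "\<dots> = C * D * (1 / (1 + (x - y)^2) * (1 / (1 + y^2)))" by simp
    also have "\<dots> \<le> C * D * (2 / (1 + x^2) * (1 / (1 + y^2) + 1 / (1 + (x - y)^2)))"
      using C D by (intro mult_left_mono cauchy_product_le) auto
    finally show ?thesis by (simp add: mult.assoc)
  qed
  have i3: "integrable lborel (\<lambda>y. C * D * (2 / (1 + x^2)) * (1 / (1 + y^2) + 1 / (1 + (x - y)^2)))" for x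
    by (intro integrable_mult_right Bochner_Integration.integrable_add integrable_cauchy i2)
  have 1: "integrable lborel (\<lambda>y. cmod (K (x - y)) * cmod (J y))" for x
    by (rule integrable_le[OF i3[of x]])
      (use bd C D in \<open>auto simp: abs_mult intro!: AE_I2 order_trans[OF bd]\<close>)
  have 2: "(LINT y|lborel. cmod (K (x - y)) * cmod (J y)) \<le> (4 * C * D * p) / (1 + x^2)" for x
  proof -
    have "(LINT y|lborel. cmod (K (x - y)) * cmod (J y)) \<le>
       (LINT y|lborel. C * D * (2 / (1 + x^2)) * (1 / (1 + y^2) + 1 / (1 + (x - y)^2)))"
      by (intro integral_mono 1 i3 bd)
    also have "\<dots> = C * D * (2 / (1 + x^2)) * (p + p)"
      unfolding integral_mult_right_zero
      by (subst Bochner_Integration.integral_add[OF integrable_cauchy i2]) (simp add: p2 p_def[symmetric])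
    finally show ?thesis by (simp add: field_simps)
  qed
  show ?thesis
  proof (intro exI[of _ "4 * C * D * p + 1"] conjI allI 1)
    show "4 * C * D * p + 1 > 0" using C D p by (simp add: add_nonneg_pos)
    show "(LINT y|lborel. cmod (K (x - y)) * cmod (J y)) \<le> (4 * C * D * p + 1) / (1 + x^2)" for x
      using 2[of x] by (rule order_trans) (intro divide_right_mono, auto)
  qed
qed

lemma decaying_conv:
  assumes "decaying K" "decaying J" shows "decaying (conv K J)"
proof -
  obtain C where C: "\<And>x. (LINT y|lborel. cmod (K (x - y)) * cmod (J y)) \<le> C / (1 + x^2)"
    using decaying_product_le[OF assms] by blast
  show ?thesis
  proof (rule decayingI[of _ C])
    show "conv K J \<in> borel_measurable borel"
      by (intro conv_measurable assms moderate_decaying)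
    show "cmod (conv K J x) \<le> C / (1 + x^2)" for x
    proof -
      have "cmod (conv K J x) = cmod (LINT y|lborel. K (x - y) * J y)"
        using assms by (simp add: conv_borel decaying_def)
      also have "\<dots> \<le> (LINT y|lborel. cmod (K (x - y) * J y))"
        by (rule integral_norm_bound)
      finally show ?thesis using C[of x] by (simp add: norm_mult)
    qed
  qed
qed

lemma conv_commute:
  assumes "decaying K" "decaying J" shows "conv K J = conv J K"
proof
  fix x
  have "conv K J x = (LINT y|lborel. K (x - y) * J y)"
    using assms by (simp add: conv_borel decaying_def)
  also have "\<dots> = (LINT y|lborel. K (x - (x + (-1) * y)) * J (x + (-1) * y))"
    using lborel_integral_real_affine[of "-1" "\<lambda>y. K (x - y) * J y" x] by simp
  also have "\<dots> = conv J K x"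
    using assms by (simp add: conv_borel decaying_def mult.commute)
  finally show "conv K J x = conv J K x" .
qed

text \<open>The double integral converges absolutely: integrating the product of the two kernels leaves a
  function that decays like a kernel, and a moderate function is integrable against it.\<close>

lemma conv_assoc:
  assumes K: "decaying K" and J: "decaying J" and f: "moderate f"
  shows "conv K (conv J f) = conv (conv K J) f"
proof -
  obtain g where g: "moderate g" "g \<in> borel_measurable borel" "\<And>K. decaying K \<Longrightarrow> conv K f = conv K g"
     "integrable lborel (\<lambda>x. cmod (g x) / (1 + x^2))"
    using moderate_representative[OF f] by metis
  have [measurable]: "K \<in> borel_measurable borel" "J \<in> borel_measurable borel" "g \<in> borel_measurable borel"
    using K J g by (auto simp: decaying_def)
  have Jg [measurable]: "conv J g \<in> borel_measurable borel" by (intro conv_measurable J g)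
  have KJ [measurable]: "conv K J \<in> borel_measurable borel" by (intro conv_measurable K moderate_decaying J)
  obtain C where C: "\<And>x. integrable lborel (\<lambda>y. cmod (K (x - y)) * cmod (J y))"
      "\<And>x. (LINT y|lborel. cmod (K (x - y)) * cmod (J y)) \<le> C / (1 + x^2)" "C > 0"
    using decaying_product_le[OF K J] by blast
  have "conv K (conv J g) x = conv (conv K J) g x" for x
  proof -
    define F where "F = (\<lambda>(z, y). K (x - y) * J (y - z) * g z)"
    have Fm [measurable]: "F \<in> borel_measurable (lborel \<Otimes>\<^sub>M lborel)"
      unfolding F_def by measurable
    have shift: "integrable lborel (\<lambda>y. cmod (K (x - y)) * cmod (J (y - z)))"
       "(LINT y|lborel. cmod (K (x - y)) * cmod (J (y - z))) = (LINT y|lborel. cmod (K ((x - z) - y)) * cmod (J y))" for z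
    proof -
      have e: "(\<lambda>y. cmod (K (x - (z + 1 * y))) * cmod (J ((z + 1 * y) - z))) = (\<lambda>y. cmod (K ((x - z) - y)) * cmod (J y))"
        by (simp add: algebra_simps)
      show "integrable lborel (\<lambda>y. cmod (K (x - y)) * cmod (J (y - z)))"
        using C(1)[of "x - z"] lborel_integrable_real_affine_iff[of 1 "\<lambda>y. cmod (K (x - y)) * cmod (J (y - z))" z]
        unfolding e by simp
      show "(LINT y|lborel. cmod (K (x - y)) * cmod (J (y - z))) = (LINT y|lborel. cmod (K ((x - z) - y)) * cmod (J y))"
        using lborel_integral_real_affine[of 1 "\<lambda>y. cmod (K (x - y)) * cmod (J (y - z))" z]
        unfolding e by simp
    qed
    have n: "(LINT y|lborel. norm (F (z, y))) = (LINT y|lborel. cmod (K ((x - z) - y)) * cmod (J y)) * cmod (g z)" for z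
      unfolding F_def by (simp add: norm_mult shift(2)[symmetric])
    have Fint: "integrable (lborel \<Otimes>\<^sub>M lborel) F"
    proof (rule lborel_pair.Fubini_integrable[OF Fm])
      show "AE z in lborel. integrable lborel (\<lambda>y. F (z, y))"
      proof (rule AE_I2)
        fix z :: real
        have "integrable lborel (\<lambda>y. cmod (K (x - y)) * cmod (J (y - z)) * cmod (g z))"
          by (intro integrable_mult_left shift(1))
        thus "integrable lborel (\<lambda>y. F (z, y))"
          by (rule integrable_le) (auto simp: F_def norm_mult)
      qed
      have "integrable lborel (\<lambda>z. (C * (2 * (1 + x^2))) * (cmod (g z) / (1 + z^2)))"
        by (intro integrable_mult_right g(4))
      thus "integrable lborel (\<lambda>z. LINT y|lborel. norm (F (z, y)))"
      proof (rule integrable_le)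
        show "(\<lambda>z. LINT y|lborel. norm (F (z, y))) \<in> borel_measurable lborel"
          by measurable
        show "AE z in lborel. norm (LINT y|lborel. norm (F (z, y))) \<le> norm ((C * (2 * (1 + x^2))) * (cmod (g z) / (1 + z^2)))"
        proof (rule AE_I2)
          fix z :: real
          have "norm (LINT y|lborel. norm (F (z, y))) = (LINT y|lborel. norm (F (z, y)))"
            by (simp add: integral_nonneg_AE)
          also have "\<dots> \<le> C / (1 + (x - z)^2) * cmod (g z)"
            unfolding n by (intro mult_right_mono C) auto
          also have "\<dots> = C * (1 / (1 + (x - z)^2)) * cmod (g z)" by simp
          also have "\<dots> \<le> C * (2 * (1 + x^2) / (1 + z^2)) * cmod (g z)"
            using C(3) by (intro mult_right_mono mult_left_mono cauchy_shift_le) auto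
          also have "\<dots> = norm ((C * (2 * (1 + x^2))) * (cmod (g z) / (1 + z^2)))"
            using C(3) by (simp add: abs_mult)
          finally show "norm (LINT y|lborel. norm (F (z, y))) \<le> norm ((C * (2 * (1 + x^2))) * (cmod (g z) / (1 + z^2)))" .
        qed
      qed
    qed
    have "conv K (conv J g) x = (LINT y|lborel. LINT z|lborel. F (z, y))"
      unfolding F_def by (simp add: conv_borel mult.assoc)
    also have "\<dots> = (LINT z|lborel. LINT y|lborel. F (z, y))"
      using lborel_pair.Fubini_integral[of "\<lambda>z y. F (z, y)"] Fint by simp
    also have "\<dots> = (LINT z|lborel. conv K J (x - z) * g z)"
    proof (rule Bochner_Integration.integral_cong[OF refl])
      fix z :: real
      have "(LINT y|lborel. F (z, y)) = (LINT y|lborel. K (x - y) * J (y - z)) * g z"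
        unfolding F_def by simp
      also have "(LINT y|lborel. K (x - y) * J (y - z)) = (LINT y|lborel. K (x - (z + 1 * y)) * J ((z + 1 * y) - z))"
        using lborel_integral_real_affine[of 1 "\<lambda>y. K (x - y) * J (y - z)" z] by simp
      also have "\<dots> = conv K J (x - z)"
        by (simp add: conv_borel algebra_simps)
      finally show "(LINT y|lborel. F (z, y)) = conv K J (x - z) * g z" .
    qed
    also have "\<dots> = conv (conv K J) g x"
      by (simp add: conv_borel)
    finally show ?thesis .
  qed
  thus ?thesis using g(3)[OF J] g(3)[OF decaying_conv[OF K J]] by auto
qed

text \<open>The dilation keeps the integral of the kernel and is multiplicative for convolution.
  Identities between kernels are therefore proved at unit step and transported to every step
  \<open>h\<close>.\<close>

definition dil :: "real \<Rightarrow> (real \<Rightarrow> complex) \<Rightarrow> real \<Rightarrow> complex" where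
  "dil h K x = K (x / h) / of_real h"

lemma dil_measurable [measurable]: "K \<in> borel_measurable borel \<Longrightarrow> dil h K \<in> borel_measurable borel"
  unfolding dil_def by (intro borel_measurable_divide measurable_compose[of "\<lambda>x. x / h" _ borel K]) auto

lemma dil_add: "dil h (\<lambda>x. K x + J x) = (\<lambda>x. dil h K x + dil h J x)"
  by (auto simp: dil_def add_divide_distrib)

lemma dil_diff: "dil h (\<lambda>x. K x - J x) = (\<lambda>x. dil h K x - dil h J x)"
  by (auto simp: dil_def diff_divide_distrib)

lemma decaying_dil:
  assumes "decaying K" "h > 0" shows "decaying (dil h K)"
proof -
  obtain C where C: "\<And>x. cmod (K x) \<le> C / (1 + x^2)" "C > 0" using decayingE[OF assms(1)] by metis
  show ?thesis
  proof (rule decayingI[of _ "C * (1 + h^2) / h"])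
    show "dil h K \<in> borel_measurable borel"
      by (intro dil_measurable decaying_measurable assms)
    fix x
    have "1 + x^2 \<le> (1 + h^2) * (1 + (x / h)^2)"
      using assms(2) by (simp add: field_simps power2_eq_square)
    hence "1 / (1 + (x / h)^2) \<le> (1 + h^2) / (1 + x^2)"
      using one_plus_square_pos[of x] one_plus_square_pos[of "x/h"]
      by (simp add: pos_divide_le_eq mult.commute le_divide_eq)
    from mult_left_mono[OF this, of "C / h"] C assms(2)
    have "C / (1 + (x / h)^2) / h \<le> C * (1 + h^2) / h / (1 + x^2)" by (simp add: field_simps)
    moreover have "cmod (dil h K x) = cmod (K (x / h)) / h"
      using assms(2) by (simp add: dil_def norm_divide)
    moreover have "cmod (K (x / h)) / h \<le> C / (1 + (x / h)^2) / h"
      using assms(2) by (intro divide_right_mono C) auto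
    ultimately show "cmod (dil h K x) \<le> C * (1 + h^2) / h / (1 + x^2)" by linarith
  qed
qed

lemma conv_dil:
  assumes "decaying K" "decaying J" "h > 0"
  shows "conv (dil h K) (dil h J) = dil h (conv K J)"
proof
  fix x
  have [measurable]: "K \<in> borel_measurable borel" "J \<in> borel_measurable borel"
    using assms by (auto simp: decaying_def)
  have "conv (dil h K) (dil h J) x = (LINT y|lborel. dil h K (x - y) * dil h J y)"
    by (simp add: conv_borel)
  also have "\<dots> = h *\<^sub>R (LINT y|lborel. dil h K (x - (0 + h * y)) * dil h J (0 + h * y))"
    using lborel_integral_real_affine[of h "\<lambda>y. dil h K (x - y) * dil h J y" 0] assms(3) by simp
  also have "(\<lambda>y. dil h K (x - (0 + h * y)) * dil h J (0 + h * y)) = (\<lambda>y. (1 / of_real (h * h)) * (K (x / h - y) * J y))"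
    using assms(3) by (auto simp: dil_def field_simps)
  also have "h *\<^sub>R (LINT y|lborel. (1 / of_real (h * h)) * (K (x / h - y) * J y)) = dil h (conv K J) x"
    using assms(3) by (simp add: conv_borel dil_def scaleR_conv_of_real)
  finally show "conv (dil h K) (dil h J) x = dil h (conv K J) x" .
qed

section \<open>Convolution operators on the lattice\<close>

locale averaging_lattice = banach_lattice +
  assumes assumption_A: "assumption_A X nrm"
begin

lemma diff_mem: "f \<in> X \<Longrightarrow> g \<in> X \<Longrightarrow> (\<lambda>x. f x - g x) \<in> X"
  using add_mem[OF _ scale_mem[of g "-1"], of f] by simp

lemma nrm_minus: "f \<in> X \<Longrightarrow> g \<in> X \<Longrightarrow> nrm (\<lambda>x. f x - g x) = nrm (\<lambda>x. g x - f x)"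
  using nrm_scale[OF diff_mem, of f g "-1"] by simp

lemma nrm_diff_le: "f \<in> X \<Longrightarrow> g \<in> X \<Longrightarrow> nrm (\<lambda>x. f x - g x) \<le> nrm f + nrm g"
  using nrm_triangle[OF _ scale_mem[of g "-1"], of f] nrm_scale[of g "-1"] by simp

lemma nrm_le_add_diff: "f \<in> X \<Longrightarrow> g \<in> X \<Longrightarrow> nrm f \<le> nrm g + nrm (\<lambda>x. f x - g x)"
  using nrm_triangle[OF _ diff_mem, of g f g] by simp

lemma nrm_diff_triangle:
  "f \<in> X \<Longrightarrow> g \<in> X \<Longrightarrow> k \<in> X \<Longrightarrow> nrm (\<lambda>x. f x - k x) \<le> nrm (\<lambda>x. f x - g x) + nrm (\<lambda>x. g x - k x)"
  using nrm_triangle[OF diff_mem diff_mem, of f g g k] by simp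

lemma sum_mem: "finite A \<Longrightarrow> (\<And>j. j \<in> A \<Longrightarrow> u j \<in> X) \<Longrightarrow> (\<lambda>x. \<Sum>j\<in>A. u j x) \<in> X"
  by (induction A rule: finite_induct) (auto intro: zero_mem add_mem)

lemma nrm_zero: "nrm (\<lambda>x. 0) = 0"
  using nrm_eq_0_iff[OF zero_mem] by simp

lemma nrm_sum_le:
  "finite A \<Longrightarrow> (\<And>j. j \<in> A \<Longrightarrow> u j \<in> X) \<Longrightarrow> nrm (\<lambda>x. \<Sum>j\<in>A. u j x) \<le> (\<Sum>j\<in>A. nrm (u j))"
proof (induction A rule: finite_induct)
  case (insert a A)
  have "nrm (\<lambda>x. u a x + (\<Sum>j\<in>A. u j x)) \<le> nrm (u a) + nrm (\<lambda>x. \<Sum>j\<in>A. u j x)"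
    using insert by (intro nrm_triangle sum_mem) auto
  with insert show ?case by auto
qed (simp add: nrm_zero)

lemma cmod_mem:
  assumes "f \<in> X"
  shows "(\<lambda>x. complex_of_real (cmod (f x))) \<in> X" "nrm (\<lambda>x. complex_of_real (cmod (f x))) = nrm f"
proof -
  let ?g = "\<lambda>x. complex_of_real (cmod (f x))"
  have [measurable]: "f \<in> borel_measurable lebesgue" using assms by (rule meas)
  have 1: "?g \<in> X \<and> nrm ?g \<le> nrm f"
    by (rule solid[OF _ assms]) auto
  moreover have "nrm f \<le> nrm ?g"
    using solid[of f ?g] 1 by auto
  ultimately show "?g \<in> X" "nrm ?g = nrm f"
    by auto
qed

lemma steklov_mem: "f \<in> X \<Longrightarrow> h > 0 \<Longrightarrow> steklov h f \<in> X"
  using assumption_A unfolding assumption_A_def by blast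

lemma steklov_scale: "steklov h (\<lambda>x. c * f x) = (\<lambda>x. c * steklov h f x)"
  unfolding steklov_def set_lebesgue_integral_def by (simp add: mult_scaleR_right[symmetric] del: mult_scaleR_right)

text \<open>The hypothesis only speaks of the unit ball; a function of norm zero is covered because all
  its multiples stay in the ball.\<close>

lemma steklov_bounded:
  obtains M where "M \<ge> 0" "\<And>h f. h > 0 \<Longrightarrow> f \<in> X \<Longrightarrow> nrm (steklov h f) \<le> M * nrm f"
proof -
  obtain M where M: "\<And>h f. h > 0 \<Longrightarrow> f \<in> X \<Longrightarrow> nrm f \<le> 1 \<Longrightarrow> nrm (steklov h f) \<le> M"
    using assumption_A unfolding assumption_A_def by blast
  have M0: "M \<ge> 0"
    using M[of 1 "\<lambda>x. 0"] nrm_nonneg[OF steklov_mem[OF zero_mem, of 1]] zero_mem nrm_zero by simp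
  have "nrm (steklov h f) \<le> M * nrm f" if h: "h > 0" and f: "f \<in> X" for h f
  proof -
    have *: "c * nrm (steklov h f) \<le> M" if c: "c \<ge> 0" "c * nrm f \<le> 1" for c :: real
      using M[OF h scale_mem[OF f, of "of_real c"]] nrm_scale[OF f, of "of_real c"] c
        nrm_scale[OF steklov_mem[OF f h], of "of_real c"]
      by (simp add: steklov_scale)
    show ?thesis
    proof (cases "nrm f = 0")
      case True
      show ?thesis
      proof (rule ccontr)
        assume "\<not> nrm (steklov h f) \<le> M * nrm f"
        hence p: "nrm (steklov h f) > 0" using True by simp
        from *[of "(M + 1) / nrm (steklov h f)"] p M0 True show False by simp
      qed
    next
      case False
      hence p: "nrm f > 0" using nrm_nonneg[OF f] by simp
      from *[of "1 / nrm f"] p show ?thesis by (simp add: field_simps)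
    qed
  qed
  with M0 that show thesis by blast
qed

lemma set_integrable_Icc:
  assumes "f \<in> X" shows "set_integrable lebesgue {a..b} f"
proof -
  have [measurable]: "f \<in> borel_measurable lebesgue" using assms by (rule meas)
  have E: "{a..b} \<in> sets lebesgue" "emeasure lebesgue {a..b} < \<infinity>"
    by (auto simp: emeasure_lborel_Icc_eq)
  obtain c where c: "c > 0" "\<And>f. f \<in> X \<Longrightarrow> (\<integral>\<^sup>+x\<in>{a..b}. ennreal (cmod (f x)) \<partial>lebesgue) \<le> ennreal (c * nrm f)"
    using local_L1[OF E] by blast
  show ?thesis
    unfolding set_integrable_def
  proof (rule integrableI_bounded)
    have "(\<integral>\<^sup>+ x. ennreal (norm (indicat_real {a..b} x *\<^sub>R f x)) \<partial>lebesgue) = (\<integral>\<^sup>+x\<in>{a..b}. ennreal (cmod (f x)) \<partial>lebesgue)"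
      by (intro nn_integral_cong) (auto split: split_indicator)
    also have "\<dots> < \<infinity>" using c(2)[OF assms] by (auto simp: le_less_trans)
    finally show "(\<integral>\<^sup>+ x. ennreal (norm (indicat_real {a..b} x *\<^sub>R f x)) \<partial>lebesgue) < \<infinity>" .
  qed (use E in measurable)
qed

lemma steklov_cmod:
  assumes f: "f \<in> X" and h: "h > 0"
  shows "steklov h (\<lambda>x. complex_of_real (cmod (f x))) x =
           of_real (1 / h * (LINT y|lebesgue. indicator {x - h/2..x + h/2} y * cmod (f y)))"
    and "(\<integral>\<^sup>+y. ennreal (1 / h) * (indicator {x - h/2..x + h/2} y * ennreal (cmod (f y))) \<partial>lebesgue)
          = ennreal (1 / h * (LINT y|lebesgue. indicator {x - h/2..x + h/2} y * cmod (f y)))"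
proof -
  let ?I = "{x - h/2..x + h/2}"
  have [measurable]: "f \<in> borel_measurable lebesgue" using f by (rule meas)
  have "(LINT y|lebesgue. indicat_real ?I y *\<^sub>R complex_of_real (cmod (f y)))
     = (LINT y|lebesgue. complex_of_real (indicator ?I y * cmod (f y)))"
    by (intro Bochner_Integration.integral_cong) (auto simp: scaleR_conv_of_real)
  hence e: "(LINT y|lebesgue. indicat_real ?I y *\<^sub>R complex_of_real (cmod (f y)))
     = of_real (LINT y|lebesgue. indicator ?I y * cmod (f y))"
    by (simp only: integral_complex_of_real)
  show "steklov h (\<lambda>x. complex_of_real (cmod (f x))) x =
           of_real (1 / h * (LINT y|lebesgue. indicator ?I y * cmod (f y)))"
    unfolding steklov_def set_lebesgue_integral_def e by (simp only: scaleR_conv_of_real of_real_mult)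
  have "integrable lebesgue (\<lambda>y. norm (indicat_real ?I y *\<^sub>R f y))"
    using set_integrable_Icc[OF f] unfolding set_integrable_def by (rule integrable_norm)
  hence i: "integrable lebesgue (\<lambda>y. indicat_real ?I y * cmod (f y))"
    by (rule Bochner_Integration.integrable_cong[THEN iffD1, rotated -1]) (auto split: split_indicator)
  have "(\<integral>\<^sup>+y. ennreal (1 / h) * (indicator ?I y * ennreal (cmod (f y))) \<partial>lebesgue)
     = (\<integral>\<^sup>+y. ennreal (1 / h * (indicator ?I y * cmod (f y))) \<partial>lebesgue)"
    using h by (intro nn_integral_cong) (auto simp: ennreal_mult'[symmetric] split: split_indicator)
  also have "\<dots> = ennreal (LINT y|lebesgue. 1 / h * (indicator ?I y * cmod (f y)))"
    using h by (intro nn_integral_eq_integral integrable_mult_right i AE_I2) auto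
  finally show "(\<integral>\<^sup>+y. ennreal (1 / h) * (indicator ?I y * ennreal (cmod (f y))) \<partial>lebesgue)
          = ennreal (1 / h * (LINT y|lebesgue. indicator ?I y * cmod (f y)))"
    by simp
qed

lemma AE_nonpos_locally:
  fixes d :: "real \<Rightarrow> real"
  assumes [measurable]: "d \<in> borel_measurable lebesgue"
    and "\<And>N::nat. (\<integral>\<^sup>+x\<in>{- real N..real N}. ennreal (d x) \<partial>lebesgue) = 0"
  shows "AE x in lebesgue. d x \<le> 0"
proof -
  have "AE x in lebesgue. \<forall>N::nat. ennreal (d x) * indicator {- real N..real N} x = 0"
  proof (subst AE_all_countable, intro allI)
    fix N :: nat
    have [measurable]: "{- real N..real N} \<in> sets lebesgue" by simp
    show "AE x in lebesgue. ennreal (d x) * indicator {- real N..real N} x = 0"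
      using assms(2)[of N] by (subst (asm) nn_integral_0_iff_AE) auto
  qed
  thus ?thesis
  proof eventually_elim
    case (elim x)
    obtain N :: nat where "\<bar>x\<bar> \<le> real N" using real_arch_simple by blast
    hence "indicator {- real N..real N} x = (1 :: ennreal)" by (auto simp: indicator_def)
    with elim have "ennreal (d x) = 0" by (metis mult.right_neutral)
    thus ?case by (simp add: ennreal_eq_0_iff)
  qed
qed

text \<open>In terms of indicators, the Cauchy kernel is at most the sum over \<open>j\<close> of
  \<open>4 / 4 ^ j\<close> times the indicator of \<open>{- 2 ^ j..2 ^ j}\<close>: take the least
  \<open>j\<close> with \<open>\<bar>t\<bar> \<le> 2 ^ j\<close>.\<close>

lemma dyadic_cauchy_majorant: "\<exists>j::nat. \<bar>t\<bar> \<le> 2 ^ j \<and> 1 / (1 + t^2) \<le> 4 / 4 ^ j" for t :: real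
proof -
  have ex: "\<exists>j::nat. \<bar>t\<bar> \<le> 2 ^ j"
    using real_arch_pow[of 2 "\<bar>t\<bar>"] by (auto intro: less_imp_le)
  define j where "j = (LEAST j::nat. \<bar>t\<bar> \<le> 2 ^ j)"
  have j: "\<bar>t\<bar> \<le> 2 ^ j" unfolding j_def by (rule LeastI_ex[OF ex])
  have "1 / (1 + t^2) \<le> 4 / 4 ^ j"
  proof (cases j)
    case 0
    have "1 / (1 + t^2) \<le> 1 / 1" by (intro divide_left_mono) (auto simp: one_plus_square_pos)
    thus ?thesis using 0 by simp
  next
    case (Suc i)
    have "\<not> \<bar>t\<bar> \<le> 2 ^ i" using not_less_Least[of i "\<lambda>j. \<bar>t\<bar> \<le> 2 ^ j"] Suc unfolding j_def by simp
    hence "(2 ^ i)^2 \<le> \<bar>t\<bar>^2" by (intro power_mono) auto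
    hence "4 ^ i \<le> 1 + t^2" by (simp add: power_mult[symmetric] mult.commute[of i] power_mult)
    hence "1 / (1 + t^2) \<le> 1 / 4 ^ i" by (intro divide_left_mono) (auto simp: one_plus_square_pos)
    thus ?thesis using Suc by simp
  qed
  with j show ?thesis by blast
qed

definition cauchy_average :: "real \<Rightarrow> (real \<Rightarrow> complex) \<Rightarrow> real \<Rightarrow> ennreal" where
  "cauchy_average h f x = (\<integral>\<^sup>+y. ennreal (1 / (1 + ((x - y) / h)^2) / h * cmod (f y)) \<partial>lebesgue)"

text \<open>The space need not be translation invariant, so convolutions are controlled through averages
  only. The dyadic majorant turns the integral of \<open>\<bar>f\<bar>\<close> against the Cauchy kernel
  of width \<open>h\<close> into the geometric series of \<open>8 / 2 ^ j\<close> times the Steklov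
  average of step \<open>2 ^ (j + 1) h\<close>, whose partial sums are Cauchy in \<open>X\<close>. The
  partial sums increase, and local integrability turns their norm convergence to \<open>W\<close> into
  pointwise domination by \<open>\<bar>W\<bar>\<close>.\<close>

lemma cauchy_average_majorant:
  assumes M: "M \<ge> 0" "\<And>h f. h > 0 \<Longrightarrow> f \<in> X \<Longrightarrow> nrm (steklov h f) \<le> M * nrm f"
    and f: "f \<in> X" and h: "h > 0"
  shows "\<exists>W\<in>X. nrm W \<le> 16 * M * nrm f \<and>
     (AE x in lebesgue. cauchy_average h f x \<le> ennreal (cmod (W x)))"
proof -
  let ?I = "\<lambda>x j. {x - (2 ^ Suc j * h)/2..x + (2 ^ Suc j * h)/2}"
  have fm [measurable]: "f \<in> borel_measurable lebesgue" using f by (rule meas)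
  define F where "F = (\<lambda>x. complex_of_real (cmod (f x)))"
  have F: "F \<in> X" "nrm F = nrm f" unfolding F_def using cmod_mem[OF f] by auto
  (* The series is kept as real-valued functions; tst identifies its terms with Steklov averages. *)
  define t where "t j x = 8 / 2 ^ j * (1 / (2 ^ Suc j * h) * (LINT y|lebesgue. indicator (?I x j) y * cmod (f y)))"
    for j :: nat and x
  have hj: "2 ^ Suc j * h > 0" for j :: nat using h by simp
  have tst: "complex_of_real (t j x) = of_real (8 / 2 ^ j) * steklov (2 ^ Suc j * h) F x" for j x
    unfolding t_def F_def steklov_cmod(1)[OF f hj] of_real_mult ..
  have tst': "(\<lambda>x. complex_of_real (t j x)) = (\<lambda>x. of_real (8 / 2 ^ j) * steklov (2 ^ Suc j * h) F x)" for j
    using tst by blast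
  have t0: "0 \<le> t j x" for j x
    unfolding t_def using h by (intro mult_nonneg_nonneg integral_nonneg_AE) auto
  have tX: "(\<lambda>x. complex_of_real (t j x)) \<in> X" for j
    unfolding tst' by (intro scale_mem steklov_mem F hj)
  have tn: "nrm (\<lambda>x. complex_of_real (t j x)) \<le> 8 * M * nrm f * (1 / 2) ^ j" for j
  proof -
    have "nrm (\<lambda>x. complex_of_real (t j x)) = 8 / 2 ^ j * nrm (steklov (2 ^ Suc j * h) F)"
      unfolding tst' by (subst nrm_scale[OF steklov_mem[OF F(1) hj]]) (simp add: norm_divide norm_power)
    also have "\<dots> \<le> 8 / 2 ^ j * (M * nrm F)"
      by (intro mult_left_mono M hj F) auto
    finally show ?thesis by (simp add: F power_one_over field_simps)
  qed
  define w where "w n x = (\<Sum>j<n. t j x)" for n :: nat and x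
  define u where "u n x = complex_of_real (w n x)" for n x
  have u_eq: "u n = (\<lambda>x. \<Sum>j<n. complex_of_real (t j x))" for n
    by (auto simp: u_def w_def)
  have uX: "u n \<in> X" for n unfolding u_eq by (intro sum_mem tX) auto
  have wmono: "w m x \<le> w n x" if "m \<le> n" for m n x
    unfolding w_def using that by (intro sum_mono2 t0) auto
  have w0: "0 \<le> w n x" for n x unfolding w_def by (intro sum_nonneg t0)
  have geom: "(\<Sum>j\<in>{m..<n}. (1/2::real) ^ j) \<le> 2 * (1/2) ^ m" if "m \<le> n" for m n :: nat
  proof -
    have "(\<Sum>j\<in>{m..<n}. (1/2::real) ^ j) = 2 * (1/2) ^ m - 2 * (1/2) ^ n"
      using that by (induction n rule: dec_induct) auto
    thus ?thesis by simp
  qed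
  have ud: "nrm (\<lambda>x. u n x - u m x) \<le> 16 * M * nrm f * (1/2) ^ m" if "m \<le> n" for m n
  proof -
    have "{..<n} = {..<m} \<union> {m..<n}" using that by auto
    hence "(\<Sum>j<n. complex_of_real (t j x)) = (\<Sum>j\<in>{..<m} \<union> {m..<n}. complex_of_real (t j x))" for x
      by simp
    also have "(\<Sum>j\<in>{..<m} \<union> {m..<n}. complex_of_real (t j x))
        = (\<Sum>j<m. complex_of_real (t j x)) + (\<Sum>j\<in>{m..<n}. complex_of_real (t j x))" for x
      by (rule sum.union_disjoint) auto
    finally have "u n x - u m x = (\<Sum>j\<in>{m..<n}. complex_of_real (t j x))" for x
      unfolding u_eq by simp
    hence "nrm (\<lambda>x. u n x - u m x) \<le> (\<Sum>j\<in>{m..<n}. nrm (\<lambda>x. complex_of_real (t j x)))"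
      using nrm_sum_le[of "{m..<n}" "\<lambda>j x. complex_of_real (t j x)"] tX by simp
    also have "\<dots> \<le> (\<Sum>j\<in>{m..<n}. 8 * M * nrm f * (1 / 2) ^ j)" by (intro sum_mono tn)
    also have "\<dots> = 8 * M * nrm f * (\<Sum>j\<in>{m..<n}. (1 / 2) ^ j)" by (simp add: sum_distrib_left)
    also have "\<dots> \<le> 8 * M * nrm f * (2 * (1/2) ^ m)"
      using M nrm_nonneg[OF f] that by (intro mult_left_mono geom) auto
    finally show ?thesis by simp
  qed
  define Q where "Q = 16 * M * nrm f"
  have Q0: "Q \<ge> 0" unfolding Q_def using M nrm_nonneg[OF f] by auto
  have cau: "\<exists>N. \<forall>m\<ge>N. \<forall>n\<ge>N. nrm (\<lambda>x. u m x - u n x) < e" if e: "e > 0" for e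
  proof -
    have "(\<lambda>N. Q * (1/2) ^ N) \<longlonglongrightarrow> Q * 0"
      by (intro tendsto_mult_left LIMSEQ_power_zero) auto
    hence "eventually (\<lambda>N. Q * (1/2) ^ N < e) sequentially"
      using e by (intro order_tendstoD) auto
    then obtain N where N: "Q * (1/2) ^ N < e" by (auto simp: eventually_sequentially)
    have aux: "nrm (\<lambda>x. u m x - u n x) < e" if "N \<le> n" "n \<le> m" for m n
    proof -
      have "nrm (\<lambda>x. u m x - u n x) \<le> Q * (1/2) ^ n" using ud[OF that(2)] by (simp add: Q_def)
      also have "\<dots> \<le> Q * (1/2) ^ N" using that Q0 by (intro mult_left_mono power_decreasing) auto
      finally show ?thesis using N by simp
    qed
    have "nrm (\<lambda>x. u m x - u n x) < e" if "N \<le> n" "N \<le> m" for m n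
      using aux[of n m] aux[of m n] that nrm_minus[OF uX uX, of m n] by (cases "n \<le> m") auto
    thus ?thesis by blast
  qed
  obtain W where W: "W \<in> X" "(\<lambda>n. nrm (\<lambda>x. u n x - W x)) \<longlonglongrightarrow> 0"
    using complete[OF uX cau] by blast
  have Wm [measurable]: "W \<in> borel_measurable lebesgue" using W(1) by (rule meas)
  have um [measurable]: "u n \<in> borel_measurable lebesgue" for n using uX by (rule meas)
  have "w n = (\<lambda>x. Re (u n x))" for n unfolding u_def by simp
  hence wm [measurable]: "w n \<in> borel_measurable lebesgue" for n by simp
  have nW: "nrm W \<le> Q"
  proof -
    have "nrm W - nrm (\<lambda>x. u n x - W x) \<le> Q" for n
    proof -
      have "nrm W \<le> nrm (u n) + nrm (\<lambda>x. u n x - W x)"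
        using nrm_le_add_diff[OF W(1) uX[of n]] nrm_minus[OF W(1) uX[of n]] by simp
      moreover have "nrm (u n) \<le> Q" proof -
        have "u 0 = (\<lambda>x. 0)" by (auto simp: u_def w_def)
        thus ?thesis using ud[of 0 n] by (simp add: Q_def)
      qed
      ultimately show ?thesis by simp
    qed
    moreover have "(\<lambda>n. nrm W - nrm (\<lambda>x. u n x - W x)) \<longlonglongrightarrow> nrm W - 0"
      by (intro tendsto_intros W)
    ultimately show ?thesis using LIMSEQ_le_const2[of _ "nrm W" Q] by auto
  qed
  (* w m - |W| is at most |u n - W| for every n >= m, and the right-hand side tends to 0 in X. *)
  have AEm: "AE x in lebesgue. w m x - cmod (W x) \<le> 0" for m
  proof (rule AE_nonpos_locally)
    fix N :: nat
    have E: "{- real N..real N} \<in> sets lebesgue" "emeasure lebesgue {- real N..real N} < \<infinity>"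
      by (auto simp: emeasure_lborel_Icc_eq)
    obtain c where c: "c > 0" "\<And>f. f \<in> X \<Longrightarrow> (\<integral>\<^sup>+x\<in>{- real N..real N}. ennreal (cmod (f x)) \<partial>lebesgue) \<le> ennreal (c * nrm f)"
      using local_L1[OF E] by blast
    have le: "(\<integral>\<^sup>+x\<in>{- real N..real N}. ennreal (w m x - cmod (W x)) \<partial>lebesgue) \<le> ennreal (c * nrm (\<lambda>x. u n x - W x))" if "m \<le> n" for n
    proof -
      have "w m x - cmod (W x) \<le> cmod (u n x - W x)" for x
      proof -
        have "w m x \<le> w n x" using that by (rule wmono)
        moreover have "cmod (u n x) = w n x" unfolding u_def using w0 by simp
        ultimately show ?thesis using norm_triangle_ineq2[of "u n x" "W x"] by linarith
      qed
      hence "(\<integral>\<^sup>+x\<in>{- real N..real N}. ennreal (w m x - cmod (W x)) \<partial>lebesgue) \<le> (\<integral>\<^sup>+x\<in>{- real N..real N}. ennreal (cmod (u n x - W x)) \<partial>lebesgue)"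
        by (intro nn_integral_mono mult_right_mono ennreal_leI) auto
      also have "\<dots> \<le> ennreal (c * nrm (\<lambda>x. u n x - W x))"
        by (intro c diff_mem uX W)
      finally show ?thesis .
    qed
    have "(\<lambda>n. ennreal (c * nrm (\<lambda>x. u n x - W x))) \<longlonglongrightarrow> ennreal (c * 0)"
      by (intro tendsto_ennrealI tendsto_mult_left W)
    hence "(\<integral>\<^sup>+x\<in>{- real N..real N}. ennreal (w m x - cmod (W x)) \<partial>lebesgue) \<le> ennreal (c * 0)"
      by (rule LIMSEQ_le_const) (use le in blast)
    thus "(\<integral>\<^sup>+x\<in>{- real N..real N}. ennreal (w m x - cmod (W x)) \<partial>lebesgue) = 0" by simp
  qed measurable
  have "AE x in lebesgue. \<forall>m. w m x - cmod (W x) \<le> 0"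
    by (subst AE_all_countable) (use AEm in blast)
  hence "AE x in lebesgue. cauchy_average h f x \<le> ennreal (cmod (W x))"
  proof eventually_elim
    case (elim x)
    define g where "g j y = ennreal (8 / 2 ^ j) * (ennreal (1 / (2 ^ Suc j * h)) * (indicator (?I x j) y * ennreal (cmod (f y))))" for j y
    have icc [measurable]: "(\<lambda>y. indicator {a..b} y :: ennreal) \<in> borel_measurable lebesgue" for a b :: real
      by (rule borel_measurable_indicator) simp
    have fm' [measurable]: "(\<lambda>y. ennreal (cmod (f y))) \<in> borel_measurable lebesgue"
      by measurable
    have gm [measurable]: "g j \<in> borel_measurable lebesgue" for j
      unfolding g_def by (intro borel_measurable_times_ennreal borel_measurable_const icc fm')
    have gint: "(\<integral>\<^sup>+y. g j y \<partial>lebesgue) = ennreal (t j x)" for j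
    proof -
      have "(\<integral>\<^sup>+y. g j y \<partial>lebesgue) = ennreal (8 / 2 ^ j) * (\<integral>\<^sup>+y. ennreal (1 / (2 ^ Suc j * h)) * (indicator (?I x j) y * ennreal (cmod (f y))) \<partial>lebesgue)"
        unfolding g_def
        by (rule nn_integral_cmult) (intro borel_measurable_times_ennreal borel_measurable_const icc fm')
      also have "\<dots> = ennreal (8 / 2 ^ j) * ennreal (1 / (2 ^ Suc j * h) * (LINT y|lebesgue. indicator (?I x j) y * cmod (f y)))"
        by (simp only: steklov_cmod(2)[OF f hj])
      also have "\<dots> = ennreal (t j x)"
        unfolding t_def by (rule ennreal_mult'[symmetric]) simp
      finally show ?thesis .
    qed
    have "ennreal (1 / (1 + ((x - y) / h)^2) / h * cmod (f y)) \<le> (\<Sum>j. g j y)" for y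
    proof -
      obtain j :: nat where j: "\<bar>(x - y) / h\<bar> \<le> 2 ^ j" "1 / (1 + ((x - y) / h)^2) \<le> 4 / 4 ^ j"
        using dyadic_cauchy_majorant by blast
      have "\<bar>x - y\<bar> \<le> 2 ^ j * h" using j(1) h by (simp add: field_simps)
      hence ind: "y \<in> (?I x j)" by auto
      have p4: "(4::real) ^ j = 2 ^ j * 2 ^ j" by (simp add: power_mult_distrib[symmetric])
      have "1 / (1 + ((x - y) / h)^2) / h * cmod (f y) \<le> 4 / 4 ^ j / h * cmod (f y)"
        using j(2) h by (intro mult_right_mono divide_right_mono) auto
      also have "\<dots> = 8 / 2 ^ j * (1 / (2 ^ Suc j * h) * cmod (f y))"
        unfolding p4 by simp
      finally have "ennreal (1 / (1 + ((x - y) / h)^2) / h * cmod (f y)) \<le> ennreal (8 / 2 ^ j * (1 / (2 ^ Suc j * h) * cmod (f y)))"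
        by (rule ennreal_leI)
      also have "\<dots> = g j y"
      proof -
        have "ennreal (8 / 2 ^ j * (1 / (2 ^ Suc j * h) * cmod (f y)))
            = ennreal (8 / 2 ^ j) * ennreal (1 / (2 ^ Suc j * h) * cmod (f y))"
          by (rule ennreal_mult') simp
        also have "ennreal (1 / (2 ^ Suc j * h) * cmod (f y)) = ennreal (1 / (2 ^ Suc j * h)) * ennreal (cmod (f y))"
          by (rule ennreal_mult') (use h in simp)
        finally show ?thesis unfolding g_def using ind by (simp only: indicator_simps mult_1_left)
      qed
      also have "\<dots> \<le> (\<Sum>j. g j y)"
        using sum_le_suminf[of "\<lambda>j. g j y" "{j}"] by simp
      finally show ?thesis .
    qed
    hence "cauchy_average h f x \<le> (\<integral>\<^sup>+y. (\<Sum>j. g j y) \<partial>lebesgue)"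
      unfolding cauchy_average_def by (intro nn_integral_mono)
    also have "\<dots> = (\<Sum>j. \<integral>\<^sup>+y. g j y \<partial>lebesgue)"
      by (rule nn_integral_suminf) measurable
    also have "\<dots> = (\<Sum>j. ennreal (t j x))" by (simp add: gint)
    also have "\<dots> \<le> ennreal (cmod (W x))"
    proof (rule suminf_le_const)
      fix n
      have "(\<Sum>j<n. ennreal (t j x)) = ennreal (w n x)"
        unfolding w_def by (rule sum_ennreal) (rule t0)
      also have "\<dots> \<le> ennreal (cmod (W x))" using elim by (intro ennreal_leI) (simp add: diff_le_eq)
      finally show "(\<Sum>j<n. ennreal (t j x)) \<le> ennreal (cmod (W x))" .
    qed simp
    finally show ?case .
  qed
  with W(1) nW show ?thesis unfolding Q_def by blast
qed

text \<open>Finiteness of the Cauchy average at a single point suffices.\<close>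

lemma moderate_mem:
  assumes "f \<in> X" shows "moderate f"
proof -
  have fm [measurable]: "f \<in> borel_measurable lebesgue" using assms by (rule meas)
  obtain M where M: "M \<ge> 0" "\<And>h f. h > 0 \<Longrightarrow> f \<in> X \<Longrightarrow> nrm (steklov h f) \<le> M * nrm f"
    using steklov_bounded by blast
  obtain W where W: "AE x in lebesgue. cauchy_average 1 f x \<le> ennreal (cmod (W x))"
    using cauchy_average_majorant[OF M assms, of 1] by auto
  have "ae_filter (lebesgue :: real measure) \<noteq> bot"
    by (subst ae_filter_eq_bot_iff) simp
  from eventually_happens'[OF this W] obtain x
    where x: "cauchy_average 1 f x \<le> ennreal (cmod (W x))" ..
  have [measurable]: "(\<lambda>y::real. 1 + y^2) \<in> borel_measurable lebesgue" "(\<lambda>y::real. 1 + (x - y)^2) \<in> borel_measurable lebesgue"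
    by (rule measurable_completion, measurable)+
  have "integrable lebesgue (\<lambda>y. 1 / (1 + (x - y)^2) * cmod (f y))"
  proof (rule integrableI_bounded)
    have "(\<integral>\<^sup>+y. ennreal (norm (1 / (1 + (x - y)^2) * cmod (f y))) \<partial>lebesgue)
        = cauchy_average 1 f x"
      unfolding cauchy_average_def by (intro nn_integral_cong) (simp add: abs_mult)
    also have "\<dots> < \<infinity>" using x by (rule le_less_trans) simp
    finally show "(\<integral>\<^sup>+y. ennreal (norm (1 / (1 + (x - y)^2) * cmod (f y))) \<partial>lebesgue) < \<infinity>" .
  qed measurable
  hence i: "integrable lebesgue (\<lambda>y. 2 * (1 + x^2) * (1 / (1 + (x - y)^2) * cmod (f y)))"
    by (rule integrable_mult_right)
  have bd: "cmod (f y) / (1 + y^2) \<le> 2 * (1 + x^2) * (1 / (1 + (x - y)^2) * cmod (f y))" for y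
    using mult_right_mono[OF cauchy_shift_le[of x "x - y"], of "cmod (f y)"] by simp
  have "integrable lebesgue (\<lambda>y. cmod (f y) / (1 + y^2))"
    by (rule integrable_le[OF i]) (use bd in \<open>auto simp: abs_mult\<close>)
  thus ?thesis by (simp add: moderate_def)
qed

text \<open>The substitute for Young's inequality. The bound does not depend on \<open>h\<close> because
  the Steklov averages are bounded uniformly in their step.\<close>

lemma conv_dil_bounded:
  assumes K: "decaying K"
  obtains C where "C \<ge> 0" "\<And>h f. h > 0 \<Longrightarrow> f \<in> X \<Longrightarrow> conv (dil h K) f \<in> X"
    "\<And>h f. h > 0 \<Longrightarrow> f \<in> X \<Longrightarrow> nrm (conv (dil h K) f) \<le> C * nrm f"
proof -
  obtain M where M: "M \<ge> 0" "\<And>h f. h > 0 \<Longrightarrow> f \<in> X \<Longrightarrow> nrm (steklov h f) \<le> M * nrm f"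
    using steklov_bounded by blast
  obtain C where C: "\<And>x. cmod (K x) \<le> C / (1 + x^2)" "C > 0" using decayingE[OF K] by metis
  have "conv (dil h K) f \<in> X \<and> nrm (conv (dil h K) f) \<le> C * (16 * M) * nrm f" if h: "h > 0" and f: "f \<in> X" for h f
  proof -
    note mf = moderate_mem[OF f] and kd = decaying_dil[OF K h]
    have fm [measurable]: "f \<in> borel_measurable lebesgue" using f by (rule meas)
    obtain W where W: "W \<in> X" "nrm W \<le> 16 * M * nrm f"
     "AE x in lebesgue. cauchy_average h f x \<le> ennreal (cmod (W x))"
      using cauchy_average_majorant[OF M f h] by blast
    have "AE x in lebesgue. cmod (conv (dil h K) f x) \<le> cmod (complex_of_real C * W x)"
      using W(3)
    proof eventually_elim
      case (elim x)
      have [measurable]: "(\<lambda>y::real. 1 + ((x - y) / h)^2) \<in> borel_measurable lebesgue"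
        by (rule measurable_completion) measurable
      have "ennreal (cmod (conv (dil h K) f x)) \<le> (\<integral>\<^sup>+y. ennreal (norm (dil h K (x - y) * f y)) \<partial>lebesgue)"
        unfolding conv_def by (rule integral_norm_bound_ennreal) (rule conv_integrable[OF kd mf])
      also have "\<dots> \<le> (\<integral>\<^sup>+y. ennreal C * ennreal (1 / (1 + ((x - y) / h)^2) / h * cmod (f y)) \<partial>lebesgue)"
      proof (rule nn_integral_mono)
        fix y
        have "norm (dil h K (x - y) * f y) = cmod (K ((x - y) / h)) / h * cmod (f y)"
          using h by (simp add: dil_def norm_mult norm_divide)
        also have "\<dots> \<le> C / (1 + ((x - y) / h)^2) / h * cmod (f y)"
          using h by (intro mult_right_mono divide_right_mono C) auto
        also have "\<dots> = C * (1 / (1 + ((x - y) / h)^2) / h * cmod (f y))" by simp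
        finally show "ennreal (norm (dil h K (x - y) * f y)) \<le> ennreal C * ennreal (1 / (1 + ((x - y) / h)^2) / h * cmod (f y))"
          using C(2) by (subst ennreal_mult'[symmetric]) (auto intro: ennreal_leI)
      qed
      also have "\<dots> = ennreal C * cauchy_average h f x"
        unfolding cauchy_average_def by (rule nn_integral_cmult) measurable
      also have "\<dots> \<le> ennreal C * ennreal (cmod (W x))"
        using elim by (rule mult_left_mono) simp
      also have "\<dots> = ennreal (C * cmod (W x))" using C(2) by (simp add: ennreal_mult)
      finally have "cmod (conv (dil h K) f x) \<le> C * cmod (W x)"
        using C(2) by (subst (asm) ennreal_le_iff) auto
      thus ?case using C(2) by (simp add: norm_mult)
    qed
    moreover have "conv (dil h K) f \<in> borel_measurable lebesgue"
      by (intro measurable_completion) (use conv_measurable[OF kd mf] in simp)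
    ultimately have 1: "conv (dil h K) f \<in> X \<and> nrm (conv (dil h K) f) \<le> nrm (\<lambda>x. complex_of_real C * W x)"
      by (intro solid scale_mem W)
    have "nrm (\<lambda>x. complex_of_real C * W x) = C * nrm W" using C(2) by (simp add: nrm_scale[OF W(1)])
    also have "\<dots> \<le> C * (16 * M * nrm f)" using W(2) C(2) by (intro mult_left_mono) auto
    finally show ?thesis using 1 by (simp add: mult.assoc)
  qed
  thus thesis using that[of "C * (16 * M)"] C(2) M(1) by auto
qed

end

section \<open>Division by the identity minus the forward average\<close>

text \<open>The kernel of the forward average of step one. Since \<open>conv K f x\<close> integrates
  \<open>K (x - y) * f y\<close>, looking forward means that the kernel lives on the negative
  axis.\<close>

definition box_kernel :: "real \<Rightarrow> complex" where
  "box_kernel x = (if x \<in> {-1..0} then 1 else 0)"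

text \<open>The two ramps split the box. The up ramp absorbs a derivative, by partial integration; the
  down ramp has mass \<open>1 / 2\<close>, so that \<open>I - down_ramp\<close> is invertible by a
  Neumann series.\<close>

definition up_ramp :: "real \<Rightarrow> complex" where
  "up_ramp x = (if x \<in> {-1..0} then of_real (1 + x) else 0)"

definition down_ramp :: "real \<Rightarrow> complex" where
  "down_ramp x = (if x \<in> {-1..0} then of_real (- x) else 0)"

lemma box_eq_ramps: "box_kernel = (\<lambda>x. down_ramp x + up_ramp x)"
  by (auto simp: box_kernel_def up_ramp_def down_ramp_def)

text \<open>The constant grows only quadratically with the support, which the geometric decay of the ramp
  powers outweighs.\<close>

lemma decaying_bounded_support:
  assumes "K \<in> borel_measurable borel" "\<And>x. cmod (K x) \<le> B" "\<And>x. K x \<noteq> 0 \<Longrightarrow> \<bar>x\<bar> \<le> r"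
  shows "cmod (K x) \<le> B * (1 + r^2) / (1 + x^2)" and "decaying K"
proof -
  show *: "cmod (K x) \<le> B * (1 + r^2) / (1 + x^2)" for x
  proof (cases "K x = 0")
    case True
    have "0 \<le> B" using assms(2)[of 0] norm_ge_zero order_trans by blast
    thus ?thesis using True one_plus_square_pos[of x] by simp
  next
    case False
    have "\<bar>x\<bar>^2 \<le> r^2" by (intro power_mono assms(3) False) simp
    hence "cmod (K x) * (1 + x^2) \<le> B * (1 + r^2)"
      by (intro mult_mono assms(2)) (auto intro: order_trans[OF norm_ge_zero assms(2)])
    thus ?thesis by (simp add: pos_le_divide_eq one_plus_square_pos)
  qed
  show "decaying K" by (rule decayingI[OF assms(1) *])
qed

lemma decaying_box: "decaying box_kernel"
  by (rule decaying_bounded_support[where B = 1 and r = 1])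
    (auto simp: box_kernel_def[abs_def] intro!: measurable_If split: if_splits)

lemma decaying_up_ramp: "decaying up_ramp"
  by (rule decaying_bounded_support[where B = 1 and r = 1])
    (auto simp: up_ramp_def[abs_def] simp del: of_real_add intro!: measurable_If split: if_splits)

lemma decaying_down_ramp: "decaying down_ramp"
  by (rule decaying_bounded_support[where B = 1 and r = 1])
    (auto simp: down_ramp_def[abs_def] simp del: of_real_minus intro!: measurable_If split: if_splits)

lemma integral_down_ramp: "(LINT y|lborel. cmod (down_ramp (x - y))) = 1 / 2"
proof -
  have "(LINT y|lborel. cmod (down_ramp (x - y))) = (LINT y|lborel. cmod (down_ramp y))"
    using lborel_integral_real_affine[of "-1" "\<lambda>y. cmod (down_ramp y)" x] by simp
  also have "\<dots> = (LINT y|lborel. indicator {-1..0} y *\<^sub>R (- y))"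
    by (intro Bochner_Integration.integral_cong) (auto simp: down_ramp_def split: split_indicator)
  also have "\<dots> = (- (0^2) / 2) - (- ((-1)^2) / 2)"
    by (rule integral_FTC_atLeastAtMost)
      (auto intro!: continuous_intros derivative_eq_intros
        simp: has_real_derivative_iff_has_vector_derivative[symmetric])
  finally show ?thesis by simp
qed

text \<open>The terms of the Neumann series are geometrically small, and the \<open>n\<close>-th one is
  supported in an interval of length \<open>n + 1\<close>; so the sum decays faster than any
  power.\<close>

primrec ramp_power :: "nat \<Rightarrow> real \<Rightarrow> complex" where
  "ramp_power 0 = down_ramp"
| "ramp_power (Suc n) = conv down_ramp (ramp_power n)"

lemma decaying_ramp_power: "decaying (ramp_power n)"
  by (induction n) (auto intro: decaying_down_ramp decaying_conv)

lemma ramp_power_bound: "cmod (ramp_power n x) \<le> (1/2) ^ n"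
proof (induction n arbitrary: x)
  case 0
  show ?case by (auto simp: down_ramp_def simp del: of_real_minus)
next
  case (Suc n)
  note m = decaying_measurable[OF decaying_down_ramp] decaying_measurable[OF decaying_ramp_power[of n]]
  have i: "integrable lborel (\<lambda>y. cmod (down_ramp (x - y)) * cmod (ramp_power n y))"
    using decaying_product_le[OF decaying_down_ramp decaying_ramp_power[of n]] by blast
  have i2: "integrable lborel (\<lambda>y. cmod (down_ramp (x - y)))"
    using integral_down_ramp[of x] not_integrable_integral_eq by fastforce
  have "cmod (ramp_power (Suc n) x) = cmod (LINT y|lborel. down_ramp (x - y) * ramp_power n y)"
    using m by (simp add: conv_borel)
  also have "\<dots> \<le> (LINT y|lborel. cmod (down_ramp (x - y) * ramp_power n y))"
    by (rule integral_norm_bound)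
  also have "\<dots> \<le> (LINT y|lborel. cmod (down_ramp (x - y)) * (1/2) ^ n)"
    unfolding norm_mult by (intro integral_mono i integrable_mult_left i2 mult_left_mono Suc) auto
  also have "\<dots> = (1/2) ^ Suc n"
    by (simp add: integral_down_ramp)
  finally show ?case .
qed

lemma ramp_power_support: "ramp_power n x \<noteq> 0 \<Longrightarrow> - real (n + 1) \<le> x \<and> x \<le> 0"
proof (induction n arbitrary: x)
  case 0
  thus ?case by (auto simp: down_ramp_def split: if_splits)
next
  case (Suc n)
  show ?case
  proof (rule ccontr)
    assume *: "\<not> ?case"
    have "down_ramp (x - y) * ramp_power n y = 0" for y
      using Suc.IH[of y] * by (auto simp: down_ramp_def split: if_splits)
    hence "(\<lambda>y. down_ramp (x - y) * ramp_power n y) = (\<lambda>y. 0)" by blast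
    hence "ramp_power (Suc n) x = 0" by (simp add: conv_def del: mult_eq_0_iff)
    with Suc.prems show False by simp
  qed
qed

text \<open>\<open>I + ramp_resolvent\<close> is the inverse of \<open>I - down_ramp\<close>.\<close>

definition ramp_resolvent :: "real \<Rightarrow> complex" where
  "ramp_resolvent x = (\<Sum>n. ramp_power n x)"

lemma summable_ramp_power: "summable (\<lambda>n. cmod (ramp_power n x))"
  by (rule summable_comparison_test'[of "\<lambda>n. (1/2::real) ^ n" 0]) (auto intro: ramp_power_bound summable_geometric)

lemma decaying_ramp_resolvent: "decaying ramp_resolvent"
proof -
  define c where "c n = (1/2) ^ n * (1 + (real (n + 1))^2)" for n
  have bd: "cmod (ramp_power n x) \<le> c n / (1 + x^2)" for n x
    unfolding c_def
  proof (rule decaying_bounded_support(1))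
    show "\<bar>y\<bar> \<le> real (n + 1)" if "ramp_power n y \<noteq> 0" for y
      using ramp_power_support[OF that] by auto
  qed (auto intro: decaying_measurable decaying_ramp_power ramp_power_bound)
  have sc: "summable c"
  proof (rule summable_ratio_test[of "3/4" 4])
    fix n :: nat assume n: "4 \<le> n"
    have "4 * real n \<le> (real n)^2"
      using n by (simp add: power2_eq_square)
    hence "2 * (1 + (real n + 2)^2) \<le> 3 * (1 + (real n + 1)^2)"
      using n power2_sum[of "real n" 2] power2_sum[of "real n" 1] by simp
    hence "(1/2) ^ n * (2 * (1 + (real n + 2)^2)) \<le> (1/2) ^ n * (3 * (1 + (real n + 1)^2))"
      by (intro mult_left_mono) auto
    thus "norm (c (Suc n)) \<le> 3 / 4 * norm (c n)"
      unfolding c_def by (simp add: abs_mult add.commute)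
  qed simp
  show ?thesis
  proof (rule decayingI[of _ "suminf c"])
    have [measurable]: "\<And>n. ramp_power n \<in> borel_measurable borel"
      by (intro decaying_measurable decaying_ramp_power)
    show "ramp_resolvent \<in> borel_measurable borel"
      unfolding ramp_resolvent_def by measurable
    fix x
    have "cmod (ramp_resolvent x) \<le> (\<Sum>n. cmod (ramp_power n x))"
      unfolding ramp_resolvent_def by (rule summable_norm[OF summable_ramp_power])
    also have "\<dots> \<le> (\<Sum>n. c n / (1 + x^2))"
      by (intro suminf_le bd summable_ramp_power summable_divide sc)
    also have "\<dots> = suminf c / (1 + x^2)"
      by (rule suminf_divide[OF sc])
    finally show "cmod (ramp_resolvent x) \<le> suminf c / (1 + x^2)" .
  qed
qed

lemma ramp_resolvent_eq: "conv down_ramp ramp_resolvent = (\<lambda>x. ramp_resolvent x - down_ramp x)"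
proof
  fix x
  note m = decaying_measurable[OF decaying_down_ramp] decaying_measurable[OF decaying_ramp_power]
     decaying_measurable[OF decaying_ramp_resolvent]
  note [measurable] = m
  have i: "integrable lborel (\<lambda>y. cmod (down_ramp (x - y)) * cmod (ramp_power n y))" for n
    using decaying_product_le[OF decaying_down_ramp decaying_ramp_power[of n]] by blast
  have i2: "integrable lborel (\<lambda>y. cmod (down_ramp (x - y)))"
    using integral_down_ramp[of x] not_integrable_integral_eq by fastforce
  have i': "integrable lborel (\<lambda>y. down_ramp (x - y) * ramp_power n y)" for n
    using i[of n] by (rule integrable_le) (auto simp: norm_mult)
  have s: "summable (\<lambda>n. LINT y|lborel. norm (down_ramp (x - y) * ramp_power n y))"
  proof (rule summable_comparison_test'[of "\<lambda>n. (1/2::real) ^ n" 0])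
    fix n
    have "(LINT y|lborel. cmod (down_ramp (x - y) * ramp_power n y)) \<le> (LINT y|lborel. cmod (down_ramp (x - y)) * (1/2) ^ n)"
      unfolding norm_mult by (intro integral_mono i integrable_mult_left i2 mult_left_mono ramp_power_bound) auto
    also have "\<dots> \<le> (1/2) ^ n" by (simp add: integral_down_ramp)
    finally show "norm (LINT y|lborel. cmod (down_ramp (x - y) * ramp_power n y)) \<le> (1/2) ^ n"
      by (simp add: integral_nonneg_AE)
  qed (simp add: summable_geometric)
  have sp: "summable (\<lambda>n. ramp_power n y)" for y
    by (rule summable_norm_cancel[OF summable_ramp_power])
  have "conv down_ramp ramp_resolvent x = (LINT y|lborel. down_ramp (x - y) * ramp_resolvent y)"
    by (rule conv_borel) (fact m)+
  also have "\<dots> = (LINT y|lborel. (\<Sum>n. down_ramp (x - y) * ramp_power n y))"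
    unfolding ramp_resolvent_def by (simp add: suminf_mult[OF sp])
  also have "\<dots> = (\<Sum>n. (LINT y|lborel. down_ramp (x - y) * ramp_power n y))"
    by (rule integral_suminf[OF i' _ s])
      (auto simp: norm_mult intro!: AE_I2 summable_mult summable_ramp_power)
  also have "\<dots> = (\<Sum>n. ramp_power (Suc n) x)"
    using m by (simp add: conv_borel)
  also have "\<dots> = ramp_resolvent x - down_ramp x"
    unfolding ramp_resolvent_def using suminf_split_head[OF sp[of x]] by simp
  finally show "conv down_ramp ramp_resolvent x = ramp_resolvent x - down_ramp x" .
qed

text \<open>Finitely many exceptional points are needed because the box kernel jumps.\<close>

definition primitive_kernel :: "(real \<Rightarrow> complex) \<Rightarrow> (real \<Rightarrow> complex) \<Rightarrow> bool" where
  "primitive_kernel P N \<longleftrightarrow> decaying P \<and> decaying N \<and> continuous_on UNIV P \<and>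
     (\<exists>S. finite S \<and> (\<forall>x. x \<notin> S \<longrightarrow> (P has_vector_derivative N x) (at x)))"

text \<open>Partial integration over \<open>[x, x + 1]\<close>: the weight \<open>1 + x - y\<close> is
  \<open>1\<close> at the left and \<open>0\<close> at the right end, and its derivative is minus the
  box.\<close>

lemma conv_up_ramp_primitive:
  assumes "primitive_kernel P N"
  shows "conv up_ramp N = (\<lambda>x. conv box_kernel P x - P x)"
proof
  fix x
  from assms obtain S where PN: "decaying P" "decaying N" "continuous_on UNIV P" "finite S"
    "\<And>x. x \<notin> S \<Longrightarrow> (P has_vector_derivative N x) (at x)"
    unfolding primitive_kernel_def by blast
  have mP: "P \<in> borel_measurable borel" "N \<in> borel_measurable borel"
    using PN by (auto intro: decaying_measurable)
  have int: "integrable lborel (\<lambda>y. K (x - y) * J y)" if "decaying K" "decaying J" for K J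
    using conv_integrable[OF that(1) moderate_decaying[OF that(2)], of x] that[THEN decaying_measurable]
    by (subst (asm) integrable_completion) auto
  define f where "f y = of_real (1 + x - y) * N y - P y" for y
  have "((\<lambda>y. of_real (1 + x - y) * P y) has_vector_derivative f y) (at y)" if "y \<notin> S" for y
  proof -
    have "((\<lambda>y. complex_of_real (1 + x - y)) has_vector_derivative of_real (-1)) (at y)"
      by (rule has_vector_derivative_of_real) (auto intro!: derivative_eq_intros)
    from has_vector_derivative_mult[OF this PN(5)[OF that]] show ?thesis
      by (simp add: f_def)
  qed
  hence "(f has_integral (of_real (1 + x - (x + 1)) * P (x + 1) - of_real (1 + x - x) * P x)) {x..x+1}"
    by (intro fundamental_theorem_of_calculus_interior_strong[OF PN(4)] continuous_intros
         continuous_on_subset[OF PN(3)]) auto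
  hence 1: "((\<lambda>y. if y \<in> {x..x+1} then f y else 0) has_integral - P x) UNIV"
    by (subst has_integral_restrict_UNIV) simp
  have eq: "(\<lambda>y. up_ramp (x - y) * N y - box_kernel (x - y) * P y) = (\<lambda>y. if y \<in> {x..x+1} then f y else 0)"
    by (auto simp: up_ramp_def box_kernel_def f_def fun_eq_iff algebra_simps)
  have "((\<lambda>y. up_ramp (x - y) * N y - box_kernel (x - y) * P y) has_integral
        (LINT y|lborel. up_ramp (x - y) * N y - box_kernel (x - y) * P y)) UNIV"
    by (intro has_integral_integral_lborel Bochner_Integration.integrable_diff int decaying_box decaying_up_ramp PN)
  hence "(LINT y|lborel. up_ramp (x - y) * N y - box_kernel (x - y) * P y) = - P x"
    using 1 unfolding eq by (rule has_integral_unique)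
  moreover have "(LINT y|lborel. up_ramp (x - y) * N y - box_kernel (x - y) * P y) = conv up_ramp N x - conv box_kernel P x"
    using Bochner_Integration.integral_diff[OF int[OF decaying_up_ramp PN(2)] int[OF decaying_box PN(1)]]
    by (simp add: conv_borel decaying_measurable decaying_up_ramp decaying_box PN)
  ultimately show "conv up_ramp N x = conv box_kernel P x - P x" by (simp add: algebra_simps)
qed

text \<open>The kernel of \<open>(I + ramp_resolvent) (N - P)\<close>, which is the quotient of
  \<open>N = P'\<close> by \<open>I - box_kernel\<close>.\<close>

definition box_quotient :: "(real \<Rightarrow> complex) \<Rightarrow> (real \<Rightarrow> complex) \<Rightarrow> real \<Rightarrow> complex" where
  "box_quotient P N x = (N x - P x) + conv ramp_resolvent (\<lambda>y. N y - P y) x"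

lemma decaying_box_quotient: "decaying P \<Longrightarrow> decaying N \<Longrightarrow> decaying (box_quotient P N)"
  unfolding box_quotient_def[abs_def]
  by (intro decaying_add decaying_diff decaying_conv decaying_ramp_resolvent)

text \<open>Let \<open>R\<close> be the resolvent, \<open>D\<close> and \<open>U\<close> the ramps,
  \<open>w = N - P\<close> and \<open>q = (I + R) w\<close>. Then \<open>q - D q = w\<close>. Partial
  integration gives \<open>U N = (D + U) P - P\<close>, hence \<open>U w = - (I - D) P\<close> and
  \<open>U q = - P\<close>. Subtracting, \<open>q - (D + U) q = w + P = N\<close>.\<close>

lemma box_quotient_eq:
  assumes "primitive_kernel P N"
  shows "(\<lambda>x. box_quotient P N x - conv box_kernel (box_quotient P N) x) = N"
proof
  fix x
  have P: "decaying P" and N: "decaying N" using assms by (auto simp: primitive_kernel_def)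
  define w where "w = (\<lambda>y. N y - P y)"
  define q where "q = (\<lambda>x. w x + conv ramp_resolvent w x)"
  have w: "decaying w" unfolding w_def by (intro decaying_diff P N)
  note R = decaying_ramp_resolvent and D = decaying_down_ramp and U = decaying_up_ramp and mk = moderate_decaying
  have q: "decaying q" unfolding q_def by (intro decaying_add w decaying_conv R)
  have "conv down_ramp (conv ramp_resolvent w) = (\<lambda>x. conv ramp_resolvent w x - conv down_ramp w x)"
    unfolding conv_assoc[OF D R mk[OF w]] ramp_resolvent_eq by (rule conv_diff_left[OF R D mk[OF w]])
  hence 1: "conv down_ramp q = conv ramp_resolvent w"
    unfolding q_def by (subst conv_add_right[OF D mk[OF w] mk[OF decaying_conv[OF R w]]]) simp
  have uw: "conv up_ramp w = (\<lambda>x. conv down_ramp P x - P x)"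
  proof -
    have "conv up_ramp w = (\<lambda>x. conv up_ramp N x - conv up_ramp P x)"
      unfolding w_def by (rule conv_diff_right[OF U mk[OF N] mk[OF P]])
    moreover have "conv box_kernel P = (\<lambda>x. conv down_ramp P x + conv up_ramp P x)"
      unfolding box_eq_ramps by (rule conv_add_left[OF D U mk[OF P]])
    ultimately show ?thesis unfolding conv_up_ramp_primitive[OF assms] by simp
  qed
  have "conv up_ramp (conv ramp_resolvent w) = conv ramp_resolvent (conv up_ramp w)"
    unfolding conv_assoc[OF U R mk[OF w]] conv_assoc[OF R U mk[OF w]] conv_commute[OF U R] ..
  also have "\<dots> = (\<lambda>x. conv ramp_resolvent (conv down_ramp P) x - conv ramp_resolvent P x)"
    unfolding uw by (rule conv_diff_right[OF R mk[OF decaying_conv[OF D P]] mk[OF P]])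
  also have "conv ramp_resolvent (conv down_ramp P) = (\<lambda>x. conv ramp_resolvent P x - conv down_ramp P x)"
    unfolding conv_assoc[OF R D mk[OF P]] conv_commute[OF R D] ramp_resolvent_eq
    by (rule conv_diff_left[OF R D mk[OF P]])
  finally have 2: "conv up_ramp q = (\<lambda>x. - P x)"
    unfolding q_def by (subst conv_add_right[OF U mk[OF w] mk[OF decaying_conv[OF R w]]]) (simp add: uw)
  have "conv box_kernel q = (\<lambda>x. conv down_ramp q x + conv up_ramp q x)"
    unfolding box_eq_ramps by (rule conv_add_left[OF D U mk[OF q]])
  hence "q x - conv box_kernel q x = N x"
    unfolding 1 2 by (simp add: q_def w_def)
  moreover have "box_quotient P N = q" by (auto simp: box_quotient_def q_def w_def)
  ultimately show "box_quotient P N x - conv box_kernel (box_quotient P N) x = N x" by simp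
qed

lemma steklov_fwd_eq_conv:
  assumes h: "h > 0" shows "steklov_fwd h f = conv (dil h box_kernel) f"
proof
  fix x
  have "conv (dil h box_kernel) f x = (LINT y|lebesgue. (1 / h) *\<^sub>R (indicat_real {x..x + h} y *\<^sub>R f y))"
    unfolding conv_def
    by (rule Bochner_Integration.integral_cong)
      (use h in \<open>auto simp: dil_def box_kernel_def scaleR_conv_of_real field_simps split: split_indicator\<close>)
  also have "\<dots> = steklov_fwd h f x"
  proof -
    have "x + h / 2 - h / 2 = x" "x + h / 2 + h / 2 = x + h" by simp_all
    thus ?thesis
      unfolding steklov_fwd_def steklov_def set_lebesgue_integral_def by (simp only: integral_scaleR_right)
  qed
  finally show "steklov_fwd h f x = conv (dil h box_kernel) f x" by simp
qed

lemma I_minus_steklov_fwd_eq: "h > 0 \<Longrightarrow> I_minus_steklov_fwd h f = (\<lambda>x. f x - conv (dil h box_kernel) f x)"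
  by (simp add: I_minus_steklov_fwd_def steklov_fwd_eq_conv fun_eq_iff)

context averaging_lattice begin

lemma conv_dil_mem: "decaying K \<Longrightarrow> h > 0 \<Longrightarrow> f \<in> X \<Longrightarrow> conv (dil h K) f \<in> X"
  by (rule conv_dil_bounded[of K])

lemma I_minus_steklov_fwd_mem: "h > 0 \<Longrightarrow> f \<in> X \<Longrightarrow> I_minus_steklov_fwd h f \<in> X"
  unfolding I_minus_steklov_fwd_eq by (intro diff_mem conv_dil_mem decaying_box)

lemma conv_eq_box_quotient:
  assumes PN: "primitive_kernel P N" and h: "h > 0" and f: "f \<in> X"
  shows "conv (dil h N) f = conv (dil h (box_quotient P N)) (I_minus_steklov_fwd h f)"
proof -
  have P: "decaying P" and N: "decaying N" using PN by (auto simp: primitive_kernel_def)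
  define q where "q = box_quotient P N"
  have q: "decaying q" unfolding q_def by (intro decaying_box_quotient P N)
  note f' = moderate_mem[OF f] and q' = decaying_dil[OF q h] and b' = decaying_dil[OF decaying_box h]
  have "conv (dil h q) (I_minus_steklov_fwd h f) = (\<lambda>x. conv (dil h q) f x - conv (dil h q) (conv (dil h box_kernel) f) x)"
    unfolding I_minus_steklov_fwd_eq[OF h]
    by (intro conv_diff_right q' f' moderate_mem[OF conv_dil_mem] decaying_box h f)
  also have "conv (dil h q) (conv (dil h box_kernel) f) = conv (dil h (conv box_kernel q)) f"
    unfolding conv_assoc[OF q' b' f'] conv_dil[OF q decaying_box h] conv_commute[OF q decaying_box] ..
  also have "(\<lambda>x. conv (dil h q) f x - conv (dil h (conv box_kernel q)) f x) = conv (dil h N) f"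
    using conv_diff_left[OF q' decaying_dil[OF decaying_conv[OF decaying_box q] h] f', symmetric]
    unfolding dil_diff[symmetric] q_def box_quotient_eq[OF PN] by simp
  finally show ?thesis unfolding q_def ..
qed

text \<open>Division by \<open>I\<close> minus the forward average costs a constant independent of the
  step. In terms of Fourier multipliers, \<open>1 - (exp (i t) - 1) / (i t)\<close> has no real zero but
  \<open>t = 0\<close>, and this zero is simple; having a primitive \<open>P\<close> lets
  \<open>N\<close> compensate it.\<close>

lemma divide_by_difference:
  assumes PN: "primitive_kernel P N"
  obtains C where "C \<ge> 0" "\<And>h f. h > 0 \<Longrightarrow> f \<in> X \<Longrightarrow>
    nrm (conv (dil h N) f) \<le> C * (nrm (conv (dil h N) (I_minus_steklov_fwd h f))
       + nrm (conv (dil h P) (I_minus_steklov_fwd h f)))"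
proof -
  have P: "decaying P" and N: "decaying N" using PN by (auto simp: primitive_kernel_def)
  obtain C where C: "C \<ge> 0" "\<And>h f. h > 0 \<Longrightarrow> f \<in> X \<Longrightarrow> nrm (conv (dil h ramp_resolvent) f) \<le> C * nrm f"
    using conv_dil_bounded[OF decaying_ramp_resolvent] by metis
  have "nrm (conv (dil h N) f) \<le> (1 + C) * (nrm (conv (dil h N) (I_minus_steklov_fwd h f))
       + nrm (conv (dil h P) (I_minus_steklov_fwd h f)))" if h: "h > 0" and f: "f \<in> X" for h f
  proof -
    define g where "g = I_minus_steklov_fwd h f"
    have g: "g \<in> X" unfolding g_def by (intro I_minus_steklov_fwd_mem h f)
    note g' = moderate_mem[OF g]
    define w where "w = (\<lambda>y. N y - P y)"
    have w: "decaying w" unfolding w_def by (intro decaying_diff P N)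
    note R = decaying_ramp_resolvent
    have wg: "conv (dil h w) g = (\<lambda>x. conv (dil h N) g x - conv (dil h P) g x)"
      unfolding w_def dil_diff by (intro conv_diff_left decaying_dil N P h g')
    have Ng: "conv (dil h N) g \<in> X" "conv (dil h P) g \<in> X" by (intro conv_dil_mem N P h g)+
    have wgX: "conv (dil h w) g \<in> X" by (intro conv_dil_mem w h g)
    have "conv (dil h N) f = conv (dil h (\<lambda>x. w x + conv ramp_resolvent w x)) g"
      unfolding conv_eq_box_quotient[OF PN h f] g_def box_quotient_def[abs_def] w_def ..
    also have "\<dots> = (\<lambda>x. conv (dil h w) g x + conv (dil h ramp_resolvent) (conv (dil h w) g) x)"
      unfolding dil_add conv_assoc[OF decaying_dil[OF R h] decaying_dil[OF w h] g'] conv_dil[OF R w h]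
      by (intro conv_add_left decaying_dil w decaying_conv R h g')
    finally have "nrm (conv (dil h N) f) \<le> nrm (conv (dil h w) g) + nrm (conv (dil h ramp_resolvent) (conv (dil h w) g))"
      using nrm_triangle[OF wgX conv_dil_mem[OF R h wgX]] by simp
    also have "\<dots> \<le> (1 + C) * nrm (conv (dil h w) g)"
      using C(2)[OF h wgX] by (simp add: distrib_right)
    also have "\<dots> \<le> (1 + C) * (nrm (conv (dil h N) g) + nrm (conv (dil h P) g))"
      unfolding wg using nrm_diff_le[OF Ng] C(1) by (intro mult_left_mono) auto
    finally show ?thesis unfolding g_def .
  qed
  with C(1) that[of "1 + C"] show thesis by auto
qed

end

section \<open>A band-limited mollifier\<close>

text \<open>The function \<open>F z * exp (- i \<xi> z)\<close> decays exponentially in the lower half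
  plane because \<open>\<xi> > g\<close>. Its integral over \<open>[-R, R]\<close> is moved to the other
  three sides of the rectangle of depth \<open>R\<close> below it: the vertical sides contribute
  \<open>O(1 / R)\<close>, the lower side an exponentially small amount.\<close>

lemma fourier_band_limited_aux:
  fixes F :: "complex \<Rightarrow> complex"
  assumes hol: "F holomorphic_on UNIV"
    and bd: "\<And>z. cmod (F z) \<le> B * exp (g * \<bar>Im z\<bar>) / (1 + (Re z)^2)"
    and int: "integrable lborel (\<lambda>x. F (of_real x))" and xi: "\<xi> > g"
  shows "(LINT x|lborel. F (of_real x) * exp (- (\<i> * of_real (\<xi> * x)))) = 0"
proof -
  define G where "G z = F z * exp (- (\<i> * of_real \<xi> * z))" for z
  have B0: "B \<ge> 0" using order_trans[OF norm_ge_zero bd[of 0]] by simp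
  have Gbd: "cmod (G z) \<le> B * exp ((\<xi> - g) * Im z) / (1 + (Re z)^2)" if "Im z \<le> 0" for z
  proof -
    have "cmod (G z) = cmod (F z) * exp (\<xi> * Im z)" by (simp add: G_def norm_mult)
    also have "\<dots> \<le> B * exp (g * \<bar>Im z\<bar>) / (1 + (Re z)^2) * exp (\<xi> * Im z)"
      by (intro mult_right_mono bd) auto
    also have "\<dots> = B * (exp (g * \<bar>Im z\<bar>) * exp (\<xi> * Im z)) / (1 + (Re z)^2)" by simp
    also have "exp (g * \<bar>Im z\<bar>) * exp (\<xi> * Im z) = exp ((\<xi> - g) * Im z)"
      using that by (simp add: exp_add[symmetric] algebra_simps)
    finally show ?thesis .
  qed
  have "G holomorphic_on UNIV" unfolding G_def by (intro holomorphic_intros hol)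
  then obtain P where P: "\<And>z. (P has_field_derivative G z) (at z)"
    using holomorphic_convex_primitive'[of UNIV G] by auto
  have I: "(LINT x|lborel. indicator {-R..R} x *\<^sub>R G (of_real x)) = P (of_real R) - P (of_real (-R))" if "R \<ge> 0" for R
  proof (rule integral_FTC_atLeastAtMost)
    show "- R \<le> R" using that by simp
    show "((\<lambda>x. P (of_real x)) has_vector_derivative G (of_real x)) (at x within {-R..R})" for x
      by (rule has_vector_derivative_real_field) (rule P)
    have "continuous_on UNIV G" using \<open>G holomorphic_on UNIV\<close> by (rule holomorphic_on_imp_continuous_on)
    thus "continuous_on {-R..R} (\<lambda>x. G (of_real x))"
      by (rule continuous_on_compose2[of UNIV G _ complex_of_real]) (auto intro: continuous_on_of_real continuous_on_id)
  qed
  have seg: "cmod (P a - P b) \<le> K * cmod (a - b)"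
    if "\<And>z. z \<in> closed_segment a b \<Longrightarrow> cmod (G z) \<le> K" for a b K
    by (rule field_differentiable_bound[of "closed_segment a b" P G])
      (auto intro: has_field_derivative_at_within[OF P] that)
  have bound: "cmod (LINT x|lborel. indicator {-R..R} x *\<^sub>R G (of_real x))
       \<le> 2 * (B / (1 + R^2) * R) + B * exp (- (\<xi> - g) * R) * (2 * R)" if R: "R > 0" for R
  proof -
    have v: "cmod (P (of_real r) - P (Complex r (- R))) \<le> B / (1 + R^2) * R" if r: "r^2 = R^2" for r
    proof -
      have "cmod (P (of_real r) - P (Complex r (- R))) \<le> B / (1 + R^2) * cmod (of_real r - Complex r (- R))"
      proof (rule seg)
        fix z assume "z \<in> closed_segment (complex_of_real r) (Complex r (- R))"
        hence z: "Re z = r" "Im z \<le> 0"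
          using R by (auto simp: closed_segment_same_Re closed_segment_eq_real_ivl)
        have "cmod (G z) \<le> B * exp ((\<xi> - g) * Im z) / (1 + (Re z)^2)" using z by (intro Gbd)
        also have "\<dots> \<le> B * 1 / (1 + (Re z)^2)"
          using B0 z xi by (intro divide_right_mono mult_left_mono) (auto simp: mult_le_0_iff)
        finally show "cmod (G z) \<le> B / (1 + R^2)" using z r by simp
      qed
      also have "complex_of_real r - Complex r (- R) = \<i> * of_real R" by (simp add: complex_eq_iff)
      finally show ?thesis using R by (simp add: norm_mult)
    qed
    have h: "cmod (P (Complex R (- R)) - P (Complex (- R) (- R))) \<le> B * exp (- (\<xi> - g) * R) * (2 * R)"
    proof -
      have "cmod (P (Complex R (- R)) - P (Complex (- R) (- R))) \<le> B * exp (- (\<xi> - g) * R) * cmod (Complex R (- R) - Complex (- R) (- R))"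
      proof (rule seg)
        fix z assume "z \<in> closed_segment (Complex R (- R)) (Complex (- R) (- R))"
        hence z: "Im z = - R" by (auto simp: closed_segment_same_Im)
        have "cmod (G z) \<le> B * exp ((\<xi> - g) * Im z) / (1 + (Re z)^2)" using z R by (intro Gbd) simp
        also have "\<dots> \<le> B * exp ((\<xi> - g) * Im z) / 1"
          using B0 by (intro divide_left_mono) (auto simp: one_plus_square_pos)
        finally show "cmod (G z) \<le> B * exp (- (\<xi> - g) * R)" using z by (simp add: algebra_simps)
      qed
      also have "Complex R (- R) - Complex (- R) (- R) = of_real (2 * R)" by (simp add: complex_eq_iff)
      also have "cmod (of_real (2 * R)) = 2 * R" using R by (simp only: norm_of_real)
      finally show ?thesis .
    qed
    have "cmod (P (of_real R) - P (of_real (- R))) \<le> cmod (P (of_real R) - P (Complex R (- R)))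
       + cmod (P (Complex R (- R)) - P (Complex (- R) (- R))) + cmod (P (of_real (- R)) - P (Complex (- R) (- R)))"
    proof -
      have split: "P (of_real R) - P (of_real (- R)) = (P (of_real R) - P (Complex R (- R)))
       + (P (Complex R (- R)) - P (Complex (- R) (- R))) - (P (of_real (- R)) - P (Complex (- R) (- R)))" by simp
      show ?thesis
        by (subst split) (rule order_trans[OF norm_triangle_ineq4 add_right_mono[OF norm_triangle_ineq]])
    qed
    with v[of R] v[of "-R"] h I[of R] R show ?thesis by simp
  qed
  have Gint: "integrable lborel (\<lambda>x. G (of_real x))"
  proof (rule integrable_le[OF int])
    have [measurable]: "(\<lambda>x. F (complex_of_real x)) \<in> borel_measurable borel"
      using borel_measurable_integrable[OF int] by simp
    show "(\<lambda>x. G (complex_of_real x)) \<in> borel_measurable lborel" unfolding G_def by measurable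
  qed (auto simp: G_def norm_mult)
  have "(\<lambda>n::nat. LINT x|lborel. indicator {- real n..real n} x *\<^sub>R G (of_real x)) \<longlonglongrightarrow> (LINT x|lborel. G (of_real x))"
  proof (rule integral_dominated_convergence)
    show "integrable lborel (\<lambda>x. cmod (G (of_real x)))" using Gint by (rule integrable_norm)
    show "AE x in lborel. (\<lambda>n. indicator {- real n..real n} x *\<^sub>R G (of_real x)) \<longlonglongrightarrow> G (of_real x)"
    proof (rule AE_I2)
      fix x :: real
      obtain N :: nat where N: "\<bar>x\<bar> \<le> real N" using real_arch_simple by blast
      have "eventually (\<lambda>n. indicator {- real n..real n} x *\<^sub>R G (of_real x) = G (of_real x)) sequentially"
        unfolding eventually_sequentially
      proof (intro exI allI impI)
        fix n assume "N \<le> n"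
        with N have "x \<in> {- real n..real n}" by auto
        thus "indicator {- real n..real n} x *\<^sub>R G (of_real x) = G (of_real x)" by simp
      qed
      thus "(\<lambda>n. indicator {- real n..real n} x *\<^sub>R G (of_real x)) \<longlonglongrightarrow> G (of_real x)"
        by (rule tendsto_eventually)
    qed
    have [measurable]: "(\<lambda>x. G (complex_of_real x)) \<in> borel_measurable lborel"
      using Gint by (rule borel_measurable_integrable)
    show "(\<lambda>x. G (complex_of_real x)) \<in> borel_measurable lborel" by fact
    show "(\<lambda>x. indicator {- real n..real n} x *\<^sub>R G (of_real x)) \<in> borel_measurable lborel" for n
      by measurable
  qed (auto split: split_indicator)
  moreover have "(\<lambda>n::nat. LINT x|lborel. indicator {- real n..real n} x *\<^sub>R G (of_real x)) \<longlonglongrightarrow> 0"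
  proof (rule Lim_null_comparison)
    show "eventually (\<lambda>n. norm (LINT x|lborel. indicator {- real n..real n} x *\<^sub>R G (of_real x))
       \<le> 2 * (B / (1 + (real n)^2) * real n) + B * exp (- (\<xi> - g) * real n) * (2 * real n)) sequentially"
      using eventually_gt_at_top[of 0] by eventually_elim (rule bound, simp)
    define c where "c = \<xi> - g"
    have "c > 0" using xi by (simp add: c_def)
    thus "(\<lambda>n::nat. 2 * (B / (1 + (real n)^2) * real n) + B * exp (- (\<xi> - g) * real n) * (2 * real n)) \<longlonglongrightarrow> 0"
      unfolding c_def[symmetric] by real_asymp
  qed
  ultimately have "(LINT x|lborel. G (of_real x)) = 0" by (rule LIMSEQ_unique)
  thus ?thesis by (simp add: G_def mult.assoc)
qed

lemma fourier_band_limited: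
  fixes F :: "complex \<Rightarrow> complex"
  assumes hol: "F holomorphic_on UNIV"
    and bd: "\<And>z. cmod (F z) \<le> B * exp (g * \<bar>Im z\<bar>) / (1 + (Re z)^2)"
    and int: "integrable lborel (\<lambda>x. F (of_real x))" and xi: "\<bar>\<xi>\<bar> > g"
  shows "(LINT x|lborel. F (of_real x) * exp (- (\<i> * of_real (\<xi> * x)))) = 0"
proof (cases "\<xi> > g")
  case True
  thus ?thesis using fourier_band_limited_aux[OF hol bd int] by blast
next
  case False
  have "(LINT x|lborel. F (- of_real x) * exp (- (\<i> * of_real (- \<xi> * x)))) = 0"
  proof (rule fourier_band_limited_aux)
    show "(\<lambda>z. F (- z)) holomorphic_on UNIV"
      using holomorphic_on_compose[OF holomorphic_on_minus[OF holomorphic_on_ident] holomorphic_on_subset[OF hol]]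
      by (simp add: o_def)
    show "cmod (F (- z)) \<le> B * exp (g * \<bar>Im z\<bar>) / (1 + (Re z)^2)" for z using bd[of "- z"] by simp
    show "integrable lborel (\<lambda>x. F (- complex_of_real x))"
      using lborel_integrable_real_affine[OF int, of "-1" 0] by simp
    show "- \<xi> > g" using False xi by simp
  qed
  thus ?thesis
    using lborel_integral_real_affine[of "-1" "\<lambda>x. F (of_real x) * exp (- (\<i> * of_real (\<xi> * x)))" 0] by simp
qed

definition entire_sinc :: "complex \<Rightarrow> complex" where
  "entire_sinc z = (if z = 0 then 1 else sin z / z)"

lemma entire_sinc_holomorphic: "entire_sinc holomorphic_on UNIV"
proof (rule no_isolated_singularity[of _ _ "{0}"])
  have away: "entire_sinc holomorphic_on UNIV - {0}"
  proof (rule holomorphic_transform)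
    show "(\<lambda>z. sin z / z) holomorphic_on UNIV - {0}"
      by (intro holomorphic_intros) auto
  qed (auto simp: entire_sinc_def)
  thus "entire_sinc holomorphic_on UNIV - {0}" .
  have "((\<lambda>z::complex. sin z / z) \<longlongrightarrow> 1) (at 0)"
    using DERIV_sin[of "0::complex"] by (simp add: has_field_derivative_iff)
  hence "(entire_sinc \<longlongrightarrow> 1) (at 0)"
    by (rule Lim_transform_eventually) (auto simp: entire_sinc_def eventually_at_filter)
  hence "isCont entire_sinc 0"
    by (simp add: isCont_def entire_sinc_def)
  moreover have "isCont entire_sinc z" if "z \<noteq> 0" for z
    using holomorphic_on_imp_continuous_on[OF away] that
    by (auto simp: continuous_on_eq_continuous_at open_delete)
  ultimately show "continuous_on UNIV entire_sinc"
    by (metis continuous_at_imp_continuous_on)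
qed auto

text \<open>Near the origin the function is bounded by continuity; elsewhere both it and its product with
  \<open>z\<close> are bounded by \<open>\<bar>sin z\<bar>\<close>.\<close>

lemma entire_sinc_bound:
  obtains A where "A > 0" "\<And>z. (1 + (cmod z)^2) * (cmod (entire_sinc z))^2 \<le> A * exp (2 * \<bar>Im z\<bar>)"
proof -
  have cont: "continuous_on UNIV entire_sinc"
    using entire_sinc_holomorphic by (rule holomorphic_on_imp_continuous_on)
  have "compact (entire_sinc ` cball 0 1)"
    by (intro compact_continuous_image continuous_on_subset[OF cont]) auto
  then obtain C where C: "\<And>z. z \<in> cball 0 1 \<Longrightarrow> cmod (entire_sinc z) \<le> C"
    using compact_imp_bounded[THEN iffD1[OF bounded_iff]] by (metis imageI)
  have C0: "0 \<le> C" using C[of 0] norm_ge_zero order_trans by (metis centre_in_cball zero_le_one)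
  have s: "cmod (sin z) \<le> exp \<bar>Im z\<bar>" for z using cmod_sin_le_exp[of 1 z] by simp
  have e1: "1 \<le> exp \<bar>Im z\<bar>" for z by simp
  define D where "D = max 1 C"
  have "cmod (entire_sinc z) \<le> D * exp \<bar>Im z\<bar>" for z
  proof (cases "cmod z \<le> 1")
    case True
    have "cmod (entire_sinc z) \<le> D * 1" using C[of z] True by (simp add: D_def)
    also have "\<dots> \<le> D * exp \<bar>Im z\<bar>" using e1 by (intro mult_left_mono) (auto simp: D_def)
    finally show ?thesis .
  next
    case False
    hence "cmod (entire_sinc z) = cmod (sin z) / cmod z" by (auto simp: entire_sinc_def norm_divide)
    also have "\<dots> \<le> cmod (sin z) / 1" using False by (intro divide_left_mono) auto
    also have "\<dots> \<le> 1 * exp \<bar>Im z\<bar>" using s by simp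
    also have "\<dots> \<le> D * exp \<bar>Im z\<bar>" by (intro mult_right_mono) (auto simp: D_def)
    finally show ?thesis .
  qed
  hence 1: "(cmod (entire_sinc z))^2 \<le> (D * exp \<bar>Im z\<bar>)^2" for z by (intro power_mono) auto
  have "cmod z * cmod (entire_sinc z) \<le> exp \<bar>Im z\<bar>" for z
    using s[of z] by (auto simp: entire_sinc_def norm_divide)
  hence 2: "(cmod z * cmod (entire_sinc z))^2 \<le> (exp \<bar>Im z\<bar>)^2" for z by (intro power_mono) auto
  have e2: "(exp \<bar>Im z\<bar>)^2 = exp (2 * \<bar>Im z\<bar>)" for z by (simp add: exp_double)
  have "(1 + (cmod z)^2) * (cmod (entire_sinc z))^2 \<le> (D^2 + 1) * exp (2 * \<bar>Im z\<bar>)" for z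
    using 1[of z] 2[of z] unfolding power_mult_distrib e2 by (simp add: distrib_right)
  thus thesis by (intro that[of "D^2 + 1"]) (auto simp: add_nonneg_pos)
qed

text \<open>The fourth power has exponential type \<open>g\<close> and decays like
  \<open>x ^ (-4)\<close> on horizontal lines. Second order decay would not do: the mollifier needs a
  primitive (after subtracting the box) which is itself \<open>O(x ^ (-2))\<close>.\<close>

lemma jackson_entire_bound:
  assumes g: "g > 0"
  obtains B where "B > 0" "\<And>z. cmod (entire_sinc (of_real (g / 4) * z) ^ 4) \<le> B * exp (g * \<bar>Im z\<bar>) / (1 + (Re z)^2)^2"
proof -
  obtain A where A: "A > 0" "\<And>z. (1 + (cmod z)^2) * (cmod (entire_sinc z))^2 \<le> A * exp (2 * \<bar>Im z\<bar>)"
    by (rule entire_sinc_bound) blast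
  define D where "D = 1 + 16 / g^2"
  have D: "D > 0" unfolding D_def using g by (simp add: add_pos_nonneg)
  have "cmod (entire_sinc (of_real (g / 4) * z) ^ 4) \<le> (D * A)^2 * exp (g * \<bar>Im z\<bar>) / (1 + (Re z)^2)^2" for z
  proof -
    define w where "w = complex_of_real (g / 4) * z"
    have "\<bar>Re z\<bar>^2 \<le> (cmod z)^2" by (intro power_mono abs_Re_le_cmod) auto
    hence rz: "(Re z)^2 \<le> (cmod z)^2" by simp
    have cw: "(cmod w)^2 = g^2 / 16 * (cmod z)^2"
      using g by (simp add: w_def norm_mult power_mult_distrib power_divide)
    have "(Re z)^2 \<le> 16 / g^2 * (cmod w)^2" using rz g unfolding cw by simp
    moreover have "0 \<le> 16 / g^2" "0 \<le> (cmod w)^2" using g by auto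
    moreover have "D * (1 + (cmod w)^2) = 1 + (cmod w)^2 + 16 / g^2 + 16 / g^2 * (cmod w)^2"
      unfolding D_def by (simp add: distrib_left distrib_right)
    ultimately have "1 + (Re z)^2 \<le> D * (1 + (cmod w)^2)"
      by linarith
    hence "(1 + (Re z)^2) * (cmod (entire_sinc w))^2 \<le> D * (1 + (cmod w)^2) * (cmod (entire_sinc w))^2"
      by (intro mult_right_mono) auto
    also have "\<dots> \<le> D * (A * exp (2 * \<bar>Im w\<bar>))"
      using A(2)[of w] D unfolding mult.assoc by (intro mult_left_mono) auto
    finally have "((1 + (Re z)^2) * (cmod (entire_sinc w))^2)^2 \<le> (D * (A * exp (2 * \<bar>Im w\<bar>)))^2"
      by (intro power_mono) auto
    also have "\<dots> = (D * A)^2 * exp (4 * \<bar>Im w\<bar>)"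
      using exp_double[of "2 * \<bar>Im w\<bar>"] by (simp add: power_mult_distrib)
    also have "4 * \<bar>Im w\<bar> = g * \<bar>Im z\<bar>" using g by (simp add: w_def abs_mult)
    finally have "(1 + (Re z)^2)^2 * cmod (entire_sinc w ^ 4) \<le> (D * A)^2 * exp (g * \<bar>Im z\<bar>)"
      by (simp add: power_mult_distrib norm_power flip: power_mult)
    thus ?thesis
      unfolding w_def by (simp add: pos_le_divide_eq[OF zero_less_power[OF one_plus_square_pos]] mult.commute)
  qed
  thus thesis using D A by (intro that[of "(D * A)^2"]) auto
qed

text \<open>On the real line the kernel is a nonnegative function that exceeds \<open>1 / 2\<close> near
  the origin.\<close>

lemma integral_jackson_nonzero:
  fixes g :: real
  assumes int: "integrable lborel (\<lambda>x. entire_sinc (of_real (g / 4 * x)) ^ 4)"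
  shows "(LINT x|lborel. entire_sinc (of_real (g / 4 * x)) ^ 4) \<noteq> 0"
proof -
  define j where "j x = (if g / 4 * x = 0 then 1 else sin (g / 4 * x) / (g / 4 * x)) ^ 4" for x :: real
  have j: "entire_sinc (of_real (g / 4 * x)) ^ 4 = of_real (j x)" for x
  proof (cases "g / 4 * x = 0")
    case False
    hence "complex_of_real (g / 4 * x) \<noteq> 0" by (simp only: of_real_eq_0_iff not_False_eq_True)
    thus ?thesis using False unfolding j_def entire_sinc_def
      by (simp only: if_False sin_of_real of_real_divide of_real_power)
  qed (auto simp: j_def entire_sinc_def)
  have j0: "0 \<le> j x" for x unfolding j_def by (rule zero_le_even_power) simp
  have ji: "integrable lborel j"
    using integrable_Re[OF int] unfolding j by simp
  have cont: "continuous_on UNIV j"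
  proof -
    have "continuous_on UNIV (\<lambda>x. entire_sinc (complex_of_real (g / 4 * x)))"
      by (rule continuous_on_compose2[OF holomorphic_on_imp_continuous_on[OF entire_sinc_holomorphic],
            of _ "\<lambda>x. complex_of_real (g / 4 * x)"])
        (auto intro!: continuous_intros simp del: of_real_mult of_real_divide)
    hence "continuous_on UNIV (\<lambda>x. entire_sinc (complex_of_real (g / 4 * x)) ^ 4)"
      by (rule continuous_on_power)
    hence "continuous_on UNIV (\<lambda>x. Re (of_real (j x)))" unfolding j by (intro continuous_on_Re)
    thus ?thesis by simp
  qed
  have "isCont j 0" using cont by (simp add: continuous_on_eq_continuous_at)
  moreover have "j 0 > 1 / 2" by (simp add: j_def)
  ultimately have "eventually (\<lambda>x. j x > 1/2) (at 0)"
    unfolding isCont_def by (rule order_tendstoD)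
  then obtain d where d: "d > 0" "\<And>x. x \<noteq> 0 \<Longrightarrow> dist x 0 < d \<Longrightarrow> j x > 1/2"
    unfolding eventually_at by auto
  have dj: "1 / 2 \<le> j x" if "\<bar>x\<bar> \<le> d / 2" for x
    using d that \<open>j 0 > 1 / 2\<close> by (cases "x = 0") (auto simp: less_imp_le)
  have "(LINT x|lborel. indicator {- d/2..d/2} x * (1/2)) \<le> (LINT x|lborel. j x)"
    using d dj j0 by (intro integral_mono ji integrable_mult_left) (auto split: split_indicator)
  moreover have "(LINT x|lborel. indicator {- d/2..d/2} x * (1/2 :: real)) = d / 2"
    using d(1) by simp
  ultimately have "(LINT x|lborel. j x) > 0" using d(1) by simp
  thus ?thesis unfolding j integral_complex_of_real by simp
qed

text \<open>For \<open>y \<ge> 1\<close> the bound \<open>1 / (1 + y^2)^2\<close> is at most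
  \<open>y / (1 + y^2)^2\<close>, which has an elementary primitive.\<close>

lemma quartic_tail:
  fixes V :: "real \<Rightarrow> complex"
  assumes [measurable]: "V \<in> borel_measurable borel" and int: "integrable lborel V"
    and bd: "\<And>x. cmod (V x) \<le> B / (1 + x^2)^2" and x: "x \<ge> 1"
  shows "cmod (LINT y|lborel. indicator {x..} y *\<^sub>R V y) \<le> B / (1 + x^2)"
proof -
  have B: "B \<ge> 0" using order_trans[OF norm_ge_zero bd[of 0]] by simp
  have n0: "1 + y^2 \<noteq> 0" for y :: real using one_plus_square_pos[of y] by linarith
  have "(\<integral>\<^sup>+y. ennreal (y / (1 + y^2)^2) * indicator {x ..} y \<partial>lborel) = 0 - (- (1 / (2 * (1 + x^2))))"
  proof (rule nn_integral_FTC_atLeast)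
    show "((\<lambda>y. - (1 / (2 * (1 + y^2)))) has_real_derivative y / (1 + y^2)^2) (at y)" for y :: real
    proof -
      have "((\<lambda>y::real. 2 * (1 + y^2)) has_real_derivative 4 * y) (at y)"
        by (auto intro!: derivative_eq_intros)
      from DERIV_minus[OF DERIV_inverse'[OF this]]
      have "((\<lambda>y. - inverse (2 * (1 + y^2))) has_real_derivative
          inverse (2 * (1 + y^2)) * (4 * y) * inverse (2 * (1 + y^2))) (at y)"
        using n0[of y] by simp
      moreover have "inverse (2 * a) * (4 * y) * inverse (2 * a) = y / a^2" if "a \<noteq> 0" for a
        using that by (simp add: field_simps power2_eq_square)
      note this[OF n0[of y]]
      ultimately show ?thesis by (simp only: inverse_eq_divide)
    qed
    show "0 \<le> y / (1 + y^2)^2" if "x \<le> y" for y using that x by simp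
    show "((\<lambda>y::real. - (1 / (2 * (1 + y^2)))) \<longlongrightarrow> 0) at_top" by real_asymp
  qed simp
  hence I: "(\<integral>\<^sup>+y. ennreal (y / (1 + y^2)^2) * indicator {x ..} y \<partial>lborel) = ennreal (1 / (2 * (1 + x^2)))" by simp
  have "ennreal (cmod (LINT y|lborel. indicator {x..} y *\<^sub>R V y)) \<le> (\<integral>\<^sup>+y. ennreal (norm (indicat_real {x..} y *\<^sub>R V y)) \<partial>lborel)"
    by (intro integral_norm_bound_ennreal integrable_mult_indicator int) simp
  also have "\<dots> \<le> (\<integral>\<^sup>+y. ennreal B * (ennreal (y / (1 + y^2)^2) * indicator {x ..} y) \<partial>lborel)"
  proof (rule nn_integral_mono)
    fix y :: real
    show "ennreal (norm (indicat_real {x..} y *\<^sub>R V y)) \<le> ennreal B * (ennreal (y / (1 + y^2)^2) * indicator {x ..} y)"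
    proof (cases "y \<in> {x..}")
      case True
      have "cmod (V y) \<le> B / (1 + y^2)^2" by (rule bd)
      also have "\<dots> \<le> B * (y / (1 + y^2)^2)"
        using True x B mult_left_mono[of 1 y B] by (simp add: divide_right_mono)
      finally have "ennreal (cmod (V y)) \<le> ennreal B * ennreal (y / (1 + y^2)^2)"
        using B by (subst ennreal_mult'[symmetric]) (auto intro: ennreal_leI)
      thus ?thesis using True by simp
    qed simp
  qed
  also have "\<dots> = ennreal B * ennreal (1 / (2 * (1 + x^2)))"
    by (subst nn_integral_cmult) (auto simp: I)
  also have "\<dots> = ennreal (B * (1 / (2 * (1 + x^2))))" using B by (subst ennreal_mult') auto
  finally have "cmod (LINT y|lborel. indicator {x..} y *\<^sub>R V y) \<le> B * (1 / (2 * (1 + x^2)))"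
    using B by (subst (asm) ennreal_le_iff) auto
  also have "\<dots> \<le> B * (1 / (1 * (1 + x^2)))"
    using B by (intro mult_left_mono divide_left_mono mult_right_mono mult_pos_pos one_plus_square_pos) auto
  finally show ?thesis by simp
qed

text \<open>Both \<open>box_kernel\<close> and \<open>V\<close> have integral one, so the difference of
  their distribution functions vanishes at both ends, and it does so at the rate of the tails of
  \<open>V\<close>.\<close>

lemma ex_primitive_box_minus:
  fixes V :: "real \<Rightarrow> complex"
  assumes cont: "continuous_on UNIV V" and bd: "\<And>x. cmod (V x) \<le> B / (1 + x^2)^2"
    and one: "(LINT y|lborel. V y) = 1"
  shows "\<exists>P. primitive_kernel P (\<lambda>x. box_kernel x - V x)"
proof -
  have mV [measurable]: "V \<in> borel_measurable borel" using cont by (rule borel_measurable_continuous_onI)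
  have B: "B \<ge> 0" using order_trans[OF norm_ge_zero bd[of 0]] by simp
  have sq: "1 + x^2 \<le> (1 + x^2)^2" for x :: real using self_le_power[of "1 + x^2" 2] by simp
  have kV: "decaying V"
  proof (rule decayingI[OF mV])
    fix x
    have "B / (1 + x^2)^2 \<le> B / (1 + x^2)"
      using B sq by (intro divide_left_mono mult_pos_pos zero_less_power one_plus_square_pos)
    with bd[of x] show "cmod (V x) \<le> B / (1 + x^2)" by simp
  qed
  have iV: "integrable lborel V" using kV by (rule decaying_integrable)
  define W where "W x = (LINT y|lborel. indicator {..x} y *\<^sub>R V y)" for x
  (* The first term is the distribution function of the box. *)
  define P where "P x = complex_of_real (max 0 (min 1 (x + 1))) - W x" for x
  define D where "D = 1 + (LINT y|lborel. cmod (V y))"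
  have ii: "integrable lborel (\<lambda>y. indicat_real A y *\<^sub>R V y)" if "A \<in> sets borel" for A
    using that by (intro integrable_mult_indicator iV) simp
  have Wb: "cmod (W x) \<le> D - 1" for x
  proof -
    have "cmod (W x) \<le> (LINT y|lborel. norm (indicat_real {..x} y *\<^sub>R V y))"
      unfolding W_def by (rule integral_norm_bound)
    also have "\<dots> \<le> (LINT y|lborel. cmod (V y))"
      by (intro integral_mono integrable_norm ii iV) (auto split: split_indicator)
    finally show ?thesis by (simp add: D_def)
  qed
  have Wneg: "cmod (W x) \<le> B / (1 + x^2)" if "x \<le> -1" for x
  proof -
    have "W x = (LINT y|lborel. indicator {-x..} y *\<^sub>R V (- y))"
      unfolding W_def using lborel_integral_real_affine[of "-1" "\<lambda>y. indicat_real {..x} y *\<^sub>R V y" 0]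
      by (simp add: indicator_def minus_le_iff)
    moreover have "cmod (LINT y|lborel. indicator {-x..} y *\<^sub>R V (- y)) \<le> B / (1 + (-x)^2)"
    proof (rule quartic_tail)
      show "integrable lborel (\<lambda>y. V (- y))" using lborel_integrable_real_affine[OF iV, of "-1" 0] by simp
      show "cmod (V (- y)) \<le> B / (1 + y^2)^2" for y using bd[of "- y"] by simp
    qed (use that in auto)
    ultimately show ?thesis by simp
  qed
  have Wpos: "cmod (1 - W x) \<le> B / (1 + x^2)" if "x \<ge> 1" for x
  proof -
    have "W x + (LINT y|lborel. indicator {x..} y *\<^sub>R V y) = (LINT y|lborel. indicator {..x} y *\<^sub>R V y + indicator {x..} y *\<^sub>R V y)"
      unfolding W_def by (rule Bochner_Integration.integral_add[symmetric]; rule ii; simp)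
    also have "\<dots> = (LINT y|lborel. V y)"
    proof (rule integral_cong_AE)
      show "AE y in lborel. indicat_real {..x} y *\<^sub>R V y + indicator {x..} y *\<^sub>R V y = V y"
        using AE_lborel_singleton[of x] by eventually_elim (auto split: split_indicator)
    qed measurable
    finally have "1 - W x = (LINT y|lborel. indicator {x..} y *\<^sub>R V y)" using one by (simp add: algebra_simps)
    thus ?thesis using quartic_tail[OF mV iV bd that] by simp
  qed
  have Wd: "(W has_vector_derivative V x) (at x)" for x
  proof -
    have eq: "W u = W (x - 1) + integral {x - 1..u} V" if "u \<in> {x - 1<..<x + 1}" for u
    proof -
      have "W u = (LINT y|lborel. indicator {..x - 1} y *\<^sub>R V y + indicator {x - 1..u} y *\<^sub>R V y)"
        unfolding W_def
      proof (rule integral_cong_AE)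
        show "AE y in lborel. indicat_real {..u} y *\<^sub>R V y = indicator {..x - 1} y *\<^sub>R V y + indicator {x - 1..u} y *\<^sub>R V y"
          using AE_lborel_singleton[of "x - 1"] by eventually_elim (use that in \<open>auto split: split_indicator\<close>)
      qed measurable
      also have "\<dots> = W (x - 1) + (LINT y:{x - 1..u}|lborel. V y)"
        unfolding W_def set_lebesgue_integral_def by (rule Bochner_Integration.integral_add; rule ii; simp)
      also have "(LINT y:{x - 1..u}|lborel. V y) = integral {x - 1..u} V"
        by (rule set_borel_integral_eq_integral) (simp add: set_integrable_def ii)
      finally show ?thesis .
    qed
    have "((\<lambda>u. integral {x - 1..u} V) has_vector_derivative V x) (at x within {x - 1..x + 1})"
      by (rule integral_has_vector_derivative) (auto intro: continuous_on_subset[OF cont])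
    hence "((\<lambda>u. integral {x - 1..u} V) has_vector_derivative V x) (at x)"
      by (subst (asm) at_within_interior) auto
    hence "((\<lambda>u. W (x - 1) + integral {x - 1..u} V) has_vector_derivative V x) (at x)"
      by (auto intro!: derivative_eq_intros)
    thus ?thesis
      by (rule has_vector_derivative_transform_within_open[where S = "{x - 1<..<x + 1}"]) (auto simp: eq)
  qed
  have contP: "continuous_on UNIV P"
    unfolding P_def
    by (intro continuous_intros continuous_at_imp_continuous_on ballI has_vector_derivative_continuous[OF Wd])
  have kP: "decaying P"
  proof (rule decayingI[of _ "B + 2 * D"])
    show "P \<in> borel_measurable borel" using contP by (rule borel_measurable_continuous_onI)
    fix x
    have D: "D \<ge> 1" unfolding D_def by (simp add: integral_nonneg_AE)
    have r: "a / (1 + x^2) \<le> (B + 2 * D) / (1 + x^2)" if "a \<le> B + 2 * D" for a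
      using that by (intro divide_right_mono) auto
    (* Outside [-1, 1] the clamp is constant and only a tail of V remains. *)
    consider "x \<le> -1" | "x \<ge> 1" | "\<bar>x\<bar> \<le> 1" by linarith
    thus "cmod (P x) \<le> (B + 2 * D) / (1 + x^2)"
    proof cases
      case 1
      hence "cmod (P x) = cmod (W x)" by (simp add: P_def)
      with Wneg[OF 1] r[of B] D show ?thesis by linarith
    next
      case 2
      hence "P x = 1 - W x" by (simp add: P_def)
      with Wpos[OF 2] r[of B] D show ?thesis by simp
    next
      case 3
      have "cmod (P x) \<le> cmod (complex_of_real (max 0 (min 1 (x + 1)))) + cmod (W x)"
        unfolding P_def by (rule norm_triangle_ineq4)
      also have "\<dots> \<le> 1 + (D - 1)"
        using 3 by (intro add_mono Wb) (unfold norm_of_real, auto)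
      finally have "cmod (P x) \<le> D" by simp
      moreover have "x^2 \<le> 1" using 3 by (simp add: abs_square_le_1)
      hence "D * (1 + x^2) \<le> D * 2" using D by (intro mult_left_mono) auto
      hence "D \<le> 2 * D / (1 + x^2)" by (simp add: pos_le_divide_eq one_plus_square_pos)
      ultimately show ?thesis using r[of "2 * D"] B by linarith
    qed
  qed
  have "(P has_vector_derivative box_kernel x - V x) (at x)" if "x \<notin> {-1, 0}" for x
  proof -
    have "((\<lambda>x. complex_of_real (max 0 (min 1 (x + 1)))) has_vector_derivative box_kernel x) (at x)"
    proof -
      have "x \<noteq> -1" "x \<noteq> 0" using that by auto
      then consider "x < -1" | "-1 < x" "x < 0" | "x > 0" by linarith
      thus ?thesis
      proof cases
        case 1
        have "((\<lambda>x. 0) has_vector_derivative box_kernel x) (at x)" using 1 by (simp add: box_kernel_def)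
        thus ?thesis
          by (rule has_vector_derivative_transform_within_open[where S = "{..<-1}"]) (use 1 in auto)
      next
        case 2
        have "((\<lambda>x. complex_of_real (x + 1)) has_vector_derivative of_real 1) (at x)"
          by (rule has_vector_derivative_of_real) (auto intro!: derivative_eq_intros)
        hence "((\<lambda>x. complex_of_real (x + 1)) has_vector_derivative box_kernel x) (at x)"
          using 2 by (simp add: box_kernel_def)
        thus ?thesis
          by (rule has_vector_derivative_transform_within_open[where S = "{-1<..<0}"]) (use 2 in auto)
      next
        case 3
        have "((\<lambda>x. 1) has_vector_derivative box_kernel x) (at x)" using 3 by (simp add: box_kernel_def)
        thus ?thesis
          by (rule has_vector_derivative_transform_within_open[where S = "{0<..}"]) (use 3 in auto)
      qed
    qed
    from has_vector_derivative_diff[OF this Wd[of x]] show ?thesis unfolding P_def .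
  qed
  hence "primitive_kernel P (\<lambda>x. box_kernel x - V x)"
    unfolding primitive_kernel_def
    by (intro conjI kP contP decaying_diff decaying_box kV exI[of _ "{-1, 0}"]) auto
  thus ?thesis by blast
qed

text \<open>\<open>V m\<close> is the \<open>m\<close>-th derivative of the mollifier \<open>V 0\<close>,
  whose Fourier transform vanishes outside \<open>{- g..g}\<close>. The primitive is what makes
  \<open>I\<close> minus the mollifier divisible by \<open>I\<close> minus the forward average.\<close>

definition band_mollifier :: "real \<Rightarrow> (nat \<Rightarrow> real \<Rightarrow> complex) \<Rightarrow> bool" where
  "band_mollifier g V \<longleftrightarrow> (\<forall>m. decaying (V m)) \<and>
     (\<forall>m x. (V m has_vector_derivative V (Suc m) x) (at x)) \<and>
     (\<exists>P. primitive_kernel P (\<lambda>x. box_kernel x - V 0 x)) \<and>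
     (\<forall>\<xi>. \<bar>\<xi>\<bar> > g \<longrightarrow> (LINT x|lborel. V 0 x * exp (- (\<i> * of_real (\<xi> * x)))) = 0)"

text \<open>The Jackson kernel, normalized to integral one. Its growth bound holds in a strip, so that
  Cauchy's estimates on unit circles pass the decay on to all derivatives.\<close>

lemma ex_band_mollifier:
  assumes g: "g > 0" shows "\<exists>V. band_mollifier g V"
proof -
  obtain B where B: "B > 0" "\<And>z. cmod (entire_sinc (of_real (g / 4) * z) ^ 4) \<le> B * exp (g * \<bar>Im z\<bar>) / (1 + (Re z)^2)^2"
    using jackson_entire_bound[OF g] by blast
  have Jhol: "(\<lambda>z. entire_sinc (of_real (g / 4) * z) ^ 4) holomorphic_on UNIV"
    by (intro holomorphic_on_power holomorphic_on_compose_gen[unfolded o_def, OF _ entire_sinc_holomorphic] holomorphic_intros) auto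
  have kernel_of: "decaying (\<lambda>x. F (of_real x))"
    if "F holomorphic_on UNIV" "\<And>x. cmod (F (of_real x)) \<le> C / (1 + x^2)" for F C
  proof (rule decayingI[OF _ that(2)])
    have "continuous_on UNIV (\<lambda>x. F (complex_of_real x))"
      by (rule continuous_on_compose2[OF holomorphic_on_imp_continuous_on[OF that(1)], of _ complex_of_real])
        (auto intro: continuous_on_of_real continuous_on_id)
    thus "(\<lambda>x. F (complex_of_real x)) \<in> borel_measurable borel" by (rule borel_measurable_continuous_onI)
  qed
  have sq: "C / (1 + x^2)^2 \<le> C / (1 + x^2)" if "C \<ge> 0" for x C :: real
    using that self_le_power[of "1 + x^2" 2]
    by (intro divide_left_mono mult_pos_pos zero_less_power one_plus_square_pos) auto
  have "decaying (\<lambda>x. entire_sinc (of_real (g / 4) * of_real x) ^ 4)"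
    by (rule kernel_of[OF Jhol, of B]) (use B(2)[of "of_real _"] B(1) in \<open>simp add: order_trans[OF _ sq]\<close>)
  hence int: "integrable lborel (\<lambda>x. entire_sinc (of_real (g / 4 * x)) ^ 4)"
    by (intro decaying_integrable) simp
  define I where "I = (LINT x|lborel. entire_sinc (of_real (g / 4 * x)) ^ 4)"
  have I: "I \<noteq> 0" unfolding I_def by (rule integral_jackson_nonzero[OF int])
  define F where "F z = entire_sinc (of_real (g / 4) * z) ^ 4 / I" for z
  define B' where "B' = B / cmod I"
  have B': "B' > 0" using B I by (simp add: B'_def)
  have Fhol: "F holomorphic_on UNIV" unfolding F_def using I by (intro holomorphic_on_divide Jhol holomorphic_intros) auto
  have Fbd2: "cmod (F z) \<le> B' * exp (g * \<bar>Im z\<bar>) / (1 + (Re z)^2)^2" for z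
    using divide_right_mono[OF B(2)[of z], of "cmod I"] by (simp add: F_def B'_def norm_divide mult.commute)
  have Fbd: "cmod (F z) \<le> B' * exp (g * \<bar>Im z\<bar>) / (1 + (Re z)^2)" for z
    using Fbd2[of z] sq[of "B' * exp (g * \<bar>Im z\<bar>)" "Re z"] B' by simp
  define V where "V m x = (deriv ^^ m) F (of_real x)" for m :: nat and x :: real
  have Vk: "decaying (V m)" for m
  proof -
    have hm: "(deriv ^^ m) F holomorphic_on UNIV" by (intro holomorphic_intros Fhol open_UNIV)
    have "cmod ((deriv ^^ m) F (of_real x)) \<le> (fact m * (4 * B' * exp g)) / (1 + x^2)" for x :: real
    proof -
      have "norm ((deriv ^^ m) F (of_real x)) \<le> fact m * (4 * B' * exp g / (1 + x^2)) / 1 ^ m"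
      proof (rule Cauchy_inequality)
        show "F holomorphic_on ball (complex_of_real x) 1" by (rule holomorphic_on_subset[OF Fhol]) auto
        show "continuous_on (cball (complex_of_real x) 1) F"
          by (rule holomorphic_on_imp_continuous_on[OF holomorphic_on_subset[OF Fhol]]) auto
        fix w assume w: "cmod (of_real x - w) = 1"
        have "\<bar>Im w\<bar> \<le> 1" using abs_Im_le_cmod[of "of_real x - w"] w by simp
        hence e: "exp (g * \<bar>Im w\<bar>) \<le> exp g" using g by (simp add: mult_le_cancel_left2)
        have "\<bar>x - Re w\<bar> \<le> 1" using abs_Re_le_cmod[of "of_real x - w"] w by simp
        hence r: "(x - Re w)^2 \<le> 1" by (simp add: abs_square_le_1)
        have "1 + x^2 \<le> 4 * (1 + (Re w)^2)"
        proof -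
          have "(x - 2 * Re w)^2 = x^2 - 4 * (x * Re w) + 4 * (Re w)^2"
            "(x - Re w)^2 = x^2 - 2 * (x * Re w) + (Re w)^2"
            by (simp_all add: power2_eq_square algebra_simps)
          thus ?thesis
            using r zero_le_power2[of "x - 2 * Re w"] zero_le_power2[of "Re w"] by argo
        qed
        hence q: "1 / (1 + (Re w)^2) \<le> 4 / (1 + x^2)"
          by (simp add: divide_simps one_plus_square_pos add_pos_nonneg)
        have "cmod (F w) \<le> B' * exp (g * \<bar>Im w\<bar>) * (1 / (1 + (Re w)^2))" using Fbd[of w] by simp
        also have "\<dots> \<le> B' * exp g * (4 / (1 + x^2))"
          using B' e q by (intro mult_mono) (auto simp: one_plus_square_pos)
        finally show "cmod (F w) \<le> 4 * B' * exp g / (1 + x^2)" by (simp add: mult.commute mult.left_commute)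
      qed simp
      thus ?thesis by simp
    qed
    from kernel_of[OF hm this] show ?thesis unfolding V_def .
  qed
  have Vd: "(V m has_vector_derivative V (Suc m) x) (at x)" for m x
  proof -
    have hm: "(deriv ^^ m) F holomorphic_on UNIV" by (intro holomorphic_intros Fhol open_UNIV)
    have "((deriv ^^ m) F has_field_derivative (deriv ^^ Suc m) F (of_real x)) (at (of_real x))"
      using holomorphic_derivI[OF hm open_UNIV UNIV_I, of "of_real x"] by simp
    thus ?thesis unfolding V_def by (rule has_vector_derivative_real_field)
  qed
  have V0: "V 0 = (\<lambda>x. F (of_real x))" by (simp add: V_def fun_eq_iff)
  have int0: "integrable lborel (\<lambda>x. F (of_real x))" using decaying_integrable[OF Vk[of 0]] by (simp add: V0)
  have one: "(LINT y|lborel. V 0 y) = 1"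
  proof -
    have "(LINT y|lborel. V 0 y) = (LINT y|lborel. entire_sinc (of_real (g / 4 * y)) ^ 4) / I"
      unfolding V0 F_def by simp
    thus ?thesis using I by (simp only: I_def[symmetric] divide_self_if if_False)
  qed
  have "\<exists>P. primitive_kernel P (\<lambda>x. box_kernel x - V 0 x)"
  proof (rule ex_primitive_box_minus[OF _ _ one])
    show "continuous_on UNIV (V 0)"
      by (intro continuous_at_imp_continuous_on ballI has_vector_derivative_continuous[OF Vd])
    show "cmod (V 0 x) \<le> B' / (1 + x^2)^2" for x using Fbd2[of "of_real x"] by (simp add: V0)
  qed
  moreover have "(LINT x|lborel. V 0 x * exp (- (\<i> * of_real (\<xi> * x)))) = 0" if "\<bar>\<xi>\<bar> > g" for \<xi>
    unfolding V0 by (rule fourier_band_limited[OF Fhol Fbd int0 that])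
  ultimately have "band_mollifier g V" unfolding band_mollifier_def using Vk Vd by blast
  thus ?thesis by blast
qed

section \<open>Smoothness and spectrum of mollified functions\<close>

lemma norm_integral_le:
  fixes f :: "'a \<Rightarrow> 'b::{banach, second_countable_topology}"
  assumes "integrable M f" "integrable M g" "\<And>x. norm (f x) \<le> g x"
  shows "norm (integral\<^sup>L M f) \<le> integral\<^sup>L M g"
  using assms by (intro order_trans[OF integral_norm_bound] integral_mono integrable_norm)

lemma decaying_Taylor:
  assumes d0: "\<And>x. (K0 has_vector_derivative K1 x) (at x)"
    and d1: "\<And>x. (K1 has_vector_derivative K2 x) (at x)"
    and C: "C > 0" "\<And>x. cmod (K2 x) \<le> C / (1 + x^2)" and t: "\<bar>t\<bar> \<le> 1"
  shows "cmod (K0 (z + t) - K0 z - t *\<^sub>R K1 z) \<le> t^2 * (4 * C / (1 + z^2))"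
proof -
  let ?S = "closed_segment z (z + t)"
  have S: "\<bar>x - z\<bar> \<le> \<bar>t\<bar>" if "x \<in> ?S" for x
    using that by (auto simp: closed_segment_eq_real_ivl split: if_splits)
  have K2: "cmod (K2 x) \<le> 4 * C / (1 + z^2)" if x: "x \<in> ?S" for x
  proof -
    have "(x - z)^2 \<le> 1" using S[OF x] t by (simp add: abs_square_le_1)
    moreover have "(z - 2 * x)^2 = z^2 - 4 * (x * z) + 4 * x^2"
        "(x - z)^2 = x^2 - 2 * (x * z) + z^2"
      by (simp_all add: power2_eq_square algebra_simps)
    ultimately have "1 + z^2 \<le> 4 * (1 + x^2)"
      using zero_le_power2[of "z - 2 * x"] zero_le_power2[of x] by argo
    hence "1 / (1 + x^2) \<le> 4 / (1 + z^2)"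
      by (simp add: divide_simps one_plus_square_pos add_pos_nonneg)
    from mult_left_mono[OF this, of C] C(1) show ?thesis using C(2)[of x] by (simp add: mult.commute)
  qed
  define D where "D = 4 * C / (1 + z^2)"
  have D: "D \<ge> 0" unfolding D_def using C by simp
  have K1: "cmod (K1 x - K1 z) \<le> \<bar>t\<bar> * D" if x: "x \<in> ?S" for x
  proof -
    have "norm (K1 x - K1 z) \<le> D * norm (x - z)"
    proof (rule differentiable_bound[of ?S])
      show "(K1 has_derivative (\<lambda>h. h *\<^sub>R K2 y)) (at y within ?S)" for y
        using d1[of y] unfolding has_vector_derivative_def by (rule has_derivative_at_withinI)
      show "onorm (\<lambda>h. h *\<^sub>R K2 y) \<le> D" if "y \<in> ?S" for y
        using K2[OF that] onorm_scaleR_left[OF bounded_linear_ident, of "K2 y"] unfolding D_def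
        by (simp add: onorm_id)
    qed (use x in auto)
    also have "\<dots> \<le> D * \<bar>t\<bar>" using S[OF x] D by (intro mult_left_mono) auto
    finally show ?thesis by (simp add: mult.commute)
  qed
  have "norm (K0 (z + t) - K0 z - (z + t - z) *\<^sub>R K1 z) \<le> norm (z + t - z) * (\<bar>t\<bar> * D)"
    by (rule vector_differentiable_bound_linearization[where S = ?S])
      (auto intro: has_vector_derivative_at_within d0 K1)
  thus ?thesis unfolding D_def by (simp add: power2_eq_square)
qed

text \<open>A second order Taylor bound with decaying constant makes the remainder quadratic in the
  increment after integration, so no limit has to be interchanged with the integral.\<close>

lemma conv_has_vector_derivative:
  assumes k: "decaying K0" "decaying K1" "decaying K2"
    and d0: "\<And>x. (K0 has_vector_derivative K1 x) (at x)"
    and d1: "\<And>x. (K1 has_vector_derivative K2 x) (at x)" and f: "moderate f"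
  shows "(conv K0 f has_vector_derivative conv K1 f x) (at x)"
proof -
  obtain C where C: "C > 0" "\<And>x. cmod (K2 x) \<le> C / (1 + x^2)" using decayingE[OF k(3)] by metis
  define P where "P z = complex_of_real (4 * C / (1 + z^2))" for z :: real
  have P: "decaying P"
  proof (rule decayingI[of _ "4 * C"])
    show "P \<in> borel_measurable borel" unfolding P_def by measurable
    show "cmod (P z) \<le> 4 * C / (1 + z^2)" for z
      unfolding P_def norm_of_real using C(1) by (simp add: abs_mult)
  qed
  define E where "E = (LINT y|lebesgue. norm (P (x - y) * f y))"
  have iP: "integrable lebesgue (\<lambda>y. norm (P (x - y) * f y))"
    by (rule integrable_norm[OF conv_integrable[OF P f]])
  have est: "norm (conv K0 f (x + t) - conv K0 f x - t *\<^sub>R conv K1 f x) \<le> t^2 * E" if t: "\<bar>t\<bar> \<le> 1" for t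
  proof -
    have i: "integrable lebesgue (\<lambda>y. K0 (x + t - y) * f y)" "integrable lebesgue (\<lambda>y. K0 (x - y) * f y)"
       "integrable lebesgue (\<lambda>y. t *\<^sub>R (K1 (x - y) * f y))"
      using conv_integrable[OF k(1) f] conv_integrable[OF k(2) f] by auto
    have eq: "conv K0 f (x + t) - conv K0 f x - t *\<^sub>R conv K1 f x
        = (LINT y|lebesgue. K0 (x + t - y) * f y - K0 (x - y) * f y - t *\<^sub>R (K1 (x - y) * f y))"
      unfolding conv_def using i by (simp add: conv_integrable[OF k(2) f])
    have "norm \<dots> \<le> (LINT y|lebesgue. t^2 * norm (P (x - y) * f y))"
    proof (rule norm_integral_le)
      fix y
      have "K0 (x + t - y) * f y - K0 (x - y) * f y - t *\<^sub>R (K1 (x - y) * f y)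
         = (K0 ((x - y) + t) - K0 (x - y) - t *\<^sub>R K1 (x - y)) * f y"
        by (simp add: algebra_simps)
      also have "norm \<dots> \<le> t^2 * (4 * C / (1 + (x - y)^2)) * norm (f y)"
        unfolding norm_mult by (intro mult_right_mono decaying_Taylor[OF d0 d1 C t]) simp
      also have "4 * C / (1 + (x - y)^2) = norm (P (x - y))" using C(1)
        unfolding P_def norm_of_real by (simp add: abs_mult)
      finally show "norm (K0 (x + t - y) * f y - K0 (x - y) * f y - t *\<^sub>R (K1 (x - y) * f y)) \<le> t^2 * norm (P (x - y) * f y)"
        by (simp add: norm_mult mult.assoc)
    qed (intro Bochner_Integration.integrable_diff i integrable_mult_right iP)+
    thus ?thesis unfolding eq E_def by simp
  qed
  show ?thesis
    unfolding has_vector_derivative_def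
  proof (rule has_derivativeI_sandwich[where e = 1 and H = "\<lambda>y. E * \<bar>y - x\<bar>"])
    show "bounded_linear (\<lambda>h. h *\<^sub>R conv K1 f x)" by (rule bounded_linear_scaleR_left)
    show "norm (conv K0 f y - conv K0 f x - (y - x) *\<^sub>R conv K1 f x) / norm (y - x) \<le> E * \<bar>y - x\<bar>"
      if y: "y \<noteq> x" "dist y x < 1" for y
    proof -
      have "norm (conv K0 f y - conv K0 f x - (y - x) *\<^sub>R conv K1 f x) \<le> (y - x)^2 * E"
        using est[of "y - x"] y by (simp add: dist_real_def)
      also have "\<dots> = E * \<bar>y - x\<bar> * norm (y - x)" by (simp add: power2_eq_square)
      finally show ?thesis using y(1) by (simp add: pos_divide_le_eq)
    qed
    show "((\<lambda>y. E * \<bar>y - x\<bar>) \<longlongrightarrow> 0) (at x)"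
      by (auto intro!: tendsto_eq_intros)
  qed simp
qed

lemma nth_deriv_sequence:
  assumes "\<And>m x. (G m has_vector_derivative G (Suc m) x) (at x)"
  shows "nth_deriv m (G 0) = G m" and "smooth (G 0)"
proof -
  show *: "nth_deriv m (G 0) = G m" for m
  proof (induction m)
    case (Suc m)
    have "nth_deriv (Suc m) (G 0) = (\<lambda>x. vector_derivative (G m) (at x))"
      using Suc by (simp add: nth_deriv_def)
    also have "\<dots> = G (Suc m)" by (intro ext vector_derivative_at assms)
    finally show ?case .
  qed (simp add: nth_deriv_def)
  show "smooth (G 0)"
    unfolding smooth_def * using assms by (blast intro: differentiableI_vector)
qed

lemma conv_mollifier_derivatives:
  assumes V: "band_mollifier g V" and h: "h > 0" and f: "moderate f"
  shows "nth_deriv m (conv (dil h (V 0)) f) = (\<lambda>x. of_real ((1 / h) ^ m) * conv (dil h (V m)) f x)"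
    and "smooth (conv (dil h (V 0)) f)"
proof -
  define K where "K m x = of_real ((1 / h) ^ m) * dil h (V m) x" for m x
  have Vk: "decaying (V m)" and Vd: "(V m has_vector_derivative V (Suc m) x) (at x)" for m x
    using V by (auto simp: band_mollifier_def)
  have Kk: "decaying (K m)" for m
    unfolding K_def by (intro decaying_cmult decaying_dil Vk h)
  have Kd: "(K m has_vector_derivative K (Suc m) x) (at x)" for m x
  proof -
    have "((\<lambda>x. x / h) has_real_derivative 1 / h) (at x)"
      using h by (auto intro!: derivative_eq_intros)
    hence "((\<lambda>x. x / h) has_vector_derivative 1 / h) (at x)"
      by (simp add: has_real_derivative_iff_has_vector_derivative)
    from vector_diff_chain_at[OF this Vd[of m "x / h"]]
    have "((\<lambda>x. V m (x / h)) has_vector_derivative (1 / h) *\<^sub>R V (Suc m) (x / h)) (at x)"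
      by (simp add: o_def)
    from has_vector_derivative_mult_right[OF this, of "of_real ((1 / h) ^ m) / of_real h"]
    show ?thesis
      unfolding K_def[abs_def] dil_def using h by (simp add: scaleR_conv_of_real field_simps)
  qed
  define G where "G m = conv (K m) f" for m
  have Gd: "(G m has_vector_derivative G (Suc m) x) (at x)" for m x
    unfolding G_def by (rule conv_has_vector_derivative[OF Kk Kk Kk Kd Kd f])
  have "K 0 = dil h (V 0)" by (simp add: K_def fun_eq_iff)
  hence G0: "G 0 = conv (dil h (V 0)) f" by (simp add: G_def)
  have Gm: "G m = (\<lambda>x. of_real ((1 / h) ^ m) * conv (dil h (V m)) f x)"
    unfolding G_def K_def[abs_def] by (rule conv_cmult_left)
  show "nth_deriv m (conv (dil h (V 0)) f) = (\<lambda>x. of_real ((1 / h) ^ m) * conv (dil h (V m)) f x)"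
    using nth_deriv_sequence(1)[of G m, OF Gd] unfolding G0 Gm .
  show "smooth (conv (dil h (V 0)) f)"
    using nth_deriv_sequence(2)[of G, OF Gd] unfolding G0 .
qed

lemma smooth_has_vector_derivative:
  assumes "smooth \<psi>"
  shows "(nth_deriv n \<psi> has_vector_derivative nth_deriv (Suc n) \<psi> x) (at x)"
  using assms unfolding smooth_def nth_deriv_def by (auto simp: vector_derivative_works)

lemma smooth_continuous: "smooth \<psi> \<Longrightarrow> continuous_on UNIV (nth_deriv n \<psi>)"
  by (intro continuous_at_imp_continuous_on ballI)
    (rule has_vector_derivative_continuous, rule smooth_has_vector_derivative)

lemma nth_deriv_0 [simp]: "nth_deriv 0 \<psi> = \<psi>"
  by (simp add: nth_deriv_def)

lemma schwartz_seminorm_le: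
  assumes "\<psi> \<in> schwartz"
  shows "\<bar>x\<bar> ^ m * cmod (nth_deriv n \<psi> x) \<le> schwartz_seminorm m n \<psi>" and "0 \<le> schwartz_seminorm m n \<psi>"
proof -
  have "bounded (range (\<lambda>x. \<bar>x\<bar> ^ m *\<^sub>R nth_deriv n \<psi> x))"
    using assms by (simp add: schwartz_def)
  then obtain B where "\<And>x. norm (\<bar>x\<bar> ^ m *\<^sub>R nth_deriv n \<psi> x) \<le> B"
    by (auto simp: bounded_iff)
  hence b: "bdd_above (range (\<lambda>x. \<bar>x\<bar> ^ m * cmod (nth_deriv n \<psi> x)))"
    by (intro bdd_aboveI[of _ B]) auto
  show le: "\<bar>x\<bar> ^ m * cmod (nth_deriv n \<psi> x) \<le> schwartz_seminorm m n \<psi>" for x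
    unfolding schwartz_seminorm_def by (rule cSUP_upper[OF _ b]) simp
  show "0 \<le> schwartz_seminorm m n \<psi>"
    by (rule order_trans[OF _ le[of 0]]) simp
qed

lemma schwartz_decaying:
  assumes "\<psi> \<in> schwartz"
  shows "decaying \<psi>" and "cmod (\<psi> x) \<le> (schwartz_seminorm 0 0 \<psi> + schwartz_seminorm 2 0 \<psi>) / (1 + x^2)"
proof -
  show *: "cmod (\<psi> x) \<le> (schwartz_seminorm 0 0 \<psi> + schwartz_seminorm 2 0 \<psi>) / (1 + x^2)" for x
  proof -
    have "(1 + x^2) * cmod (\<psi> x) \<le> schwartz_seminorm 0 0 \<psi> + schwartz_seminorm 2 0 \<psi>"
      using schwartz_seminorm_le(1)[OF assms, of x 0 0] schwartz_seminorm_le(1)[OF assms, of x 2 0]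
      by (simp add: distrib_right)
    thus ?thesis by (simp add: pos_le_divide_eq one_plus_square_pos mult.commute)
  qed
  have "continuous_on UNIV \<psi>" using smooth_continuous[of \<psi> 0] assms by (simp add: schwartz_def)
  thus "decaying \<psi>" by (intro decayingI[OF _ *] borel_measurable_continuous_onI)
qed

lemma decaying_reflect: "decaying K \<Longrightarrow> decaying (\<lambda>x. K (- x))"
proof -
  assume K: "decaying K"
  obtain C where C: "\<And>x. cmod (K x) \<le> C / (1 + x^2)" and [measurable]: "K \<in> borel_measurable borel"
    using decayingE[OF K] by metis
  show ?thesis by (rule decayingI[of _ C]) (use C[of "- _"] in \<open>auto simp: power2_minus\<close>)
qed

lemma moderate_pairing:
  assumes "decaying K" "moderate f"
  shows "integrable lebesgue (\<lambda>x. f x * K x)" "(LINT x|lebesgue. f x * K x) = conv (\<lambda>x. K (- x)) f 0"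
  using conv_integrable[OF decaying_reflect[OF assms(1)] assms(2), of 0]
  by (simp_all add: conv_def mult.commute)

text \<open>Moderate functions act on Schwartz functions through the two seminorms that control
  \<open>(1 + x^2) \<psi>\<close>.\<close>

lemma tempered_moderate:
  assumes f: "moderate f"
  shows "tempered_distribution (\<lambda>\<psi>. LINT x|lebesgue. f x * \<psi> x)"
proof -
  define C where "C = (LINT x|lebesgue. cmod (f x) / (1 + x^2))"
  have C0: "C \<ge> 0" unfolding C_def by (rule integral_nonneg_AE) auto
  note int = moderate_pairing(1)[OF schwartz_decaying(1) f]
  have bd: "cmod (LINT x|lebesgue. f x * \<psi> x) \<le> C * (\<Sum>m\<le>2. \<Sum>n\<le>2. schwartz_seminorm m n \<psi>)"
    if \<psi>: "\<psi> \<in> schwartz" for \<psi>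
  proof -
    let ?p = "\<lambda>m n. schwartz_seminorm m n \<psi>"
    have "cmod (LINT x|lebesgue. f x * \<psi> x) \<le> (LINT x|lebesgue. (?p 0 0 + ?p 2 0) * (cmod (f x) / (1 + x^2)))"
    proof (rule norm_integral_le[OF int[OF \<psi>]])
      show "integrable lebesgue (\<lambda>x. (?p 0 0 + ?p 2 0) * (cmod (f x) / (1 + x^2)))"
        using f by (intro integrable_mult_right) (simp add: moderate_def)
      show "norm (f x * \<psi> x) \<le> (?p 0 0 + ?p 2 0) * (cmod (f x) / (1 + x^2))" for x
        using mult_left_mono[OF schwartz_decaying(2)[OF \<psi>, of x], of "cmod (f x)"]
        by (simp add: norm_mult mult.commute)
    qed
    also have "\<dots> = C * (?p 0 0 + ?p 2 0)" by (subst integral_mult_right_zero) (simp add: C_def mult.commute)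
    also have "\<dots> \<le> C * (\<Sum>m\<le>2. \<Sum>n\<le>2. ?p m n)"
      using C0 schwartz_seminorm_le(2)[OF \<psi>]
      by (intro mult_left_mono) (auto simp: numeral_2_eq_2 intro!: add_nonneg_nonneg)
    finally show ?thesis .
  qed
  have "(LINT x|lebesgue. f x * (\<psi> x + \<eta> x)) = (LINT x|lebesgue. f x * \<psi> x) + (LINT x|lebesgue. f x * \<eta> x)"
    if "\<psi> \<in> schwartz" "\<eta> \<in> schwartz" for \<psi> \<eta>
    using int[OF that(1)] int[OF that(2)] by (simp add: distrib_left)
  moreover have "(LINT x|lebesgue. f x * (c * \<psi> x)) = c * (LINT x|lebesgue. f x * \<psi> x)" for c \<psi>
    by (simp add: mult.left_commute)
  ultimately show ?thesis using bd unfolding tempered_distribution_def by blast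
qed

lemma represents_moderate:
  "moderate f \<Longrightarrow> represents (\<lambda>\<psi>. LINT x|lebesgue. f x * \<psi> x) f"
  by (simp add: represents_def tempered_moderate)

lemma test_function_support:
  assumes "\<psi> \<in> test_functions U"
  obtains a where "a > 0" "\<And>n x. \<bar>x\<bar> \<ge> a \<Longrightarrow> nth_deriv n \<psi> x = 0"
proof -
  have "bounded {x. \<psi> x \<noteq> 0}"
    using assms compact_imp_bounded bounded_subset closure_subset by (fastforce simp: test_functions_def)
  then obtain r where r: "\<And>x. \<psi> x \<noteq> 0 \<Longrightarrow> \<bar>x\<bar> \<le> r" by (auto simp: bounded_iff)
  have sm: "smooth \<psi>" using assms by (simp add: test_functions_def)
  have "nth_deriv n \<psi> x = 0" if "\<bar>x\<bar> > r" for n x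
    using that
  proof (induction n arbitrary: x)
    case 0
    thus ?case using r[of x] by auto
  next
    case (Suc n)
    have "((\<lambda>x. 0) has_vector_derivative nth_deriv (Suc n) \<psi> x) (at x)"
    proof (rule has_vector_derivative_transform_within_open[OF smooth_has_vector_derivative[OF sm]])
      show "open {x. r < \<bar>x\<bar>}" by (intro open_Collect_less continuous_intros)
    qed (use Suc in auto)
    thus ?case using vector_derivative_at by fastforce
  qed
  thus thesis using that[of "\<bar>r\<bar> + 1"] by fastforce
qed

lemma test_function_integrable:
  assumes "\<psi> \<in> test_functions U"
  shows "integrable lborel (nth_deriv n \<psi>)" "nth_deriv n \<psi> \<in> borel_measurable borel"
proof -
  obtain a where a: "a > 0" "\<And>n x. \<bar>x\<bar> \<ge> a \<Longrightarrow> nth_deriv n \<psi> x = 0"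
    using test_function_support[OF assms] by metis
  have sm: "smooth \<psi>" using assms by (simp add: test_functions_def)
  have "set_integrable lborel {-a..a} (nth_deriv n \<psi>)"
    by (intro borel_integrable_atLeastAtMost' continuous_on_subset[OF smooth_continuous[OF sm]]) auto
  moreover have "indicat_real {-a..a} x *\<^sub>R nth_deriv n \<psi> x = nth_deriv n \<psi> x" for x
    using a(2)[of x n] by (cases "\<bar>x\<bar> \<ge> a") (auto simp: indicator_def)
  ultimately show "integrable lborel (nth_deriv n \<psi>)" by (simp add: set_integrable_def)
  show "nth_deriv n \<psi> \<in> borel_measurable borel"
    by (rule borel_measurable_continuous_onI[OF smooth_continuous[OF sm]])
qed

text \<open>The function \<open>\<psi>' e + i \<xi> \<psi> e\<close>, where \<open>e\<close> is the
  exponential, has derivative \<open>(\<psi>'' + \<xi>^2 \<psi>) e\<close> and compact support. This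
  gives the decay of the transform that is needed to pair it with moderate functions.\<close>

lemma fourier_second_derivative:
  assumes "\<psi> \<in> test_functions U"
  shows "(LINT x|lborel. nth_deriv 2 \<psi> x * exp (- (\<i> * of_real (\<xi> * x))))
     = - of_real (\<xi>^2) * (LINT x|lborel. \<psi> x * exp (- (\<i> * of_real (\<xi> * x))))"
proof -
  obtain a where a: "a > 0" "\<And>n x. \<bar>x\<bar> \<ge> a \<Longrightarrow> nth_deriv n \<psi> x = 0"
    using test_function_support[OF assms] by metis
  have sm: "smooth \<psi>" using assms by (simp add: test_functions_def)
  define e where "e x = exp (- (\<i> * complex_of_real (\<xi> * x)))" for x
  define G where "G x = (nth_deriv 2 \<psi> x + of_real (\<xi>^2) * \<psi> x) * e x" for x
  have de: "(e has_vector_derivative - \<i> * of_real \<xi> * e x) (at x)" for x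
  proof -
    have "((\<lambda>z. exp (- (\<i> * of_real \<xi> * z))) has_field_derivative - \<i> * of_real \<xi> * exp (- (\<i> * of_real \<xi> * z))) (at z)" for z
      by (auto intro!: derivative_eq_intros)
    from has_vector_derivative_real_field[OF this[of "of_real x"]] show ?thesis
      unfolding e_def[abs_def] by (simp add: mult.assoc)
  qed
  have d: "((\<lambda>x. nth_deriv 1 \<psi> x * e x + \<i> * of_real \<xi> * (\<psi> x * e x)) has_vector_derivative G x) (at x)" for x
  proof -
    have "((\<lambda>x. nth_deriv 1 \<psi> x * e x) has_vector_derivative
       nth_deriv 1 \<psi> x * (- \<i> * of_real \<xi> * e x) + nth_deriv 2 \<psi> x * e x) (at x)"
      using has_vector_derivative_mult[OF smooth_has_vector_derivative[OF sm, of 1 x] de[of x]] by (simp add: numeral_2_eq_2)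
    moreover have "((\<lambda>x. \<i> * of_real \<xi> * (\<psi> x * e x)) has_vector_derivative
       \<i> * of_real \<xi> * (\<psi> x * (- \<i> * of_real \<xi> * e x) + nth_deriv 1 \<psi> x * e x)) (at x)"
      using has_vector_derivative_mult_right[OF has_vector_derivative_mult[OF smooth_has_vector_derivative[OF sm, of 0 x] de[of x]]]
      by simp
    ultimately have "((\<lambda>x. nth_deriv 1 \<psi> x * e x + \<i> * of_real \<xi> * (\<psi> x * e x)) has_vector_derivative
       (nth_deriv 1 \<psi> x * (- \<i> * of_real \<xi> * e x) + nth_deriv 2 \<psi> x * e x)
        + (\<i> * of_real \<xi> * (\<psi> x * (- \<i> * of_real \<xi> * e x) + nth_deriv 1 \<psi> x * e x))) (at x)"
      by (rule has_vector_derivative_add)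
    also have "(nth_deriv 1 \<psi> x * (- \<i> * of_real \<xi> * e x) + nth_deriv 2 \<psi> x * e x)
        + (\<i> * of_real \<xi> * (\<psi> x * (- \<i> * of_real \<xi> * e x) + nth_deriv 1 \<psi> x * e x)) = G x"
      by (simp add: G_def algebra_simps power2_eq_square)
    finally show ?thesis .
  qed
  have ce: "continuous_on UNIV e" unfolding e_def by (intro continuous_intros)
  have cG: "continuous_on UNIV G"
    unfolding G_def using smooth_continuous[OF sm, of 0] smooth_continuous[OF sm, of 2]
    by (intro continuous_intros ce) simp_all
  define H where "H x = nth_deriv 1 \<psi> x * e x + \<i> * of_real \<xi> * (\<psi> x * e x)" for x
  have dH: "(H has_vector_derivative G x) (at x)" for x
    using d[of x] unfolding H_def .
  have "(LINT x|lborel. indicator {-a..a} x *\<^sub>R G x) = H a - H (-a)"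
  proof (rule integral_FTC_atLeastAtMost)
    show "- a \<le> a" using a(1) by simp
    show "(H has_vector_derivative G x) (at x within {-a..a})" for x
      by (rule has_vector_derivative_at_within[OF dH])
    show "continuous_on {-a..a} G" by (rule continuous_on_subset[OF cG]) simp
  qed
  also have "\<dots> = 0"
    unfolding H_def using a(2)[of a 1] a(2)[of "-a" 1] a(2)[of a 0] a(2)[of "-a" 0] a(1) by simp
  also have "(\<lambda>x. indicator {-a..a} x *\<^sub>R G x) = G"
  proof
    fix x
    show "indicator {-a..a} x *\<^sub>R G x = G x"
      using a(2)[of x 2] a(2)[of x 0] by (cases "\<bar>x\<bar> \<ge> a") (auto simp: indicator_def G_def)
  qed
  finally have 0: "(LINT x|lborel. G x) = 0" .
  have em: "e \<in> borel_measurable borel" by (rule borel_measurable_continuous_onI[OF ce])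
  have ie: "integrable lborel (\<lambda>x. nth_deriv n \<psi> x * e x)" for n
  proof (rule integrable_le[OF test_function_integrable(1)[OF assms, of n]])
    show "(\<lambda>x. nth_deriv n \<psi> x * e x) \<in> borel_measurable lborel"
      using em test_function_integrable(2)[OF assms, of n] by simp
  qed (simp add: norm_mult e_def)
  have "(LINT x|lborel. G x) = (LINT x|lborel. nth_deriv 2 \<psi> x * e x + of_real (\<xi>^2) * (\<psi> x * e x))"
    by (simp add: G_def distrib_right mult.assoc)
  also have "\<dots> = (LINT x|lborel. nth_deriv 2 \<psi> x * e x) + (LINT x|lborel. of_real (\<xi>^2) * (\<psi> x * e x))"
    using ie[of 2] ie[of 0] by (intro Bochner_Integration.integral_add integrable_mult_right) simp_all
  also have "(LINT x|lborel. of_real (\<xi>^2) * (\<psi> x * e x)) = of_real (\<xi>^2) * (LINT x|lborel. \<psi> x * e x)"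
    by (rule integral_mult_right_zero)
  finally show ?thesis using 0 unfolding e_def by (simp add: eq_neg_iff_add_eq_0)
qed

lemma fourier_lborel:
  assumes "\<psi> \<in> borel_measurable borel"
  shows "fourier \<psi> \<xi> = (LINT x|lborel. \<psi> x * exp (- (\<i> * of_real (\<xi> * x))))"
proof -
  have [measurable]: "\<psi> \<in> borel_measurable borel" by fact
  show ?thesis unfolding fourier_def by (rule integral_completion) measurable
qed

lemma decaying_fourier:
  assumes "\<psi> \<in> test_functions U" shows "decaying (fourier \<psi>)"
proof -
  have m [measurable]: "\<psi> \<in> borel_measurable borel"
    using test_function_integrable(2)[OF assms, of 0] by simp
  define L where "L n = (LINT x|lborel. cmod (nth_deriv n \<psi> x))" for n
  have le: "cmod (LINT x|lborel. nth_deriv n \<psi> x * exp (- (\<i> * of_real (\<xi> * x)))) \<le> L n" for n \<xi>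
  proof -
    have "cmod (LINT x|lborel. nth_deriv n \<psi> x * exp (- (\<i> * of_real (\<xi> * x))))
       \<le> (LINT x|lborel. cmod (nth_deriv n \<psi> x * exp (- (\<i> * of_real (\<xi> * x)))))"
      by (rule integral_norm_bound)
    thus ?thesis by (simp add: norm_mult L_def)
  qed
  show ?thesis
  proof (rule decayingI[of _ "L 0 + L 2"])
    have "(\<lambda>(\<xi>, x). \<psi> x * exp (- (\<i> * complex_of_real (\<xi> * x)))) \<in> borel_measurable (borel \<Otimes>\<^sub>M lborel)"
      by measurable
    hence "(\<lambda>\<xi>. LINT x|lborel. \<psi> x * exp (- (\<i> * complex_of_real (\<xi> * x)))) \<in> borel_measurable borel"
      using lborel.borel_measurable_lebesgue_integral[of "\<lambda>\<xi> x. \<psi> x * exp (- (\<i> * complex_of_real (\<xi> * x)))" borel] by simp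
    thus "fourier \<psi> \<in> borel_measurable borel" using fourier_lborel[OF m] by presburger
    fix \<xi>
    have "cmod (fourier \<psi> \<xi>) \<le> L 0"
      using le[of 0 \<xi>] by (simp add: fourier_lborel[OF m])
    moreover have "\<xi>^2 * cmod (fourier \<psi> \<xi>) \<le> L 2"
      using le[of 2 \<xi>] unfolding fourier_second_derivative[OF assms]
      by (simp add: fourier_lborel[OF m] norm_mult norm_power)
    ultimately have "cmod (fourier \<psi> \<xi>) * (1 + \<xi>^2) \<le> L 0 + L 2"
      by (simp add: distrib_left mult.commute)
    thus "cmod (fourier \<psi> \<xi>) \<le> (L 0 + L 2) / (1 + \<xi>^2)"
      by (simp add: pos_le_divide_eq one_plus_square_pos)
  qed
qed

text \<open>By Fubini, the value at \<open>z\<close> is the integral of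
  \<open>\<psi>(\<eta>) exp (i z \<eta>)\<close> against the Fourier transform of \<open>K\<close>, and
  the two factors have disjoint supports.\<close>

lemma conv_fourier_vanishes:
  assumes \<psi>: "\<psi> \<in> test_functions U" and K: "decaying K"
    and van: "\<And>\<xi>. \<xi> \<in> U \<Longrightarrow> (LINT x|lborel. K x * exp (- (\<i> * of_real (\<xi> * x)))) = 0"
  shows "conv (\<lambda>x. fourier \<psi> (- x)) K = (\<lambda>x. 0)"
proof
  fix z
  have m [measurable]: "\<psi> \<in> borel_measurable borel"
    using test_function_integrable(2)[OF \<psi>, of 0] by simp
  have i\<psi>: "integrable lborel \<psi>" using test_function_integrable(1)[OF \<psi>, of 0] by simp
  have mK [measurable]: "K \<in> borel_measurable borel" using K by (rule decaying_measurable)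
  have iK: "integrable lborel K" using K by (rule decaying_integrable)
  note kf = decaying_reflect[OF decaying_fourier[OF \<psi>]]
  define F where "F = (\<lambda>(\<eta>, y). \<psi> \<eta> * exp (- (\<i> * complex_of_real ((y - z) * \<eta>))) * K y)"
  have Fm [measurable]: "F \<in> borel_measurable (lborel \<Otimes>\<^sub>M lborel)"
    unfolding F_def by measurable
  have nF: "norm (F (\<eta>, y)) = cmod (\<psi> \<eta>) * cmod (K y)" for \<eta> y
    by (simp add: F_def norm_mult)
  have Fint: "integrable (lborel \<Otimes>\<^sub>M lborel) F"
  proof (rule lborel_pair.Fubini_integrable[OF Fm])
    show "integrable lborel (\<lambda>\<eta>. LINT y|lborel. norm (F (\<eta>, y)))"
      unfolding nF by (simp add: i\<psi>)
    show "AE \<eta> in lborel. integrable lborel (\<lambda>y. F (\<eta>, y))"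
    proof (rule AE_I2)
      fix \<eta> :: real
      have "integrable lborel (\<lambda>y. cmod (\<psi> \<eta>) * cmod (K y))" using iK by simp
      thus "integrable lborel (\<lambda>y. F (\<eta>, y))"
        by (rule integrable_le) (auto simp: nF)
    qed
  qed
  have "conv (\<lambda>x. fourier \<psi> (- x)) K z = (LINT y|lborel. fourier \<psi> (y - z) * K y)"
    using kf by (simp add: conv_borel decaying_measurable)
  also have "\<dots> = (LINT y|lborel. LINT \<eta>|lborel. F (\<eta>, y))"
    unfolding fourier_lborel[OF m] F_def by simp
  also have "\<dots> = (LINT \<eta>|lborel. LINT y|lborel. F (\<eta>, y))"
    using lborel_pair.Fubini_integral[of "\<lambda>\<eta> y. F (\<eta>, y)"] Fint by simp
  also have "\<dots> = (LINT \<eta>::real|lborel. 0)"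
  proof (rule Bochner_Integration.integral_cong[OF refl])
    fix \<eta> :: real
    show "(LINT y|lborel. F (\<eta>, y)) = 0"
    proof (cases "\<psi> \<eta> = 0")
      case False
      hence "\<eta> \<in> U" using \<psi> closure_subset by (fastforce simp: test_functions_def)
      have "F (\<eta>, y) = \<psi> \<eta> * exp (\<i> * of_real (z * \<eta>)) * (K y * exp (- (\<i> * of_real (\<eta> * y))))" for y
      proof -
        have "- (\<i> * complex_of_real ((y - z) * \<eta>)) = \<i> * of_real (z * \<eta>) + - (\<i> * of_real (\<eta> * y))"
          by (simp add: algebra_simps)
        hence "exp (- (\<i> * complex_of_real ((y - z) * \<eta>))) = exp (\<i> * of_real (z * \<eta>)) * exp (- (\<i> * of_real (\<eta> * y)))"
          by (simp only: exp_add)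
        thus ?thesis unfolding F_def by (simp add: mult_ac)
      qed
      hence "(LINT y|lborel. F (\<eta>, y)) = \<psi> \<eta> * exp (\<i> * of_real (z * \<eta>)) * (LINT y|lborel. K y * exp (- (\<i> * of_real (\<eta> * y))))"
        by (simp only: integral_mult_right_zero)
      thus ?thesis by (simp only: van[OF \<open>\<eta> \<in> U\<close>] mult_zero_right)
    qed (simp add: F_def)
  qed
  finally show "conv (\<lambda>x. fourier \<psi> (- x)) K z = 0" by simp
qed

lemma fourier_dil:
  assumes h: "h > 0"
  shows "(LINT x|lborel. dil h K x * exp (- (\<i> * of_real (\<xi> * x)))) = (LINT x|lborel. K x * exp (- (\<i> * of_real (h * \<xi> * x))))"
proof -
  have "(LINT x|lborel. dil h K x * exp (- (\<i> * of_real (\<xi> * x))))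
      = h *\<^sub>R (LINT x|lborel. dil h K (0 + h * x) * exp (- (\<i> * of_real (\<xi> * (0 + h * x)))))"
    using lborel_integral_real_affine[of h "\<lambda>x. dil h K x * exp (- (\<i> * of_real (\<xi> * x)))" 0] h by simp
  also have "\<dots> = (LINT x|lborel. h *\<^sub>R (dil h K (0 + h * x) * exp (- (\<i> * of_real (\<xi> * (0 + h * x))))))"
    by (rule integral_scaleR_right[symmetric])
  also have "\<dots> = (LINT x|lborel. K x * exp (- (\<i> * of_real (h * \<xi> * x))))"
    by (rule Bochner_Integration.integral_cong[OF refl]) (use h in \<open>simp add: dil_def scaleR_conv_of_real mult_ac\<close>)
  finally show ?thesis .
qed

text \<open>For a test function \<open>\<psi>\<close> supported off the band, the distributional
  transform of the mollified function at \<open>\<psi>\<close> is the convolution of \<open>f\<close>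
  with (transform of \<open>\<psi>\<close>) * (mollifier), evaluated at zero, and that convolution of
  kernels vanishes.\<close>

lemma (in averaging_lattice) conv_mollifier_band_limited:
  assumes V: "band_mollifier g V" and h: "h > 0" and f: "f \<in> X" and \<sigma>: "h * \<sigma> = g"
  shows "conv (dil h (V 0)) f \<in> band_limited X \<sigma>"
proof -
  note f' = moderate_mem[OF f]
  have Vk: "decaying (V 0)" using V by (simp add: band_mollifier_def)
  note Vh = decaying_dil[OF Vk h]
  define G where "G = conv (dil h (V 0)) f"
  have GX: "G \<in> X" unfolding G_def by (intro conv_dil_mem Vk h f)
  note G' = moderate_mem[OF GX]
  define T where "T = (\<lambda>\<psi>. LINT x|lebesgue. G x * \<psi> x)"
  have "dist_support (dist_fourier T) \<subseteq> {-\<sigma>..\<sigma>}"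
  proof
    fix \<xi> assume \<xi>: "\<xi> \<in> dist_support (dist_fourier T)"
    show "\<xi> \<in> {-\<sigma>..\<sigma>}"
    proof (rule ccontr)
      assume "\<xi> \<notin> {-\<sigma>..\<sigma>}"
      moreover have "open (- {-\<sigma>..\<sigma>})" by (intro open_Compl closed_atLeastAtMost)
      ultimately obtain \<psi> where \<psi>: "\<psi> \<in> test_functions (- {-\<sigma>..\<sigma>})" and nz: "dist_fourier T \<psi> \<noteq> 0"
        using \<xi> unfolding dist_support_def by blast
      note kf = decaying_fourier[OF \<psi>]
      have "conv (\<lambda>x. fourier \<psi> (- x)) (dil h (V 0)) = (\<lambda>x. 0)"
      proof (rule conv_fourier_vanishes[OF \<psi> Vh])
        fix \<eta> assume "\<eta> \<in> - {-\<sigma>..\<sigma>}"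
        hence "\<bar>\<eta>\<bar> > \<sigma>" by auto
        hence "\<bar>h * \<eta>\<bar> > g" using h by (simp add: abs_mult \<sigma>[symmetric])
        thus "(LINT x|lborel. dil h (V 0) x * exp (- (\<i> * of_real (\<eta> * x)))) = 0"
          using V unfolding fourier_dil[OF h] band_mollifier_def by blast
      qed
      moreover have "dist_fourier T \<psi> = conv (conv (\<lambda>x. fourier \<psi> (- x)) (dil h (V 0))) f 0"
        unfolding dist_fourier_def T_def moderate_pairing(2)[OF kf G']
        unfolding G_def conv_assoc[OF decaying_reflect[OF kf] Vh f'] ..
      ultimately have "dist_fourier T \<psi> = 0" by (simp add: conv_def)
      with nz show False ..
    qed
  qed
  moreover have "represents T G" unfolding T_def by (rule represents_moderate[OF G'])
  moreover have "smooth G" unfolding G_def by (rule conv_mollifier_derivatives(2)[OF V h f'])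
  ultimately show ?thesis unfolding band_limited_def G_def[symmetric] using GX by blast
qed

section \<open>Band-limited approximation and the estimate for the operators\<close>

lemma band_mollifier_primitive:
  assumes "band_mollifier g V" shows "primitive_kernel (V m) (V (Suc m))"
proof -
  have d: "(V m has_vector_derivative V (Suc m) x) (at x)" for x
    using assms by (simp add: band_mollifier_def)
  have "continuous_on UNIV (V m)"
    by (intro continuous_at_imp_continuous_on ballI has_vector_derivative_continuous[OF d])
  thus ?thesis
    using assms d unfolding primitive_kernel_def band_mollifier_def by blast
qed

lemma conv_swap:
  assumes "decaying K" "decaying J" "moderate f"
  shows "conv K (conv J f) = conv J (conv K f)"
  using assms conv_assoc conv_commute by metis

definition residual :: "(real \<Rightarrow> complex) \<Rightarrow> real \<Rightarrow> (real \<Rightarrow> complex) \<Rightarrow> real \<Rightarrow> complex" where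
  "residual K h f x = f x - conv (dil h K) f x"

lemma residual_fun: "residual K h f = (\<lambda>x. f x - conv (dil h K) f x)"
  by (simp add: residual_def fun_eq_iff)

lemma I_minus_steklov_fwd_residual: "h > 0 \<Longrightarrow> I_minus_steklov_fwd h = residual box_kernel h"
  by (simp add: fun_eq_iff I_minus_steklov_fwd_eq residual_def)

context averaging_lattice begin

lemma residual_mem: "decaying K \<Longrightarrow> h > 0 \<Longrightarrow> f \<in> X \<Longrightarrow> residual K h f \<in> X"
  unfolding residual_def by (intro diff_mem conv_dil_mem)

lemma residual_power_mem: "decaying K \<Longrightarrow> h > 0 \<Longrightarrow> f \<in> X \<Longrightarrow> (residual K h ^^ n) f \<in> X"
  by (induction n) (auto intro: residual_mem)

lemma residual_add:
  assumes "decaying K" "h > 0" "f \<in> X" "g \<in> X"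
  shows "residual K h (\<lambda>x. f x + g x) = (\<lambda>x. residual K h f x + residual K h g x)"
  using conv_add_right[OF decaying_dil moderate_mem moderate_mem, of K h f g] assms
  by (simp add: residual_def fun_eq_iff)

lemma conv_residual:
  assumes "decaying K" "decaying J" "h > 0" "f \<in> X"
  shows "conv (dil h K) (residual J h f) = residual J h (conv (dil h K) f)"
proof -
  have k: "decaying (dil h K)" "decaying (dil h J)" using assms by (auto intro: decaying_dil)
  have "conv (dil h K) (residual J h f) = (\<lambda>x. conv (dil h K) f x - conv (dil h K) (conv (dil h J) f) x)"
    unfolding residual_def[abs_def]
    by (intro conv_diff_right k moderate_mem conv_dil_mem assms)
  also have "conv (dil h K) (conv (dil h J) f) = conv (dil h J) (conv (dil h K) f)"
    by (intro conv_swap k moderate_mem assms)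
  finally show ?thesis unfolding residual_fun[of J h "conv (dil h K) f"] .
qed

lemma residual_commute:
  assumes "decaying K" "decaying J" "h > 0" "f \<in> X"
  shows "residual K h (residual J h f) = residual J h (residual K h f)"
proof
  fix x
  have k: "decaying (dil h J)" using assms by (auto intro: decaying_dil)
  have "conv (dil h J) (residual K h f) = (\<lambda>x. conv (dil h J) f x - conv (dil h J) (conv (dil h K) f) x)"
    unfolding residual_def[abs_def]
    by (intro conv_diff_right k moderate_mem conv_dil_mem assms)
  thus "residual K h (residual J h f) x = residual J h (residual K h f) x"
    using fun_cong[OF conv_residual[OF assms], of x] by (simp add: residual_def)
qed

lemma residual_power_commute:
  assumes "decaying K" "decaying J" "h > 0" "f \<in> X"
  shows "(residual K h ^^ n) (residual J h f) = residual J h ((residual K h ^^ n) f)"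
proof (induction n)
  case (Suc n)
  show ?case
    using Suc residual_commute[OF assms(1-3) residual_power_mem[OF assms(1,3,4), of n]] by simp
qed simp

text \<open>Each division by \<open>I\<close> minus the forward average lowers the order of the
  derivative by at most one, so \<open>s\<close> derivatives pay for \<open>s\<close> divisions.\<close>

lemma conv_derivative_bound:
  assumes V: "band_mollifier g V" and "s \<le> m"
  shows "\<exists>C\<ge>0. \<forall>h>0. \<forall>f\<in>X. nrm (conv (dil h (V m)) f) \<le> C * nrm ((residual box_kernel h ^^ s) f)"
  using assms(2)
proof (induction s arbitrary: m)
  case 0
  have "decaying (V m)" using V by (simp add: band_mollifier_def)
  from conv_dil_bounded[OF this] show ?case by (metis funpow_0)
next
  case (Suc s)
  then obtain n where m: "m = Suc n" and n: "s \<le> n" by (cases m) auto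
  obtain D where D: "D \<ge> 0" "\<And>h f. h > 0 \<Longrightarrow> f \<in> X \<Longrightarrow>
    nrm (conv (dil h (V m)) f) \<le> D * (nrm (conv (dil h (V m)) (I_minus_steklov_fwd h f))
       + nrm (conv (dil h (V n)) (I_minus_steklov_fwd h f)))"
    using divide_by_difference[OF band_mollifier_primitive[OF V, of n]] unfolding m by metis
  obtain A where A: "A \<ge> 0" "\<And>h f. h > 0 \<Longrightarrow> f \<in> X \<Longrightarrow> nrm (conv (dil h (V m)) f) \<le> A * nrm ((residual box_kernel h ^^ s) f)"
    using Suc.IH[of m] Suc.prems by auto
  obtain B where B: "B \<ge> 0" "\<And>h f. h > 0 \<Longrightarrow> f \<in> X \<Longrightarrow> nrm (conv (dil h (V n)) f) \<le> B * nrm ((residual box_kernel h ^^ s) f)"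
    using Suc.IH[OF n] by auto
  have "nrm (conv (dil h (V m)) f) \<le> D * (A + B) * nrm ((residual box_kernel h ^^ Suc s) f)" if h: "h > 0" and f: "f \<in> X" for h f
  proof -
    let ?d = "residual box_kernel h f"
    have d: "?d \<in> X" by (intro residual_mem decaying_box h f)
    have "nrm (conv (dil h (V m)) f) \<le> D * (nrm (conv (dil h (V m)) ?d) + nrm (conv (dil h (V n)) ?d))"
      using D(2)[OF h f] by (simp add: I_minus_steklov_fwd_residual h)
    also have "\<dots> \<le> D * (A * nrm ((residual box_kernel h ^^ s) ?d) + B * nrm ((residual box_kernel h ^^ s) ?d))"
      using D(1) by (intro mult_left_mono add_mono A B h d)
    finally show ?thesis by (simp add: funpow_swap1 algebra_simps)
  qed
  moreover have "D * (A + B) \<ge> 0" using A B D by simp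
  ultimately show ?case by blast
qed

text \<open>Write \<open>I - V = (I - box_kernel) + (box_kernel - V)\<close>; the second term is
  divisible because it has a decaying primitive.\<close>

lemma residual_bound:
  assumes V: "band_mollifier g V"
  shows "\<exists>C\<ge>0. \<forall>h>0. \<forall>f\<in>X. nrm (residual (V 0) h f) \<le> C * nrm (residual box_kernel h f)"
proof -
  obtain P where P: "primitive_kernel P (\<lambda>x. box_kernel x - V 0 x)"
    using V by (auto simp: band_mollifier_def)
  define N where "N = (\<lambda>x. box_kernel x - V 0 x)"
  have kV: "decaying (V 0)" using V by (simp add: band_mollifier_def)
  have kN: "decaying N" unfolding N_def by (intro decaying_diff decaying_box kV)
  have kP: "decaying P" using P by (simp add: primitive_kernel_def)
  obtain D where D: "D \<ge> 0" "\<And>h f. h > 0 \<Longrightarrow> f \<in> X \<Longrightarrow>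
    nrm (conv (dil h N) f) \<le> D * (nrm (conv (dil h N) (I_minus_steklov_fwd h f))
       + nrm (conv (dil h P) (I_minus_steklov_fwd h f)))"
    using divide_by_difference[OF P] unfolding N_def by metis
  obtain A where A: "A \<ge> 0" "\<And>h f. h > 0 \<Longrightarrow> f \<in> X \<Longrightarrow> nrm (conv (dil h N) f) \<le> A * nrm f"
    using conv_dil_bounded[OF kN] by metis
  obtain B where B: "B \<ge> 0" "\<And>h f. h > 0 \<Longrightarrow> f \<in> X \<Longrightarrow> nrm (conv (dil h P) f) \<le> B * nrm f"
    using conv_dil_bounded[OF kP] by metis
  have "nrm (residual (V 0) h f) \<le> (1 + D * (A + B)) * nrm (residual box_kernel h f)" if h: "h > 0" and f: "f \<in> X" for h f
  proof -
    let ?d = "residual box_kernel h f"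
    have d: "?d \<in> X" by (intro residual_mem decaying_box h f)
    have "conv (dil h N) f = (\<lambda>x. conv (dil h box_kernel) f x - conv (dil h (V 0)) f x)"
      unfolding N_def dil_diff by (intro conv_diff_left decaying_dil decaying_box kV h moderate_mem f)
    hence "residual (V 0) h f = (\<lambda>x. ?d x + conv (dil h N) f x)"
      by (simp add: residual_def fun_eq_iff)
    hence "nrm (residual (V 0) h f) \<le> nrm ?d + nrm (conv (dil h N) f)"
      using nrm_triangle[OF d conv_dil_mem[OF kN h f]] by simp
    also have "nrm (conv (dil h N) f) \<le> D * (nrm (conv (dil h N) ?d) + nrm (conv (dil h P) ?d))"
      using D(2)[OF h f] by (simp add: I_minus_steklov_fwd_residual h)
    also have "\<dots> \<le> D * (A * nrm ?d + B * nrm ?d)"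
      using D(1) by (intro mult_left_mono add_mono A B h d)
    finally show ?thesis by (simp add: algebra_simps)
  qed
  moreover have "1 + D * (A + B) \<ge> 0" using A B D by simp
  ultimately show ?thesis by blast
qed

lemma residual_power_bound:
  assumes V: "band_mollifier g V"
  shows "\<exists>C\<ge>0. \<forall>h>0. \<forall>f\<in>X. nrm ((residual (V 0) h ^^ s) f) \<le> C * nrm ((residual box_kernel h ^^ s) f)"
proof (induction s)
  case 0
  show ?case by (intro exI[of _ 1]) auto
next
  case (Suc s)
  have kV: "decaying (V 0)" using V by (simp add: band_mollifier_def)
  obtain A where A: "A \<ge> 0" "\<And>h f. h > 0 \<Longrightarrow> f \<in> X \<Longrightarrow> nrm ((residual (V 0) h ^^ s) f) \<le> A * nrm ((residual box_kernel h ^^ s) f)"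
    using Suc.IH by blast
  obtain B where B: "B \<ge> 0" "\<And>h f. h > 0 \<Longrightarrow> f \<in> X \<Longrightarrow> nrm (residual (V 0) h f) \<le> B * nrm (residual box_kernel h f)"
    using residual_bound[OF V] by blast
  have "nrm ((residual (V 0) h ^^ Suc s) f) \<le> B * A * nrm ((residual box_kernel h ^^ Suc s) f)" if h: "h > 0" and f: "f \<in> X" for h f
  proof -
    have "nrm ((residual (V 0) h ^^ Suc s) f) \<le> B * nrm (residual box_kernel h ((residual (V 0) h ^^ s) f))"
      using B(2)[OF h residual_power_mem[OF kV h f]] by simp
    also have "residual box_kernel h ((residual (V 0) h ^^ s) f) = (residual (V 0) h ^^ s) (residual box_kernel h f)"
      by (rule residual_power_commute[OF kV decaying_box h f, symmetric])
    also have "B * nrm \<dots> \<le> B * (A * nrm ((residual box_kernel h ^^ s) (residual box_kernel h f)))"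
      using B(1) by (intro mult_left_mono A h residual_mem decaying_box f)
    finally show ?thesis by (simp add: funpow_swap1 mult.assoc)
  qed
  moreover have "B * A \<ge> 0" using A B by simp
  ultimately show ?case by blast
qed

end

text \<open>The partial geometric sum of \<open>residual K h ^^ j\<close> over \<open>j < n\<close>, in
  Horner form.\<close>

primrec residual_sum :: "(real \<Rightarrow> complex) \<Rightarrow> real \<Rightarrow> nat \<Rightarrow> (real \<Rightarrow> complex) \<Rightarrow> real \<Rightarrow> complex" where
  "residual_sum K h 0 f = (\<lambda>x. 0)"
| "residual_sum K h (Suc n) f = (\<lambda>x. f x + residual K h (residual_sum K h n f) x)"

context averaging_lattice begin

lemma residual_sum_mem: "decaying K \<Longrightarrow> h > 0 \<Longrightarrow> f \<in> X \<Longrightarrow> residual_sum K h n f \<in> X"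
  by (induction n) (auto intro: zero_mem add_mem residual_mem)

text \<open>The geometric sum formula \<open>E ^ n = I - (I - E) (I + E + \<dots> + E ^ (n - 1))\<close>
  for \<open>E = residual K h\<close>, where \<open>I - E\<close> is the convolution with the dilated
  kernel.\<close>

lemma residual_sum_eq:
  assumes K: "decaying K" and h: "h > 0" and f: "f \<in> X"
  shows "(residual K h ^^ n) f = (\<lambda>x. f x - conv (dil h K) (residual_sum K h n f) x)"
proof (induction n)
  case 0
  show ?case by (simp add: conv_def)
next
  case (Suc n)
  let ?q = "residual_sum K h n f"
  have q: "?q \<in> X" by (intro residual_sum_mem K h f)
  have kd: "decaying (dil h K)" by (intro decaying_dil K h)
  have E: "(residual K h ^^ n) f \<in> X" by (intro residual_power_mem K h f)
  have Vq: "conv (dil h K) ?q \<in> X" by (intro conv_dil_mem K h q)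
  have "f = (\<lambda>x. (residual K h ^^ n) f x + conv (dil h K) ?q x)"
    unfolding Suc by simp
  hence 1: "residual K h f = (\<lambda>x. residual K h ((residual K h ^^ n) f) x + residual K h (conv (dil h K) ?q) x)"
    using residual_add[OF K h E Vq] by simp
  have "conv (dil h K) (residual_sum K h (Suc n) f)
      = (\<lambda>x. conv (dil h K) f x + conv (dil h K) (residual K h ?q) x)"
    by (simp, intro conv_add_right kd moderate_mem f residual_mem K h q)
  also have "conv (dil h K) (residual K h ?q) = residual K h (conv (dil h K) ?q)"
    by (intro conv_residual K h q)
  finally have 2: "conv (dil h K) (residual_sum K h (Suc n) f)
      = (\<lambda>x. conv (dil h K) f x + residual K h (conv (dil h K) ?q) x)" .
  show ?case
  proof
    fix x
    show "(residual K h ^^ Suc n) f x = f x - conv (dil h K) (residual_sum K h (Suc n) f) x"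
      using fun_cong[OF 1, of x] fun_cong[OF 2, of x] residual_def[of K h f x]
      by (simp del: residual_sum.simps add: algebra_simps)
  qed
qed

lemma residual_sum_commute:
  assumes K: "decaying K" and J: "decaying J" and h: "h > 0" and f: "f \<in> X"
  shows "(residual J h ^^ m) (residual_sum K h n f) = residual_sum K h n ((residual J h ^^ m) f)"
proof -
  have *: "residual J h (residual_sum K h n f) = residual_sum K h n (residual J h f)" if f: "f \<in> X" for f
  proof (induction n)
    case 0
    show ?case by (simp add: residual_def conv_def fun_eq_iff)
  next
    case (Suc n)
    have q: "residual_sum K h n f \<in> X" by (intro residual_sum_mem K h f)
    have "residual J h (residual_sum K h (Suc n) f)
        = (\<lambda>x. residual J h f x + residual J h (residual K h (residual_sum K h n f)) x)"
      by (simp, intro residual_add J h f residual_mem K q)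
    also have "residual J h (residual K h (residual_sum K h n f)) = residual K h (residual J h (residual_sum K h n f))"
      by (intro residual_commute J K h q)
    finally show ?case using Suc by simp
  qed
  show ?thesis
    by (induction m) (simp_all add: * residual_power_mem[OF J h f])
qed

lemma residual_sum_bounded:
  assumes K: "decaying K"
  shows "\<exists>C\<ge>0. \<forall>h>0. \<forall>f\<in>X. nrm (residual_sum K h n f) \<le> C * nrm f"
proof (induction n)
  case 0
  show ?case by (intro exI[of _ 0]) (auto simp: nrm_zero)
next
  case (Suc n)
  obtain A where A: "A \<ge> 0" "\<And>h f. h > 0 \<Longrightarrow> f \<in> X \<Longrightarrow> nrm (residual_sum K h n f) \<le> A * nrm f"
    using Suc by blast
  obtain B where B: "B \<ge> 0" "\<And>h f. h > 0 \<Longrightarrow> f \<in> X \<Longrightarrow> nrm (conv (dil h K) f) \<le> B * nrm f"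
    using conv_dil_bounded[OF K] by metis
  have "nrm (residual_sum K h (Suc n) f) \<le> (1 + (1 + B) * A) * nrm f" if h: "h > 0" and f: "f \<in> X" for h f
  proof -
    let ?q = "residual_sum K h n f"
    have q: "?q \<in> X" by (intro residual_sum_mem K h f)
    have "nrm (residual_sum K h (Suc n) f) \<le> nrm f + nrm (residual K h ?q)"
      using nrm_triangle[OF f residual_mem[OF K h q]] by simp
    also have "nrm (residual K h ?q) \<le> nrm ?q + nrm (conv (dil h K) ?q)"
      unfolding residual_def[abs_def] by (intro nrm_diff_le q conv_dil_mem K h)
    also have "\<dots> \<le> (1 + B) * nrm ?q" using B(2)[OF h q] by (simp add: distrib_right)
    also have "\<dots> \<le> (1 + B) * (A * nrm f)" using B(1) by (intro mult_left_mono A h f) simp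
    finally show ?thesis by (simp add: algebra_simps)
  qed
  moreover have "1 + (1 + B) * A \<ge> 0" using A B by simp
  ultimately show ?case by blast
qed

text \<open>The approximant is the mollification of \<open>q = residual_sum (V 0) h s f\<close>. The
  error is then the \<open>s\<close>-th power of \<open>I - V\<close>, and the derivative falls on the
  mollifier; both are divisible by the \<open>s\<close>-th power of \<open>I\<close> minus the forward
  average, which commutes with the passage from \<open>f\<close> to \<open>q\<close>.\<close>

lemma band_limited_approximation:
  assumes \<gamma>: "\<gamma> > 0"
  shows "\<exists>C\<ge>0. \<forall>f\<in>X. \<forall>\<sigma>>0. \<exists>g\<in>band_limited X \<sigma>.
    nrm (\<lambda>x. f x - g x) \<le> C * nrm ((I_minus_steklov_fwd (\<gamma> / \<sigma>) ^^ s) f) \<and>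
    nrm (nth_deriv s g) \<le> C * \<sigma> ^ s * nrm ((I_minus_steklov_fwd (\<gamma> / \<sigma>) ^^ s) f)"
proof -
  obtain V where V: "band_mollifier \<gamma> V" using ex_band_mollifier[OF \<gamma>] by blast
  have kV: "decaying (V m)" for m using V by (simp add: band_mollifier_def)
  obtain A where A: "A \<ge> 0" "\<And>h f. h > 0 \<Longrightarrow> f \<in> X \<Longrightarrow> nrm ((residual (V 0) h ^^ s) f) \<le> A * nrm ((residual box_kernel h ^^ s) f)"
    using residual_power_bound[OF V] by blast
  obtain B where B: "B \<ge> 0" "\<And>h f. h > 0 \<Longrightarrow> f \<in> X \<Longrightarrow> nrm (conv (dil h (V s)) f) \<le> B * nrm ((residual box_kernel h ^^ s) f)"
    using conv_derivative_bound[OF V order_refl] by blast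
  obtain D where D: "D \<ge> 0" "\<And>h f. h > 0 \<Longrightarrow> f \<in> X \<Longrightarrow> nrm (residual_sum (V 0) h s f) \<le> D * nrm f"
    using residual_sum_bounded[OF kV] by blast
  define C where "C = A + B * D / \<gamma> ^ s"
  have BD: "0 \<le> B * D / \<gamma> ^ s" using B D \<gamma> by simp
  have "\<exists>g\<in>band_limited X \<sigma>.
    nrm (\<lambda>x. f x - g x) \<le> C * nrm ((I_minus_steklov_fwd (\<gamma> / \<sigma>) ^^ s) f) \<and>
    nrm (nth_deriv s g) \<le> C * \<sigma> ^ s * nrm ((I_minus_steklov_fwd (\<gamma> / \<sigma>) ^^ s) f)" if f: "f \<in> X" and \<sigma>: "\<sigma> > 0" for f \<sigma>
  proof -
    define h where "h = \<gamma> / \<sigma>"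
    have h: "h > 0" unfolding h_def using \<gamma> \<sigma> by simp
    define q where "q = residual_sum (V 0) h s f"
    have q: "q \<in> X" unfolding q_def by (intro residual_sum_mem kV h f)
    define g where "g = conv (dil h (V 0)) q"
    let ?w = "(residual box_kernel h ^^ s) f"
    have w: "?w \<in> X" by (intro residual_power_mem decaying_box h f)
    have "h * \<sigma> = \<gamma>" unfolding h_def using \<sigma> by simp
    hence gB: "g \<in> band_limited X \<sigma>"
      unfolding g_def by (rule conv_mollifier_band_limited[OF V h q])
    have "(\<lambda>x. f x - g x) = (residual (V 0) h ^^ s) f"
      unfolding g_def q_def by (rule residual_sum_eq[OF kV h f, symmetric])
    hence "nrm (\<lambda>x. f x - g x) \<le> A * nrm ?w" using A(2)[OF h f] by simp
    also have "\<dots> \<le> C * nrm ?w"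
      unfolding C_def using nrm_nonneg[OF w] BD by (intro mult_right_mono) auto
    finally have 1: "nrm (\<lambda>x. f x - g x) \<le> C * nrm ?w" .
    have "nth_deriv s g = (\<lambda>x. of_real ((1 / h) ^ s) * conv (dil h (V s)) q x)"
      unfolding g_def by (rule conv_mollifier_derivatives(1)[OF V h moderate_mem[OF q]])
    hence "nrm (nth_deriv s g) = (1 / h) ^ s * nrm (conv (dil h (V s)) q)"
      using h by (simp add: nrm_scale[OF conv_dil_mem[OF kV h q]] norm_divide norm_power)
    also have "\<dots> \<le> (1 / h) ^ s * (B * nrm ((residual box_kernel h ^^ s) q))"
      using h by (intro mult_left_mono B q) auto
    also have "(residual box_kernel h ^^ s) q = residual_sum (V 0) h s ?w"
      unfolding q_def by (rule residual_sum_commute[OF kV decaying_box h f])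
    also have "(1 / h) ^ s * (B * nrm (residual_sum (V 0) h s ?w)) \<le> (1 / h) ^ s * (B * (D * nrm ?w))"
      using h B(1) by (intro mult_left_mono D w) auto
    also have "\<dots> = B * D / \<gamma> ^ s * \<sigma> ^ s * nrm ?w"
      unfolding h_def by (simp add: power_divide)
    also have "\<dots> \<le> C * \<sigma> ^ s * nrm ?w"
      unfolding C_def using nrm_nonneg[OF w] A(1) \<sigma> by (intro mult_right_mono) auto
    finally have 2: "nrm (nth_deriv s g) \<le> C * \<sigma> ^ s * nrm ?w" .
    show ?thesis
      using gB 1 2 unfolding I_minus_steklov_fwd_residual[OF h, unfolded h_def] h_def by blast
  qed
  moreover have "C \<ge> 0" unfolding C_def using A BD by simp
  ultimately show ?thesis by blast
qed

lemma steklov_diff: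
  assumes "f \<in> X" "g \<in> X"
  shows "steklov h (\<lambda>x. f x - g x) = (\<lambda>x. steklov h f x - steklov h g x)"
proof
  fix x
  have "(LINT t:{x - h/2..x + h/2}|lebesgue. f t - g t)
      = (LINT t:{x - h/2..x + h/2}|lebesgue. f t) - (LINT t:{x - h/2..x + h/2}|lebesgue. g t)"
    by (intro set_integral_diff set_integrable_Icc assms)
  thus "steklov h (\<lambda>x. f x - g x) x = steklov h f x - steklov h g x"
    by (simp add: steklov_def scaleR_diff_right)
qed

lemma steklov_power_mem: "h > 0 \<Longrightarrow> f \<in> X \<Longrightarrow> (steklov h ^^ k) f \<in> X"
  by (induction k) (auto intro: steklov_mem)

lemma steklov_comb_diff:
  assumes h: "h > 0" and f: "f \<in> X" and g: "g \<in> X"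
  shows "steklov_comb h r (\<lambda>x. f x - g x) x = steklov_comb h r f x - steklov_comb h r g x"
proof -
  have "(steklov h ^^ k) (\<lambda>x. f x - g x) = (\<lambda>x. (steklov h ^^ k) f x - (steklov h ^^ k) g x)" for k
  proof (induction k)
    case (Suc k)
    thus ?case using steklov_diff[OF steklov_power_mem[OF h f, of k] steklov_power_mem[OF h g, of k], of h] by simp
  qed simp
  hence "steklov_comb h r (\<lambda>x. f x - g x) x = (\<Sum>k=1..r. (-1) ^ (k + 1) * of_nat (r choose k) * (steklov h ^^ k) f x
      - (-1) ^ (k + 1) * of_nat (r choose k) * (steklov h ^^ k) g x)"
    by (simp only: steklov_comb_def right_diff_distrib)
  thus ?thesis by (simp only: steklov_comb_def sum_subtractf)
qed

text \<open>The operator is only determined up to null functions, so its additivity is expressed in the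
  norm; it follows from the additivity of the partial sums.\<close>

lemma kantorovich_sum_diff:
  assumes h: "h > 0" and f: "f \<in> X" and g: "g \<in> X" and \<phi>: "\<And>k. \<phi> k \<in> X"
    and F: "kantorovich_sum X nrm h r x \<phi> f F" and G: "kantorovich_sum X nrm h r x \<phi> g G"
    and D: "kantorovich_sum X nrm h r x \<phi> (\<lambda>t. f t - g t) D"
  shows "nrm (\<lambda>t. F t - G t) = nrm D"
proof -
  define S where "S u n t = (\<Sum>k=-int n..int n. steklov_comb h r u (x k) * \<phi> k t)" for u n t
  have SX: "S u n \<in> X" for u n
    unfolding S_def[abs_def] by (intro sum_mem scale_mem \<phi>) simp
  have Sd: "S (\<lambda>t. f t - g t) n t = S f n t - S g n t" for n t
    unfolding S_def steklov_comb_diff[OF h f g] by (simp add: left_diff_distrib sum_subtractf)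
  have FX: "F \<in> X" "G \<in> X" "D \<in> X" using F G D by (auto simp: kantorovich_sum_def)
  have lim: "(\<lambda>n. nrm (\<lambda>t. F t - S f n t)) \<longlonglongrightarrow> 0" "(\<lambda>n. nrm (\<lambda>t. G t - S g n t)) \<longlonglongrightarrow> 0"
      "(\<lambda>n. nrm (\<lambda>t. D t - S (\<lambda>t. f t - g t) n t)) \<longlonglongrightarrow> 0"
    using F G D by (auto simp: kantorovich_sum_def S_def)
  have FG: "(\<lambda>t. F t - G t) \<in> X" by (intro diff_mem FX)
  have le: "nrm (\<lambda>t. (F t - G t) - D t) \<le> nrm (\<lambda>t. F t - S f n t) + nrm (\<lambda>t. G t - S g n t)
       + nrm (\<lambda>t. D t - S (\<lambda>t. f t - g t) n t)" for n
  proof -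
    have m: "(\<lambda>t. F t - S f n t) \<in> X" "(\<lambda>t. G t - S g n t) \<in> X" "(\<lambda>t. D t - S (\<lambda>t. f t - g t) n t) \<in> X"
      by (intro diff_mem FX SX)+
    have "(\<lambda>t. (F t - G t) - D t)
        = (\<lambda>t. ((F t - S f n t) - (G t - S g n t)) - (D t - S (\<lambda>t. f t - g t) n t))"
      unfolding Sd by (simp add: algebra_simps)
    thus ?thesis using nrm_diff_le[OF diff_mem[OF m(1,2)] m(3)] nrm_diff_le[OF m(1,2)] by simp
  qed
  have "(\<lambda>n. nrm (\<lambda>t. F t - S f n t) + nrm (\<lambda>t. G t - S g n t)
       + nrm (\<lambda>t. D t - S (\<lambda>t. f t - g t) n t)) \<longlonglongrightarrow> 0 + 0 + 0"
    by (intro tendsto_add lim)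
  hence "nrm (\<lambda>t. (F t - G t) - D t) \<le> 0 + 0 + 0"
    by (rule LIMSEQ_le_const) (use le in blast)
  hence "nrm (\<lambda>t. (F t - G t) - D t) = 0" using nrm_nonneg[OF diff_mem[OF FG FX(3)]] by simp
  moreover have "nrm (\<lambda>t. F t - G t) \<le> nrm D + nrm (\<lambda>t. (F t - G t) - D t)"
    by (rule nrm_le_add_diff[OF FG FX(3)])
  moreover have "nrm D \<le> nrm (\<lambda>t. F t - G t) + nrm (\<lambda>t. (F t - G t) - D t)"
    using nrm_le_add_diff[OF FX(3) FG] nrm_minus[OF FX(3) FG] by simp
  ultimately show ?thesis by linarith
qed

end

theorem theorem4p1:
  fixes X :: "(real \<Rightarrow> complex) set" and nrm :: "(real \<Rightarrow> complex) \<Rightarrow> real"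
    and r s :: nat and \<gamma> \<gamma>' C\<^sub>1 C\<^sub>2 :: real
    and \<Phi> :: "real \<Rightarrow> (real \<Rightarrow> complex) set"
    and \<phi> :: "real \<Rightarrow> int \<Rightarrow> real \<Rightarrow> complex"
    and x :: "real \<Rightarrow> int \<Rightarrow> real"
  assumes "banach_lattice X nrm" and "assumption_A X nrm"
    and "r \<ge> 1" and "s \<ge> 1"
    and "bernstein_family X nrm \<Phi>"
    and kernels: "\<And>\<sigma> k. \<sigma> \<ge> 1 \<Longrightarrow> \<phi> \<sigma> k \<in> \<Phi> \<sigma>"
    and "\<gamma> > 0" and "\<gamma>' > 0"
    and distinct: "\<And>\<sigma>. \<sigma> \<ge> 1 \<Longrightarrow> inj (x \<sigma>)"
    and spacing: "\<And>\<sigma> k. \<sigma> \<ge> 1 \<Longrightarrow>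
      \<gamma> / \<sigma> \<le> x \<sigma> (k + 1) - x \<sigma> k \<and> x \<sigma> (k + 1) - x \<sigma> k \<le> \<gamma>' / \<sigma>"
    and series: "\<And>\<sigma> f. \<sigma> \<ge> 1 \<Longrightarrow> f \<in> X \<Longrightarrow>
      \<exists>F. kantorovich_sum X nrm (\<gamma> / \<sigma>) r (x \<sigma>) (\<phi> \<sigma>) f F"
    and standing: "\<not> (\<forall>\<sigma>\<ge>1. \<forall>k. compact (closure {t. \<phi> \<sigma> k t \<noteq> 0})) \<Longrightarrow>
      order_continuous_norm X nrm \<and> schwartz_dense X nrm"
    and "C\<^sub>1 > 0" and "C\<^sub>2 > 0"
    and bounded: "\<And>f \<sigma>. f \<in> X \<Longrightarrow> \<sigma> \<ge> 1 \<Longrightarrow>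
      nrm (kantorovich X nrm (\<gamma> / \<sigma>) r (x \<sigma>) (\<phi> \<sigma>) f) \<le> C\<^sub>1 * nrm f"
    and approx: "\<And>g \<sigma>. \<sigma> \<ge> 1 \<Longrightarrow> g \<in> band_limited X \<sigma> \<Longrightarrow>
      nrm (\<lambda>t. g t - kantorovich X nrm (\<gamma> / \<sigma>) r (x \<sigma>) (\<phi> \<sigma>) g t) \<le> C\<^sub>2 * \<sigma> powr (- real s) * nrm (nth_deriv s g)"
  shows "\<exists>C>0. \<forall>f\<in>X. \<forall>\<sigma>\<ge>1.
    nrm (\<lambda>t. f t - kantorovich X nrm (\<gamma> / \<sigma>) r (x \<sigma>) (\<phi> \<sigma>) f t) \<le> C * nrm ((I_minus_steklov_fwd (\<gamma> / \<sigma>) ^^ s) f)"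
proof -
  interpret averaging_lattice X nrm
    using assms(1,2) by (simp add: averaging_lattice_def averaging_lattice_axioms_def)
  obtain C where C: "C \<ge> 0" and app: "\<And>f \<sigma>. f \<in> X \<Longrightarrow> \<sigma> > 0 \<Longrightarrow> \<exists>g\<in>band_limited X \<sigma>.
    nrm (\<lambda>x. f x - g x) \<le> C * nrm ((I_minus_steklov_fwd (\<gamma> / \<sigma>) ^^ s) f) \<and>
    nrm (nth_deriv s g) \<le> C * \<sigma> ^ s * nrm ((I_minus_steklov_fwd (\<gamma> / \<sigma>) ^^ s) f)"
    using band_limited_approximation[OF \<open>\<gamma> > 0\<close>, of s] by blast
  (* The summand 1 only makes the constant strictly positive. *)
  have "nrm (\<lambda>t. f t - kantorovich X nrm (\<gamma> / \<sigma>) r (x \<sigma>) (\<phi> \<sigma>) f t)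
      \<le> (C + C\<^sub>2 * C + C\<^sub>1 * C + 1) * nrm ((I_minus_steklov_fwd (\<gamma> / \<sigma>) ^^ s) f)"
    if f: "f \<in> X" and \<sigma>: "\<sigma> \<ge> 1" for f \<sigma>
  proof -
    define h where "h = \<gamma> / \<sigma>"
    have h: "h > 0" unfolding h_def using \<open>\<gamma> > 0\<close> \<sigma> by simp
    define K where "K = kantorovich X nrm h r (x \<sigma>) (\<phi> \<sigma>)"
    define w where "w = nrm ((I_minus_steklov_fwd h ^^ s) f)"
    have w: "w \<ge> 0"
      unfolding w_def I_minus_steklov_fwd_residual[OF h]
      by (intro nrm_nonneg residual_power_mem decaying_box h f)
    (* f - K f = (f - g) + (g - K g) + (K g - K f) with g from the approximation lemma. *)
    obtain g where g: "g \<in> band_limited X \<sigma>" "nrm (\<lambda>x. f x - g x) \<le> C * w" "nrm (nth_deriv s g) \<le> C * \<sigma> ^ s * w"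
      using app[OF f, of \<sigma>] \<sigma> unfolding w_def h_def by auto
    have gX: "g \<in> X" using g(1) by (simp add: band_limited_def)
    have fg: "(\<lambda>t. f t - g t) \<in> X" by (intro diff_mem f gX)
    have K: "kantorovich_sum X nrm h r (x \<sigma>) (\<phi> \<sigma>) u (K u)" if "u \<in> X" for u
      unfolding K_def kantorovich_def using series[OF \<sigma> that] unfolding h_def by (rule someI_ex)
    have KX: "K u \<in> X" if "u \<in> X" for u using K[OF that] by (simp add: kantorovich_sum_def)
    have \<phi>X: "\<phi> \<sigma> k \<in> X" for k
    proof -
      have "\<sigma> \<ge> 0" using \<sigma> by simp
      from \<open>bernstein_family X nrm \<Phi>\<close>[unfolded bernstein_family_def, THEN conjunct1, THEN spec, THEN mp, OF this]
      have "\<Phi> \<sigma> \<subseteq> X" by (rule conjunct1)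
      with kernels[OF \<sigma>] show ?thesis by blast
    qed
    have 1: "nrm (\<lambda>t. K f t - K g t) \<le> C\<^sub>1 * (C * w)"
    proof -
      have "nrm (\<lambda>t. K f t - K g t) = nrm (K (\<lambda>t. f t - g t))"
        by (rule kantorovich_sum_diff[OF h f gX \<phi>X K[OF f] K[OF gX] K[OF fg]])
      also have "\<dots> \<le> C\<^sub>1 * nrm (\<lambda>t. f t - g t)"
        unfolding K_def h_def by (rule bounded[OF fg \<sigma>])
      also have "\<dots> \<le> C\<^sub>1 * (C * w)" using \<open>C\<^sub>1 > 0\<close> by (intro mult_left_mono g) simp
      finally show ?thesis .
    qed
    have 2: "nrm (\<lambda>t. g t - K g t) \<le> C\<^sub>2 * (C * w)"
    proof -
      have "nrm (\<lambda>t. g t - K g t) \<le> C\<^sub>2 * \<sigma> powr (- real s) * nrm (nth_deriv s g)"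
        unfolding K_def h_def by (rule approx[OF \<sigma> g(1)])
      also have "\<dots> \<le> C\<^sub>2 * \<sigma> powr (- real s) * (C * \<sigma> ^ s * w)"
        using \<open>C\<^sub>2 > 0\<close> by (intro mult_left_mono g) auto
      also have "\<dots> = C\<^sub>2 * (C * w) * (\<sigma> powr (- real s) * \<sigma> ^ s)" by simp
      also have "\<sigma> powr (- real s) * \<sigma> ^ s = 1"
        using \<sigma> by (simp add: powr_minus powr_realpow)
      finally show ?thesis by simp
    qed
    have "nrm (\<lambda>t. f t - K f t) \<le> nrm (\<lambda>t. f t - g t) + nrm (\<lambda>t. g t - K f t)"
      by (rule nrm_diff_triangle[OF f gX KX[OF f]])
    also have "nrm (\<lambda>t. g t - K f t) \<le> nrm (\<lambda>t. g t - K g t) + nrm (\<lambda>t. K g t - K f t)"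
      by (rule nrm_diff_triangle[OF gX KX[OF gX] KX[OF f]])
    also have "nrm (\<lambda>t. K g t - K f t) = nrm (\<lambda>t. K f t - K g t)"
      by (rule nrm_minus[OF KX[OF gX] KX[OF f]])
    finally have "nrm (\<lambda>t. f t - K f t) \<le> C * w + (C\<^sub>2 * (C * w) + C\<^sub>1 * (C * w))"
      using 1 2 g(2) by linarith
    also have "\<dots> \<le> (C + C\<^sub>2 * C + C\<^sub>1 * C + 1) * w" using w by (simp add: algebra_simps)
    finally show ?thesis unfolding K_def w_def h_def .
  qed
  moreover have "C + C\<^sub>2 * C + C\<^sub>1 * C + 1 > 0"
    using C \<open>C\<^sub>1 > 0\<close> \<open>C\<^sub>2 > 0\<close> by (simp add: add_nonneg_pos)
  ultimately show ?thesis by blast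
qed

end
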